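(* Let $j\ge 2$ be an integer and let $u$ be the solution of $u''(t)+\alpha u'(t)+Au(t)=0$ for $t>0$, with $u(0)=u_0$, $u'(0)=u_1$, where the data are sufficiently regular that $u\in C^{j}([0,\infty);L^2(\Omega))\cap C^{j-1}([0,\infty);D(A^{1/2}))$. Define $$\mathcal{E}^{(j)}(u)(t)=\tfrac12\left(\|u^{(j)}(t)\|^2+\|A^{1/2}u^{(j-1)}(t)\|^2\right),$$ where $u^{(j)}$ denotes the $j$-th time derivative of $u$. Then for every $\delta$ with $0<\delta\le \frac13\min\left(\alpha,\frac{\lambda_1}{2\alpha}\right)$, $$\mathcal{E}^{(j)}(u)(t)\le 3\,e^{-2\delta t}\,\mathcal{E}^{(j)}(u)(0),\qquad t\ge 0.$$
   Context: $\Omega\subset\mathbb{R}^d$ is a convex polygonal or polyhedral domain and $\alpha>0$ is a fixed constant. $\mathbf{A}(x)$ is a real symmetric, uniformly positive definite matrix and $a_0(x)\ge 0$, with smooth coefficients. $(\cdot,\cdot)$ and $\|\cdot\|$ are the inner product and norm of $L^2(\Omega)$. $A$ is the self-adjoint positive definite operator on $L^2(\Omega)$ given by $A\phi=-\nabla\cdot(\mathbf{A}(x)\nabla\phi)+a_0(x)\phi$ with domain $D(A)=H^2(\Omega)\cap H^1_0(\Omega)$; $D(A^{1/2})=H^1_0(\Omega)$, and $a(v,w):=(A^{1/2}v,A^{1/2}w)=(\mathbf{A}\nabla v,\nabla w)+(a_0v,w)$ for $v,w\in H_0^1(\Omega)$. $\lambda_1>0$ is the principal (smallest) eigenvalue of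 $A$. The equation is understood in the weak form $(u'',\chi)+\alpha(u',\chi)+a(u,\chi)=0$ for all $\chi\in D(A^{1/2})$. *)

theory Defs
  imports "HOL-Analysis.Analysis"
begin

text \<open>
  Elements of \<open>L\<^sup>2(\<Omega>)\<close> are represented by functions on the whole space; only their restriction to
  \<open>\<Omega>\<close>, up to Lebesgue null sets, is relevant. Equality in \<open>L\<^sup>2(\<Omega>)\<close> is written \<open>aeq \<Omega>\<close>.
\<close>

type_synonym 'n fld = "real^'n \<Rightarrow> real"

definition L2 :: "(real^'n) set \<Rightarrow> ('n::finite) fld set" where
  "L2 \<Omega> = {f. f \<in> borel_measurable (lebesgue_on \<Omega>) \<and> integrable (lebesgue_on \<Omega>) (\<lambda>x. (f x)\<^sup>2)}"

definition ip :: "(real^'n) set \<Rightarrow> ('n::finite) fld \<Rightarrow> 'n fld \<Rightarrow> real" where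
  "ip \<Omega> f g = (LINT x|lebesgue_on \<Omega>. f x * g x)"

definition nrm :: "(real^'n) set \<Rightarrow> ('n::finite) fld \<Rightarrow> real" where
  "nrm \<Omega> f = sqrt (ip \<Omega> f f)"

definition aeq :: "(real^'n) set \<Rightarrow> ('n::finite) fld \<Rightarrow> 'n fld \<Rightarrow> bool" where
  "aeq \<Omega> f g \<longleftrightarrow> (AE x in lebesgue_on \<Omega>. f x = g x)"


section \<open>Smooth functions, weak derivatives and Sobolev spaces\<close>

definition pderiv_at :: "'n \<Rightarrow> ('n::finite) fld \<Rightarrow> 'n fld" where
  "pderiv_at i f = (\<lambda>x. frechet_derivative f (at x) (axis i 1))"

text \<open>\<open>C\<^sup>k\<close> on \<open>S\<close>; only meant for open \<open>S\<close>.\<close>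

primrec Ck_on :: "nat \<Rightarrow> (real^'n) set \<Rightarrow> ('n::finite) fld \<Rightarrow> bool" where
  "Ck_on 0 S f \<longleftrightarrow> continuous_on S f"
| "Ck_on (Suc k) S f \<longleftrightarrow> (\<forall>x\<in>S. f differentiable (at x)) \<and> (\<forall>i. Ck_on k S (pderiv_at i f))"

definition smooth_on :: "(real^'n) set \<Rightarrow> ('n::finite) fld \<Rightarrow> bool" where
  "smooth_on S f \<longleftrightarrow> (\<forall>k. Ck_on k S f)"

text \<open>Smoothness up to the boundary.\<close>

definition smooth_closure :: "(real^'n) set \<Rightarrow> ('n::finite) fld \<Rightarrow> bool" where
  "smooth_closure \<Omega> f \<longleftrightarrow> (\<exists>U. open U \<and> closure \<Omega> \<subseteq> U \<and> smooth_on U f)"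

definition test_functions :: "(real^'n) set \<Rightarrow> ('n::finite) fld set" where
  "test_functions \<Omega> =
     {\<psi>. smooth_on UNIV \<psi> \<and> (\<exists>K. compact K \<and> K \<subseteq> \<Omega> \<and> (\<forall>x. x \<notin> K \<longrightarrow> \<psi> x = 0))}"

definition has_weak_pderiv :: "(real^'n) set \<Rightarrow> 'n \<Rightarrow> ('n::finite) fld \<Rightarrow> 'n fld \<Rightarrow> bool" where
  "has_weak_pderiv \<Omega> i f g \<longleftrightarrow>
     f \<in> L2 \<Omega> \<and> g \<in> L2 \<Omega> \<and> (\<forall>\<psi>\<in>test_functions \<Omega>. ip \<Omega> f (pderiv_at i \<psi>) = - ip \<Omega> g \<psi>)"

text \<open>On open sets weak derivatives are unique up to null sets, so the choice below is immaterial
  in \<open>L\<^sup>2(\<Omega>)\<close>.\<close>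

definition wpd :: "(real^'n) set \<Rightarrow> 'n \<Rightarrow> ('n::finite) fld \<Rightarrow> 'n fld" where
  "wpd \<Omega> i f = (SOME g. has_weak_pderiv \<Omega> i f g)"

definition wgrad :: "(real^'n) set \<Rightarrow> ('n::finite) fld \<Rightarrow> real^'n \<Rightarrow> real^'n" where
  "wgrad \<Omega> f = (\<lambda>x. \<chi> i. wpd \<Omega> i f x)"

definition wdiv :: "(real^'n) set \<Rightarrow> (real^'n \<Rightarrow> real^'n) \<Rightarrow> ('n::finite) fld" where
  "wdiv \<Omega> F = (\<lambda>x. \<Sum>i\<in>UNIV. wpd \<Omega> i (\<lambda>y. F y $ i) x)"

definition H1 :: "(real^'n) set \<Rightarrow> ('n::finite) fld set" where
  "H1 \<Omega> = {f \<in> L2 \<Omega>. \<forall>i. \<exists>g. has_weak_pderiv \<Omega> i f g}"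

definition H2 :: "(real^'n) set \<Rightarrow> ('n::finite) fld set" where
  "H2 \<Omega> = {f \<in> H1 \<Omega>. \<forall>i. wpd \<Omega> i f \<in> H1 \<Omega>}"

definition H1_norm :: "(real^'n) set \<Rightarrow> ('n::finite) fld \<Rightarrow> real" where
  "H1_norm \<Omega> f = sqrt ((nrm \<Omega> f)\<^sup>2 + (\<Sum>i\<in>UNIV. (nrm \<Omega> (wpd \<Omega> i f))\<^sup>2))"

definition H10 :: "(real^'n) set \<Rightarrow> ('n::finite) fld set" where
  "H10 \<Omega> = {f \<in> H1 \<Omega>. \<forall>e>0. \<exists>\<psi>\<in>test_functions \<Omega>. H1_norm \<Omega> (\<lambda>x. f x - \<psi> x) < e}"


section \<open>Unbounded operators on the space of square integrable functions\<close>

text \<open>An operator is a pair of a domain \<open>D\<close> and a map \<open>T\<close> whose values outside \<open>D\<close> are irrelevant.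
  The last conjunct of \<open>self_adjoint\<close> says that \<open>T\<close> coincides with its adjoint, domains included.\<close>

definition linear_operator ::
  "(real^'n) set \<Rightarrow> ('n::finite) fld set \<Rightarrow> ('n fld \<Rightarrow> 'n fld) \<Rightarrow> bool" where
  "linear_operator \<Omega> D T \<longleftrightarrow>
     D \<subseteq> L2 \<Omega> \<and> T ` D \<subseteq> L2 \<Omega> \<and> (\<lambda>x. 0) \<in> D \<and>
     (\<forall>f\<in>D. \<forall>g\<in>D. \<forall>c. (\<lambda>x. c * f x + g x) \<in> D \<and>
        aeq \<Omega> (T (\<lambda>x. c * f x + g x)) (\<lambda>x. c * T f x + T g x))"

definition self_adjoint ::
  "(real^'n) set \<Rightarrow> ('n::finite) fld set \<Rightarrow> ('n fld \<Rightarrow> 'n fld) \<Rightarrow> bool" where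
  "self_adjoint \<Omega> D T \<longleftrightarrow>
     linear_operator \<Omega> D T \<and>
     (\<forall>f\<in>L2 \<Omega>. \<forall>e>0. \<exists>g\<in>D. nrm \<Omega> (\<lambda>x. f x - g x) < e) \<and>
     (\<forall>f\<in>L2 \<Omega>. \<forall>h\<in>L2 \<Omega>.
        (f \<in> D \<and> aeq \<Omega> (T f) h) \<longleftrightarrow> (\<forall>g\<in>D. ip \<Omega> f (T g) = ip \<Omega> h g))"

text \<open>\<open>B\<close>, with domain \<open>DB\<close>, is the nonnegative self-adjoint square root of \<open>A\<close>, with domain \<open>DA\<close>:
  \<open>B \<circ> B = A\<close> as unbounded operators.\<close>

definition is_sqrt_operator :: "(real^'n) set \<Rightarrow>
    ('n::finite) fld set \<Rightarrow> ('n fld \<Rightarrow> 'n fld) \<Rightarrow> 'n fld set \<Rightarrow> ('n fld \<Rightarrow> 'n fld) \<Rightarrow> bool" where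
  "is_sqrt_operator \<Omega> DB B DA A \<longleftrightarrow>
     self_adjoint \<Omega> DB B \<and> (\<forall>f\<in>DB. ip \<Omega> (B f) f \<ge> 0) \<and>
     DA = {f \<in> DB. B f \<in> DB} \<and> (\<forall>f\<in>DA. aeq \<Omega> (B (B f)) (A f))"

definition is_eigenvalue ::
  "(real^'n) set \<Rightarrow> ('n::finite) fld set \<Rightarrow> ('n fld \<Rightarrow> 'n fld) \<Rightarrow> real \<Rightarrow> bool" where
  "is_eigenvalue \<Omega> D T l \<longleftrightarrow>
     (\<exists>\<phi>\<in>D. \<not> aeq \<Omega> \<phi> (\<lambda>x. 0) \<and> aeq \<Omega> (T \<phi>) (\<lambda>x. l * \<phi> x))"

definition is_smallest_eigenvalue ::
  "(real^'n) set \<Rightarrow> ('n::finite) fld set \<Rightarrow> ('n fld \<Rightarrow> 'n fld) \<Rightarrow> real \<Rightarrow> bool" where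
  "is_smallest_eigenvalue \<Omega> D T l \<longleftrightarrow>
     is_eigenvalue \<Omega> D T l \<and> (\<forall>m. is_eigenvalue \<Omega> D T m \<longrightarrow> l \<le> m)"


section \<open>The elliptic operator\<close>

definition convex_polytopal_domain :: "(real^'n::finite) set \<Rightarrow> bool" where
  "convex_polytopal_domain \<Omega> \<longleftrightarrow> \<Omega> \<noteq> {} \<and> (\<exists>P. polytope P \<and> \<Omega> = interior P)"

definition admissible_coefficients ::
  "(real^'n) set \<Rightarrow> (real^'n \<Rightarrow> real^'n^'n) \<Rightarrow> ('n::finite) fld \<Rightarrow> bool" where
  "admissible_coefficients \<Omega> M a0 \<longleftrightarrow>
     (\<forall>i k. smooth_closure \<Omega> (\<lambda>x. M x $ i $ k)) \<and> smooth_closure \<Omega> a0 \<and>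
     (\<forall>x\<in>\<Omega>. transpose (M x) = M x) \<and>
     (\<exists>c>0. \<forall>x\<in>\<Omega>. \<forall>\<xi>. c * (norm \<xi>)\<^sup>2 \<le> \<xi> \<bullet> (M x *v \<xi>)) \<and>
     (\<forall>x\<in>\<Omega>. a0 x \<ge> 0)"

definition elliptic_op ::
  "(real^'n) set \<Rightarrow> (real^'n \<Rightarrow> real^'n^'n) \<Rightarrow> ('n::finite) fld \<Rightarrow> 'n fld \<Rightarrow> 'n fld" where
  "elliptic_op \<Omega> M a0 \<phi> = (\<lambda>x. - wdiv \<Omega> (\<lambda>y. M y *v wgrad \<Omega> \<phi> y) x + a0 x * \<phi> x)"

definition elliptic_dom :: "(real^'n) set \<Rightarrow> ('n::finite) fld set" where
  "elliptic_dom \<Omega> = H2 \<Omega> \<inter> H10 \<Omega>"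

text \<open>The graph norm of \<open>B\<close>, i.e. the norm of \<open>D(sqrt A)\<close> when \<open>B = sqrt A\<close>.\<close>

definition graph_norm ::
  "(real^'n) set \<Rightarrow> (('n::finite) fld \<Rightarrow> 'n fld) \<Rightarrow> 'n fld \<Rightarrow> real" where
  "graph_norm \<Omega> B f = sqrt ((nrm \<Omega> f)\<^sup>2 + (nrm \<Omega> (B f))\<^sup>2)"

definition energy_form ::
  "(real^'n) set \<Rightarrow> (('n::finite) fld \<Rightarrow> 'n fld) \<Rightarrow> 'n fld \<Rightarrow> 'n fld \<Rightarrow> real" where
  "energy_form \<Omega> B v w = ip \<Omega> (B v) (B w)"


section \<open>Time-dependent functions\<close>

text \<open>Derivative of \<open>u : [0,\<infinity>) \<rightarrow> X\<close> at \<open>t \<ge> 0\<close> with respect to the norm \<open>N\<close> of \<open>X\<close>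
  (one-sided at \<open>t = 0\<close>).\<close>

definition has_time_deriv ::
  "('n fld \<Rightarrow> real) \<Rightarrow> (real \<Rightarrow> ('n::finite) fld) \<Rightarrow> 'n fld \<Rightarrow> real \<Rightarrow> bool" where
  "has_time_deriv N u v t \<longleftrightarrow>
     ((\<lambda>s. N (\<lambda>x. (u s x - u t x) / (s - t) - v x)) \<longlongrightarrow> 0) (at t within {0..})"

text \<open>\<open>u \<in> C\<^sup>k([0,\<infinity>); X)\<close> for the space \<open>X\<close> with norm \<open>N\<close>.\<close>

primrec C_time :: "('n::finite) fld set \<Rightarrow> ('n fld \<Rightarrow> real) \<Rightarrow> nat \<Rightarrow> (real \<Rightarrow> 'n fld) \<Rightarrow> bool" where
  "C_time X N 0 u \<longleftrightarrow>
     (\<forall>t\<ge>0. u t \<in> X \<and> ((\<lambda>s. N (\<lambda>x. u s x - u t x)) \<longlongrightarrow> 0) (at t within {0..}))"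
| "C_time X N (Suc k) u \<longleftrightarrow>
     (\<forall>t\<ge>0. u t \<in> X) \<and> (\<exists>v. (\<forall>t\<ge>0. has_time_deriv N u (v t) t) \<and> C_time X N k v)"

text \<open>The \<open>k\<close>-th time derivative in \<open>L\<^sup>2(\<Omega>)\<close>, chosen up to null sets.\<close>

primrec time_deriv ::
  "(real^'n) set \<Rightarrow> nat \<Rightarrow> (real \<Rightarrow> ('n::finite) fld) \<Rightarrow> real \<Rightarrow> 'n fld" where
  "time_deriv \<Omega> 0 u = u"
| "time_deriv \<Omega> (Suc k) u =
     (\<lambda>t. SOME v. v \<in> L2 \<Omega> \<and> has_time_deriv (nrm \<Omega>) (time_deriv \<Omega> k u) v t)"

text \<open>Solution of \<open>u'' + \<alpha> u' + A u = 0\<close> for \<open>t > 0\<close>, in the weak form, where \<open>B = sqrt A\<close> has domain \<open>V\<close>.\<close>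

definition weak_damped_wave :: "(real^'n) set \<Rightarrow> ('n::finite) fld set \<Rightarrow>
    ('n fld \<Rightarrow> 'n fld) \<Rightarrow> real \<Rightarrow> (real \<Rightarrow> 'n fld) \<Rightarrow> bool" where
  "weak_damped_wave \<Omega> V B \<alpha> u \<longleftrightarrow>
     (\<forall>t>0. \<forall>w\<in>V. ip \<Omega> (time_deriv \<Omega> 2 u t) w + \<alpha> * ip \<Omega> (time_deriv \<Omega> 1 u t) w
        + energy_form \<Omega> B (u t) w = 0)"

definition energy :: "(real^'n) set \<Rightarrow> (('n::finite) fld \<Rightarrow> 'n fld) \<Rightarrow> nat \<Rightarrow>
    (real \<Rightarrow> 'n fld) \<Rightarrow> real \<Rightarrow> real" where
  "energy \<Omega> B j u t =
     1/2 * ((nrm \<Omega> (time_deriv \<Omega> j u t))\<^sup>2 + (nrm \<Omega> (B (time_deriv \<Omega> (j - 1) u t)))\<^sup>2)"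

end

theory Submission
  imports Defs
begin

text \<open>
  Put \<open>z = u\<^sup>(\<^sup>j\<^sup>-\<^sup>2\<^sup>)\<close>. Differentiating the weak equation shows that \<open>z\<close> is again a weak solution, and the
  energy in question is that of \<open>z'\<close>. For a solution \<open>w\<close> for which \<open>w'\<close> is an admissible test function
  one uses the Lyapunov function
  \<open>F = (\<parallel>w'\<parallel>\<^sup>2 + \<parallel>B w\<parallel>\<^sup>2) / 2 + \<kappa> (w, w') + \<kappa> \<alpha> \<parallel>w\<parallel>\<^sup>2 / 2\<close> with \<open>B = sqrt A\<close> and \<open>\<kappa> = 3 \<delta> / 2\<close>: testing with \<open>w'\<close> and
  \<open>w\<close> gives \<open>F' = - (\<alpha> - \<kappa>) \<parallel>w'\<parallel>\<^sup>2 - \<kappa> \<parallel>B w\<parallel>\<^sup>2 \<le> - 2 \<delta> F\<close>, while \<open>F\<close> lies between \<open>1/2\<close> and \<open>3/2\<close> times the energy.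
  Since \<open>z'\<close> itself is not that regular, this is applied to the difference quotients of \<open>z\<close>.

  The bound \<open>\<parallel>B f\<parallel>\<^sup>2 \<ge> \<lambda>\<^sub>1 \<parallel>f\<parallel>\<^sup>2\<close> needs that the infimum of the Rayleigh quotient is an eigenvalue. Minimizing
  sequences converge by a quantitative Rellich theorem on a grid of cubes, first for test functions
  and then on the whole form domain, where test functions are dense in the graph norm of \<open>B\<close>.
\<close>


section \<open>The space of square integrable functions\<close>

text \<open>The root \<open>B\<close> is known only abstractly: self-adjoint with domain
  \<open>H10\<close> and \<open>B o B = A\<close>. That the squared norm of \<open>B f\<close> is
  comparable with the gradient is not given, and neither is the spectral bound by
  \<open>lam1\<close>, which enters only as the smallest eigenvalue of \<open>A\<close>. Both are
  recovered from test functions: they lie in the domain of \<open>A\<close>, where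
  \<open>B (B \<psi>)\<close> can be integrated by parts. The resulting bounds reach all of
  \<open>H10\<close> because a self-adjoint operator is closed. A second obstacle is that functions
  stand for their classes. Weak and time derivatives are chosen by \<open>SOME\<close>, so
  identities hold only almost everywhere, and their transfer through \<open>B\<close> needs the
  adjoint criterion for its domain. Each half of the minimum in the bound on \<delta> has its own
  task: \<delta> \<le> \<alpha>/3 absorbs the \<open>w'\<close> part of the cross term, and \<delta>
  \<le> \<open>lam1\<close>/(6\<alpha>) absorbs the norm of \<open>w\<close> into that of
  \<open>B w\<close>. The factor 3 of the theorem is the quotient of 3/2 and 1/2. Difference
  quotients at time 0 need the equation there, while it is posed only for positive times; continuity
  of the highest derivative closes this gap.\<close>

lemma L2_measurable: "f \<in> L2 \<Omega> \<Longrightarrow> f \<in> borel_measurable (lebesgue_on \<Omega>)"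
  by (simp add: L2_def)

lemma L2_integrable_mult:
  assumes "f \<in> L2 \<Omega>" "g \<in> L2 \<Omega>"
  shows "integrable (lebesgue_on \<Omega>) (\<lambda>x. f x * g x)"
proof (rule Bochner_Integration.integrable_bound)
  show "integrable (lebesgue_on \<Omega>) (\<lambda>x. (f x)\<^sup>2 + (g x)\<^sup>2)"
    using assms by (auto simp: L2_def)
  show "(\<lambda>x. f x * g x) \<in> borel_measurable (lebesgue_on \<Omega>)"
    using assms by (auto simp: L2_def)
  have "norm (a * b) \<le> norm (a\<^sup>2 + b\<^sup>2)" for a b :: real
  proof -
    have "2 * (\<bar>a\<bar> * \<bar>b\<bar>) \<le> a\<^sup>2 + b\<^sup>2"
      using sum_squares_bound[of "\<bar>a\<bar>" "\<bar>b\<bar>"] by simp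
    moreover have "0 \<le> \<bar>a\<bar> * \<bar>b\<bar>" by simp
    ultimately have "\<bar>a\<bar> * \<bar>b\<bar> \<le> a\<^sup>2 + b\<^sup>2" by linarith
    then show ?thesis by (simp add: abs_mult)
  qed
  then show "AE x in lebesgue_on \<Omega>. norm (f x * g x) \<le> norm ((f x)\<^sup>2 + (g x)\<^sup>2)"
    by simp
qed

lemma L2_zero [simp]: "(\<lambda>x. 0) \<in> L2 \<Omega>"
  by (simp add: L2_def)

lemma L2_add:
  assumes "f \<in> L2 \<Omega>" "g \<in> L2 \<Omega>"
  shows "(\<lambda>x. f x + g x) \<in> L2 \<Omega>"
proof -
  have "integrable (lebesgue_on \<Omega>) (\<lambda>x. (f x)\<^sup>2 + (g x)\<^sup>2 + 2 * (f x * g x))"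
    using L2_integrable_mult[OF assms] assms by (auto simp: L2_def)
  also have "(\<lambda>x. (f x)\<^sup>2 + (g x)\<^sup>2 + 2 * (f x * g x)) = (\<lambda>x. (f x + g x)\<^sup>2)"
    by (simp add: power2_sum mult.assoc)
  finally show ?thesis using assms by (auto simp: L2_def intro: borel_measurable_add)
qed

lemma L2_scale: "f \<in> L2 \<Omega> \<Longrightarrow> (\<lambda>x. c * f x) \<in> L2 \<Omega>"
  by (auto simp: L2_def power_mult_distrib intro: borel_measurable_times)

lemma L2_uminus: "f \<in> L2 \<Omega> \<Longrightarrow> (\<lambda>x. - f x) \<in> L2 \<Omega>"
  by (simp add: L2_def)

lemma L2_diff: "f \<in> L2 \<Omega> \<Longrightarrow> g \<in> L2 \<Omega> \<Longrightarrow> (\<lambda>x. f x - g x) \<in> L2 \<Omega>"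
  using L2_add[of f \<Omega> "\<lambda>x. - g x"] L2_uminus[of g \<Omega>] by simp

lemma L2_divide: "f \<in> L2 \<Omega> \<Longrightarrow> (\<lambda>x. f x / c) \<in> L2 \<Omega>"
  using L2_scale[of f \<Omega> "1/c"] by simp

lemma L2_sum: "(\<And>i. i \<in> I \<Longrightarrow> f i \<in> L2 \<Omega>) \<Longrightarrow> (\<lambda>x. \<Sum>i\<in>I. f i x) \<in> L2 \<Omega>"
  by (induction I rule: infinite_finite_induct) (auto intro: L2_add)

lemmas L2_intros = L2_zero L2_add L2_scale L2_uminus L2_diff L2_divide L2_sum

lemma L2_cong_AE:
  assumes "f \<in> L2 \<Omega>" "aeq \<Omega> f g" "g \<in> borel_measurable (lebesgue_on \<Omega>)"
  shows "g \<in> L2 \<Omega>"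
proof -
  have "integrable (lebesgue_on \<Omega>) (\<lambda>x. (g x)\<^sup>2)"
  proof (rule integrable_cong_AE_imp)
    show "integrable (lebesgue_on \<Omega>) (\<lambda>x. (f x)\<^sup>2)" using assms(1) by (simp add: L2_def)
    show "AE x in lebesgue_on \<Omega>. (f x)\<^sup>2 = (g x)\<^sup>2"
      using assms(2) unfolding aeq_def by (rule eventually_mono) simp
  qed (use assms(3) in simp)
  then show ?thesis using assms(3) by (simp add: L2_def)
qed

section \<open>Inner product and norm\<close>

lemma ip_commute: "ip \<Omega> f g = ip \<Omega> g f"
  by (simp add: ip_def mult.commute)

lemma ip_add_left:
  "f \<in> L2 \<Omega> \<Longrightarrow> g \<in> L2 \<Omega> \<Longrightarrow> h \<in> L2 \<Omega> \<Longrightarrow> ip \<Omega> (\<lambda>x. f x + g x) h = ip \<Omega> f h + ip \<Omega> g h"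
  by (simp add: ip_def distrib_right L2_integrable_mult)

lemma ip_diff_left:
  "f \<in> L2 \<Omega> \<Longrightarrow> g \<in> L2 \<Omega> \<Longrightarrow> h \<in> L2 \<Omega> \<Longrightarrow> ip \<Omega> (\<lambda>x. f x - g x) h = ip \<Omega> f h - ip \<Omega> g h"
  by (simp add: ip_def left_diff_distrib L2_integrable_mult)

lemma ip_scale_left [simp]: "ip \<Omega> (\<lambda>x. c * f x) h = c * ip \<Omega> f h"
  by (simp add: ip_def mult.assoc)

lemma ip_divide_left [simp]: "ip \<Omega> (\<lambda>x. f x / c) h = ip \<Omega> f h / c"
  using ip_scale_left[of \<Omega> "1/c" f h] by simp

lemma ip_uminus_left [simp]: "ip \<Omega> (\<lambda>x. - f x) h = - ip \<Omega> f h"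
  by (simp add: ip_def)

lemma ip_zero_left [simp]: "ip \<Omega> (\<lambda>x. 0) h = 0"
  by (simp add: ip_def)

lemma ip_sum_left:
  "(\<And>i. i \<in> I \<Longrightarrow> f i \<in> L2 \<Omega>) \<Longrightarrow> h \<in> L2 \<Omega> \<Longrightarrow>
    ip \<Omega> (\<lambda>x. \<Sum>i\<in>I. f i x) h = (\<Sum>i\<in>I. ip \<Omega> (f i) h)"
  by (induction I rule: infinite_finite_induct) (auto simp: ip_add_left L2_sum)

lemma ip_add_right:
  "f \<in> L2 \<Omega> \<Longrightarrow> g \<in> L2 \<Omega> \<Longrightarrow> h \<in> L2 \<Omega> \<Longrightarrow> ip \<Omega> h (\<lambda>x. f x + g x) = ip \<Omega> h f + ip \<Omega> h g"
  by (simp add: ip_commute[of \<Omega> h] ip_add_left)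

lemma ip_diff_right:
  "f \<in> L2 \<Omega> \<Longrightarrow> g \<in> L2 \<Omega> \<Longrightarrow> h \<in> L2 \<Omega> \<Longrightarrow> ip \<Omega> h (\<lambda>x. f x - g x) = ip \<Omega> h f - ip \<Omega> h g"
  by (simp add: ip_commute[of \<Omega> h] ip_diff_left)

lemma ip_scale_right [simp]: "ip \<Omega> h (\<lambda>x. c * f x) = c * ip \<Omega> h f"
  by (simp add: ip_commute[of \<Omega> h])

lemma ip_divide_right [simp]: "ip \<Omega> h (\<lambda>x. f x / c) = ip \<Omega> h f / c"
  by (simp add: ip_commute[of \<Omega> h])

lemma ip_uminus_right [simp]: "ip \<Omega> h (\<lambda>x. - f x) = - ip \<Omega> h f"
  by (simp add: ip_commute[of \<Omega> h])

lemma ip_zero_right [simp]: "ip \<Omega> h (\<lambda>x. 0) = 0"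
  by (simp add: ip_def)

lemma ip_sum_right:
  "(\<And>i. i \<in> I \<Longrightarrow> f i \<in> L2 \<Omega>) \<Longrightarrow> h \<in> L2 \<Omega> \<Longrightarrow>
    ip \<Omega> h (\<lambda>x. \<Sum>i\<in>I. f i x) = (\<Sum>i\<in>I. ip \<Omega> h (f i))"
  by (simp add: ip_commute[of \<Omega> h] ip_sum_left)

lemmas ip_linear = ip_add_left ip_add_right ip_diff_left ip_diff_right ip_sum_left ip_sum_right

lemma ip_self_nonneg [simp]: "0 \<le> ip \<Omega> f f"
  by (auto simp: ip_def intro: Bochner_Integration.integral_nonneg)

lemma nrm_nonneg [simp]: "0 \<le> nrm \<Omega> f"
  by (simp add: nrm_def)

lemma nrm_square: "(nrm \<Omega> f)\<^sup>2 = ip \<Omega> f f"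
  by (simp add: nrm_def)

lemma nrm_scale: "nrm \<Omega> (\<lambda>x. c * f x) = \<bar>c\<bar> * nrm \<Omega> f"
  by (simp add: nrm_def real_sqrt_mult flip: mult.assoc)

lemma nrm_divide: "nrm \<Omega> (\<lambda>x. f x / c) = nrm \<Omega> f / \<bar>c\<bar>"
  using nrm_scale[of \<Omega> "1/c" f] by simp

lemma nrm_minus_commute: "nrm \<Omega> (\<lambda>x. f x - g x) = nrm \<Omega> (\<lambda>x. g x - f x)"
  by (simp add: nrm_def ip_def algebra_simps)

lemma ip_square_add:
  "f \<in> L2 \<Omega> \<Longrightarrow> g \<in> L2 \<Omega> \<Longrightarrow>
    ip \<Omega> (\<lambda>x. f x + g x) (\<lambda>x. f x + g x) = ip \<Omega> f f + 2 * ip \<Omega> f g + ip \<Omega> g g"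
  by (simp add: ip_linear L2_intros ip_commute[of \<Omega> g f])

lemma ip_square_diff:
  "f \<in> L2 \<Omega> \<Longrightarrow> g \<in> L2 \<Omega> \<Longrightarrow>
    ip \<Omega> (\<lambda>x. f x - g x) (\<lambda>x. f x - g x) = ip \<Omega> f f - 2 * ip \<Omega> f g + ip \<Omega> g g"
  by (simp add: ip_linear L2_intros ip_commute[of \<Omega> g f])

text \<open>For small \<open>t\<close> the linear term dominates. Besides the degenerate cases of
  Cauchy-Schwarz, this yields the Euler-Lagrange equation of the Rayleigh quotient.\<close>

lemma quadratic_nonneg_imp_linear_zero:
  fixes b c :: real
  assumes "\<And>t. 0 \<le> 2 * t * b + t\<^sup>2 * c"
  shows "b = 0"
proof (rule ccontr)
  assume b: "b \<noteq> 0"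
  \<comment> \<open>A positive number above \<open>c\<close>, whatever the sign of \<open>c\<close>,
    so that \<open>c - 2 * k\<close> is negative and \<open>t = - b / k\<close> refutes the
    assumption.\<close>
  define k where "k = \<bar>c\<bar> + 1"
  have k: "k > 0" "c < k" by (auto simp: k_def)
  have "0 \<le> 2 * (- b / k) * b + (- b / k)\<^sup>2 * c" by (rule assms)
  also have "\<dots> = (b\<^sup>2 / k\<^sup>2) * (c - 2 * k)"
    using k by (simp add: field_simps power2_eq_square)
  finally have "0 \<le> (b\<^sup>2 / k\<^sup>2) * (c - 2 * k)" .
  moreover have "(b\<^sup>2 / k\<^sup>2) * (c - 2 * k) < 0"
    using b k by (intro mult_pos_neg) auto
  ultimately show False by linarith
qed

text \<open>The squared norm of \<open>f + t * g\<close> is a nonnegative quadratic in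
  \<open>t\<close>. If \<open>ip \<Omega> g g\<close> is positive, its minimizer gives the bound; as
  \<open>ip\<close> is only semidefinite on functions, a factor of norm zero is treated apart and
  forces \<open>ip \<Omega> f g = 0\<close>.\<close>

lemma Cauchy_Schwarz_ip:
  assumes f: "f \<in> L2 \<Omega>" and g: "g \<in> L2 \<Omega>"
  shows "\<bar>ip \<Omega> f g\<bar> \<le> nrm \<Omega> f * nrm \<Omega> g"
proof -
  have q: "0 \<le> ip \<Omega> f f + 2 * t * ip \<Omega> f g + t\<^sup>2 * ip \<Omega> g g" for t
    using ip_self_nonneg[of \<Omega> "\<lambda>x. f x + t * g x"]
    by (simp add: ip_square_add f g L2_scale power2_eq_square algebra_simps)
  have "(ip \<Omega> f g)\<^sup>2 \<le> ip \<Omega> f f * ip \<Omega> g g"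
  proof (cases "ip \<Omega> f f = 0")
    case True
    then have "ip \<Omega> f g = 0"
      using q by (intro quadratic_nonneg_imp_linear_zero[of "ip \<Omega> f g" "ip \<Omega> g g"]) simp
    then show ?thesis by simp
  next
    case False
    show ?thesis
    proof (cases "ip \<Omega> g g = 0")
      case True
      have "0 \<le> 2 * t * ip \<Omega> f g + t\<^sup>2 * ip \<Omega> f f" for t
        using ip_self_nonneg[of \<Omega> "\<lambda>x. g x + t * f x"] True
        by (simp add: ip_square_add f g L2_scale power2_eq_square algebra_simps ip_commute[of \<Omega> g f])
      then have "ip \<Omega> f g = 0" by (rule quadratic_nonneg_imp_linear_zero)
      then show ?thesis by simp
    next
      case False
      then have pos: "ip \<Omega> g g > 0" by (simp add: order_less_le)
      have "0 \<le> ip \<Omega> f f + 2 * (- ip \<Omega> f g / ip \<Omega> g g) * ip \<Omega> f g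
                 + (- ip \<Omega> f g / ip \<Omega> g g)\<^sup>2 * ip \<Omega> g g" by (rule q)
      also have "\<dots> = ip \<Omega> f f - (ip \<Omega> f g)\<^sup>2 / ip \<Omega> g g"
        using pos by (simp add: field_simps power2_eq_square)
      finally show ?thesis using pos by (simp add: field_simps)
    qed
  qed
  then have "(ip \<Omega> f g)\<^sup>2 \<le> (nrm \<Omega> f * nrm \<Omega> g)\<^sup>2"
    by (simp add: power_mult_distrib nrm_square)
  then show ?thesis by (metis abs_le_square_iff abs_of_nonneg mult_nonneg_nonneg nrm_nonneg)
qed

lemma nrm_triangle:
  assumes f: "f \<in> L2 \<Omega>" and g: "g \<in> L2 \<Omega>"
  shows "nrm \<Omega> (\<lambda>x. f x + g x) \<le> nrm \<Omega> f + nrm \<Omega> g"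
proof (rule power2_le_imp_le)
  show "(nrm \<Omega> (\<lambda>x. f x + g x))\<^sup>2 \<le> (nrm \<Omega> f + nrm \<Omega> g)\<^sup>2"
    using Cauchy_Schwarz_ip[OF f g] by (simp add: nrm_square power2_sum ip_square_add f g)
qed simp

lemma nrm_triangle_diff:
  assumes "f \<in> L2 \<Omega>" "g \<in> L2 \<Omega>" "h \<in> L2 \<Omega>"
  shows "nrm \<Omega> (\<lambda>x. f x - h x) \<le> nrm \<Omega> (\<lambda>x. f x - g x) + nrm \<Omega> (\<lambda>x. g x - h x)"
  using nrm_triangle[of "\<lambda>x. f x - g x" \<Omega> "\<lambda>x. g x - h x"] assms by (simp add: L2_intros)

section \<open>Equality almost everywhere and limits of inner products\<close>

lemma aeq_refl [simp]: "aeq \<Omega> f f"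
  by (simp add: aeq_def)

lemma aeq_sym: "aeq \<Omega> f g \<Longrightarrow> aeq \<Omega> g f"
  by (auto simp: aeq_def elim: eventually_mono)

lemma aeq_trans: "aeq \<Omega> f g \<Longrightarrow> aeq \<Omega> g h \<Longrightarrow> aeq \<Omega> f h"
  unfolding aeq_def by (erule (1) eventually_elim2) simp

lemma ip_cong:
  assumes "aeq \<Omega> f f'" "aeq \<Omega> g g'" "f \<in> L2 \<Omega>" "f' \<in> L2 \<Omega>" "g \<in> L2 \<Omega>" "g' \<in> L2 \<Omega>"
  shows "ip \<Omega> f g = ip \<Omega> f' g'"
  unfolding ip_def
proof (rule integral_cong_AE)
  show "AE x in lebesgue_on \<Omega>. f x * g x = f' x * g' x"
    using assms(1,2) unfolding aeq_def by (rule eventually_elim2) simp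
qed (use assms in \<open>auto intro!: borel_measurable_times dest!: L2_measurable\<close>)

lemma nrm_cong:
  assumes "aeq \<Omega> f g" "f \<in> L2 \<Omega>" "g \<in> L2 \<Omega>"
  shows "nrm \<Omega> f = nrm \<Omega> g"
  using ip_cong[OF assms(1,1)] assms by (simp add: nrm_def)

lemma nrm_eq_0_iff:
  assumes "f \<in> L2 \<Omega>"
  shows "nrm \<Omega> f = 0 \<longleftrightarrow> aeq \<Omega> f (\<lambda>x. 0)"
proof -
  have "integrable (lebesgue_on \<Omega>) (\<lambda>x. (f x)\<^sup>2)" using assms by (simp add: L2_def)
  then have "ip \<Omega> f f = 0 \<longleftrightarrow> aeq \<Omega> f (\<lambda>x. 0)"
    by (simp add: ip_def aeq_def power2_eq_square integral_nonneg_eq_0_iff_AE)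
  then show ?thesis by (simp add: nrm_def)
qed

lemma aeq_iff_nrm_diff:
  assumes "f \<in> L2 \<Omega>" "g \<in> L2 \<Omega>"
  shows "aeq \<Omega> f g \<longleftrightarrow> nrm \<Omega> (\<lambda>x. f x - g x) = 0"
  using assms by (simp add: nrm_eq_0_iff L2_diff) (simp add: aeq_def)

text \<open>The filter is arbitrary because the lemma serves one-sided limits in time, the limit of
  the difference step to 0, and sequences alike.\<close>

lemma ip_tendsto:
  assumes F: "((\<lambda>s. nrm \<Omega> (\<lambda>x. F s x - f x)) \<longlongrightarrow> 0) \<FF>"
    and G: "((\<lambda>s. nrm \<Omega> (\<lambda>x. G s x - g x)) \<longlongrightarrow> 0) \<FF>"
    and FL: "\<forall>\<^sub>F s in \<FF>. F s \<in> L2 \<Omega>" and GL: "\<forall>\<^sub>F s in \<FF>. G s \<in> L2 \<Omega>"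
    and f: "f \<in> L2 \<Omega>" and g: "g \<in> L2 \<Omega>"
  shows "((\<lambda>s. ip \<Omega> (F s) (G s)) \<longlongrightarrow> ip \<Omega> f g) \<FF>"
proof -
  let ?a = "\<lambda>s. nrm \<Omega> (\<lambda>x. F s x - f x)" and ?b = "\<lambda>s. nrm \<Omega> (\<lambda>x. G s x - g x)"
  have "((\<lambda>s. ip \<Omega> (F s) (G s) - ip \<Omega> f g) \<longlongrightarrow> 0) \<FF>"
  proof (rule Lim_null_comparison)
    show "((\<lambda>s. ?a s * ?b s + ?a s * nrm \<Omega> g + nrm \<Omega> f * ?b s) \<longlongrightarrow> 0) \<FF>"
      using F G by (auto intro!: tendsto_eq_intros)
    show "\<forall>\<^sub>F s in \<FF>. norm (ip \<Omega> (F s) (G s) - ip \<Omega> f g)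
        \<le> ?a s * ?b s + ?a s * nrm \<Omega> g + nrm \<Omega> f * ?b s"
      using FL GL
    proof eventually_elim
      case (elim s)
      let ?p = "\<lambda>x. F s x - f x" and ?q = "\<lambda>x. G s x - g x"
      have "ip \<Omega> (F s) (G s) - ip \<Omega> f g = ip \<Omega> ?p ?q + ip \<Omega> ?p g + ip \<Omega> f ?q"
        using elim f g by (simp add: ip_linear L2_intros)
      moreover have "\<bar>ip \<Omega> ?p ?q\<bar> \<le> ?a s * ?b s" "\<bar>ip \<Omega> ?p g\<bar> \<le> ?a s * nrm \<Omega> g"
        "\<bar>ip \<Omega> f ?q\<bar> \<le> nrm \<Omega> f * ?b s"
        using elim f g by (auto intro!: Cauchy_Schwarz_ip L2_intros)
      ultimately show ?case by simp
    qed
  qed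
  then show ?thesis by (simp add: LIM_zero_iff)
qed

section \<open>Completeness (Riesz-Fischer)\<close>

lemma L2_Cauchy_subseq:
  assumes C: "\<And>e. e > 0 \<Longrightarrow> \<exists>N. \<forall>m\<ge>N. \<forall>n\<ge>N. nrm \<Omega> (\<lambda>x. f m x - f n x) < (e::real)"
  shows "\<exists>r::nat\<Rightarrow>nat. strict_mono r \<and> (\<forall>k. nrm \<Omega> (\<lambda>x. f (r (Suc k)) x - f (r k) x) < (1/4)^k)"
proof -
  have "\<forall>k. \<exists>N. \<forall>m\<ge>N. \<forall>n\<ge>N. nrm \<Omega> (\<lambda>x. f m x - f n x) < (1/4)^k"
    using C by simp
  then obtain N where N: "\<And>k m n. m \<ge> N k \<Longrightarrow> n \<ge> N k \<Longrightarrow> nrm \<Omega> (\<lambda>x. f m x - f n x) < (1/4)^k"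
    by metis
  define r where "r = rec_nat (N 0) (\<lambda>k p. max (Suc p) (N (Suc k)))"
  have r0: "r 0 = N 0" and rS: "\<And>k. r (Suc k) = max (Suc (r k)) (N (Suc k))"
    by (auto simp: r_def)
  have "strict_mono r" by (rule strict_monoI_Suc) (simp add: rS)
  moreover have rN: "r k \<ge> N k" for k by (cases k) (auto simp: r0 rS)
  moreover have "r (Suc k) \<ge> N k" for k using rN[of k] by (simp add: rS)
  ultimately show ?thesis using N by blast
qed

lemma nn_integral_square_L2:
  assumes "f \<in> L2 \<Omega>"
  shows "(\<integral>\<^sup>+x. ennreal ((f x)\<^sup>2) \<partial>lebesgue_on \<Omega>) = ennreal ((nrm \<Omega> f)\<^sup>2)"
proof -
  have "(\<integral>\<^sup>+x. ennreal ((f x)\<^sup>2) \<partial>lebesgue_on \<Omega>) = ennreal (LINT x|lebesgue_on \<Omega>. (f x)\<^sup>2)"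
    using assms by (intro nn_integral_eq_integral) (auto simp: L2_def)
  then show ?thesis by (simp only: nrm_square) (simp add: ip_def power2_eq_square)
qed

text \<open>The squared increments of the subsequence, weighted by \<open>2^k\<close>, have a finite
  total integral thanks to the rate \<open>(1/4)^k\<close>. So the weighted series is finite almost
  everywhere, and the weights turn this into geometric decay of the increments, hence pointwise
  convergence. Fatou's lemma carries this limit back to the norm.\<close>

lemma L2_complete:
  assumes L: "\<And>n. f n \<in> L2 \<Omega>"
    and C: "\<And>e. e > 0 \<Longrightarrow> \<exists>N. \<forall>m\<ge>N. \<forall>n\<ge>N. nrm \<Omega> (\<lambda>x. f m x - f n x) < (e::real)"
  shows "\<exists>g\<in>L2 \<Omega>. (\<lambda>n. nrm \<Omega> (\<lambda>x. f n x - g x)) \<longlonglongrightarrow> 0"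
proof -
  let ?M = "lebesgue_on \<Omega>"
  obtain r :: "nat \<Rightarrow> nat" where r: "strict_mono r"
    and rk: "\<And>k. nrm \<Omega> (\<lambda>x. f (r (Suc k)) x - f (r k) x) < (1/4)^k"
    using L2_Cauchy_subseq[OF C] by blast
  let ?d = "\<lambda>k x. f (r (Suc k)) x - f (r k) x"
  have meas [measurable]: "f n \<in> borel_measurable ?M" for n
    using L by (simp add: L2_def)
  have "(\<integral>\<^sup>+x. (\<Sum>k. ennreal (2^k * (?d k x)\<^sup>2)) \<partial>?M) = (\<Sum>k. \<integral>\<^sup>+x. ennreal (2^k * (?d k x)\<^sup>2) \<partial>?M)"
    by (rule nn_integral_suminf) simp
  also have "\<dots> \<le> (\<Sum>k. ennreal ((1/2)^k))"
  proof (rule suminf_le)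
    fix k
    have "(\<integral>\<^sup>+x. ennreal (2^k * (?d k x)\<^sup>2) \<partial>?M) = 2^k * ennreal ((nrm \<Omega> (?d k))\<^sup>2)"
      by (simp add: ennreal_mult nn_integral_cmult nn_integral_square_L2 L L2_diff ennreal_power[symmetric])
    also have "\<dots> \<le> 2^k * ennreal (((1/4)^k)\<^sup>2)"
      using rk[of k] by (intro mult_left_mono ennreal_leI power_mono) auto
    also have "\<dots> = ennreal (2^k * ((1/4)^k)\<^sup>2)"
      by (simp add: ennreal_mult ennreal_power[symmetric])
    also have "\<dots> \<le> ennreal ((1/2)^k)"
    proof (rule ennreal_leI)
      have "2^k * ((1/4::real)^k)\<^sup>2 = (1/8)^k"
        by (simp add: power2_eq_square flip: power_mult_distrib)
      also have "\<dots> \<le> (1/2)^k" by (rule power_mono) auto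
      finally show "2^k * ((1/4::real)^k)\<^sup>2 \<le> (1/2)^k" .
    qed
    finally show "(\<integral>\<^sup>+x. ennreal (2^k * (?d k x)\<^sup>2) \<partial>?M) \<le> ennreal ((1/2)^k)" .
  qed auto
  also have "\<dots> = ennreal (\<Sum>k. (1/2)^k)"
    by (rule suminf_ennreal2) (auto intro: summable_geometric)
  also have "\<dots> < \<infinity>" by simp
  finally have "AE x in ?M. (\<Sum>k. ennreal (2^k * (?d k x)\<^sup>2)) \<noteq> \<infinity>"
    by (intro nn_integral_PInf_AE) auto
  moreover have "convergent (\<lambda>k. f (r k) x)" if "(\<Sum>k. ennreal (2^k * (?d k x)\<^sup>2)) \<noteq> \<infinity>" for x
  proof -
    have s: "summable (\<lambda>k. 2^k * (?d k x)\<^sup>2)"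
      using that by (intro summable_suminf_not_top) auto
    then obtain K where "K > 0" and "\<And>k. norm (2^k * (?d k x)\<^sup>2) \<le> K"
      using summable_imp_Bseq[OF s] unfolding Bseq_def by blast
    then have K: "\<And>k. 2^k * (?d k x)\<^sup>2 \<le> K" "K \<ge> 0" by (auto simp: abs_le_iff)
    \<comment> \<open>Boundedness of the weighted terms is enough: it makes the increments decay
      like powers of \<open>sqrt (1/2)\<close>, which are summable.\<close>
    have bd: "\<bar>?d k x\<bar> \<le> sqrt K * (sqrt (1/2))^k" for k
    proof -
      have "(?d k x)\<^sup>2 \<le> K * (1/2)^k" using K(1)[of k] by (simp add: field_simps power_divide)
      then have "sqrt ((?d k x)\<^sup>2) \<le> sqrt (K * (1/2)^k)" by (rule real_sqrt_le_mono)
      then show ?thesis by (simp only: real_sqrt_abs real_sqrt_mult[of K] real_sqrt_power[of "1/2"])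
    qed
    have "summable (\<lambda>k. sqrt K * (sqrt (1/2::real))^k)"
      by (intro summable_mult summable_geometric) (simp add: real_sqrt_divide)
    then have "summable (\<lambda>k. ?d k x)"
      by (rule summable_comparison_test'[where N=0]) (use bd in simp)
    then have "convergent (\<lambda>n. \<Sum>k<n. ?d k x)" by (simp add: summable_iff_convergent)
    then have "convergent (\<lambda>n. f (r n) x - f (r 0) x)"
      by (simp only: sum_lessThan_telescope[of "\<lambda>k. f (r k) x"])
    then have "convergent (\<lambda>n. (f (r n) x - f (r 0) x) + f (r 0) x)"
      by (intro convergent_add convergent_const)
    then show ?thesis by simp
  qed
  ultimately have conv: "AE x in ?M. convergent (\<lambda>k. f (r k) x)"
    by (auto elim: eventually_mono)
  define g where "g x = lim (\<lambda>k. f (r k) x)" for x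
  have g_meas [measurable]: "g \<in> borel_measurable ?M"
    unfolding g_def by measurable
  have glim: "AE x in ?M. (\<lambda>k. f (r k) x) \<longlonglongrightarrow> g x"
    using conv by (auto simp: g_def convergent_LIMSEQ_iff elim: eventually_mono)
  \<comment> \<open>The Cauchy bound survives the limit in the second index. This gives both square
    integrability of \<open>g\<close> and convergence of the whole sequence, not only of the
    subsequence.\<close>
  have Fatou: "(\<integral>\<^sup>+x. ennreal ((f m x - g x)\<^sup>2) \<partial>?M) \<le> ennreal (e\<^sup>2)"
    if e: "\<And>n. n \<ge> N \<Longrightarrow> nrm \<Omega> (\<lambda>x. f m x - f n x) \<le> e" for m N and e :: real
  proof -
    have "(\<integral>\<^sup>+x. ennreal ((f m x - g x)\<^sup>2) \<partial>?M)
        = (\<integral>\<^sup>+x. liminf (\<lambda>k. ennreal ((f m x - f (r k) x)\<^sup>2)) \<partial>?M)"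
      using glim
      by (intro nn_integral_cong_AE, elim eventually_mono)
         (rule lim_imp_Liminf[symmetric], auto intro!: tendsto_intros)
    also have "\<dots> \<le> liminf (\<lambda>k. \<integral>\<^sup>+x. ennreal ((f m x - f (r k) x)\<^sup>2) \<partial>?M)"
      by (rule nn_integral_liminf) simp
    also have "\<dots> \<le> ennreal (e\<^sup>2)"
    proof (rule Liminf_le)
      have "\<forall>\<^sub>F k in sequentially. N \<le> r k"
        using filterlim_subseq[OF r] unfolding filterlim_at_top by blast
      then show "\<forall>\<^sub>F k in sequentially. (\<integral>\<^sup>+x. ennreal ((f m x - f (r k) x)\<^sup>2) \<partial>?M) \<le> ennreal (e\<^sup>2)"
        by eventually_elim
           (use e in \<open>auto simp: nn_integral_square_L2 L L2_diff intro!: ennreal_leI power_mono\<close>)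
    qed simp
    finally show ?thesis .
  qed
  have diffL2: "(\<lambda>x. f m x - g x) \<in> L2 \<Omega>"
    if "\<And>n. n \<ge> N \<Longrightarrow> nrm \<Omega> (\<lambda>x. f m x - f n x) \<le> e" for m N and e :: real
  proof -
    have "(\<integral>\<^sup>+x. ennreal ((f m x - g x)\<^sup>2) \<partial>?M) < \<infinity>"
      using Fatou[of N m e, OF that] by (simp add: le_less_trans)
    then show ?thesis by (simp add: L2_def integrable_iff_bounded)
  qed
  obtain N1 where N1: "\<forall>m\<ge>N1. \<forall>n\<ge>N1. nrm \<Omega> (\<lambda>x. f m x - f n x) < 1"
    using C[of 1] by auto
  have "(\<lambda>x. f N1 x - g x) \<in> L2 \<Omega>"
    by (rule diffL2[of N1 _ 1]) (use N1 in \<open>auto intro: less_imp_le\<close>)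
  from L2_diff[OF L[of N1] this] have gL: "g \<in> L2 \<Omega>" by simp
  have "(\<lambda>n. nrm \<Omega> (\<lambda>x. f n x - g x)) \<longlonglongrightarrow> 0"
  proof (rule LIMSEQ_I)
    fix e :: real assume e: "e > 0"
    obtain N where N: "\<forall>m\<ge>N. \<forall>n\<ge>N. nrm \<Omega> (\<lambda>x. f m x - f n x) < e/2"
      using C[of "e/2"] e by auto
    have "nrm \<Omega> (\<lambda>x. f m x - g x) \<le> e/2" if m: "m \<ge> N" for m
    proof -
      have "ennreal ((nrm \<Omega> (\<lambda>x. f m x - g x))\<^sup>2) \<le> ennreal ((e/2)\<^sup>2)"
        using Fatou[of N m "e/2"] N m
        by (auto simp: nn_integral_square_L2 L L2_diff gL intro: less_imp_le)
      then have "(nrm \<Omega> (\<lambda>x. f m x - g x))\<^sup>2 \<le> (e/2)\<^sup>2" using e by (simp add: ennreal_le_iff)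
      then show ?thesis using e by (auto dest: power2_le_imp_le)
    qed
    moreover have "e/2 < e" using e by simp
    ultimately have "\<forall>m\<ge>N. nrm \<Omega> (\<lambda>x. f m x - g x) < e" by (meson le_less_trans)
    then have "\<forall>m\<ge>N. norm (nrm \<Omega> (\<lambda>x. f m x - g x) - 0) < e" by simp
    then show "\<exists>no. \<forall>n\<ge>no. norm (nrm \<Omega> (\<lambda>x. f n x - g x) - 0) < e" by blast
  qed
  with gL show ?thesis by blast
qed


section \<open>Time derivatives and energy decay\<close>

lemma at_within_atLeast_neq_bot: "0 \<le> t \<Longrightarrow> at t within {0..} \<noteq> (bot :: real filter)"
proof -
  assume t: "0 \<le> t"
  have "at_right t \<le> at t within {0..}" using t by (intro at_le) auto
  then show ?thesis using trivial_limit_at_right_real[of t] by (auto simp: bot.extremum_unique)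
qed

lemma eventually_at_within_atLeast: "\<forall>\<^sub>F s in at t within {0::real..}. 0 \<le> s \<and> s \<noteq> t"
  by (auto simp: eventually_at_filter)

lemma has_time_deriv_unique:
  assumes u: "\<And>s. 0 \<le> s \<Longrightarrow> u s \<in> L2 \<Omega>" and v: "v \<in> L2 \<Omega>" and w: "w \<in> L2 \<Omega>" and t: "0 \<le> t"
    and uv: "has_time_deriv (nrm \<Omega>) u v t" and uw: "has_time_deriv (nrm \<Omega>) u w t"
  shows "aeq \<Omega> v w"
proof -
  let ?q = "\<lambda>s x. (u s x - u t x) / (s - t)"
  have "((\<lambda>s. nrm \<Omega> (\<lambda>x. v x - w x)) \<longlongrightarrow> 0) (at t within {0..})"
  proof (rule Lim_null_comparison)
    show "((\<lambda>s. nrm \<Omega> (\<lambda>x. ?q s x - v x) + nrm \<Omega> (\<lambda>x. ?q s x - w x)) \<longlongrightarrow> 0) (at t within {0..})"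
      using uv uw unfolding has_time_deriv_def by (auto intro!: tendsto_eq_intros)
    show "\<forall>\<^sub>F s in at t within {0..}. norm (nrm \<Omega> (\<lambda>x. v x - w x))
        \<le> nrm \<Omega> (\<lambda>x. ?q s x - v x) + nrm \<Omega> (\<lambda>x. ?q s x - w x)"
      using eventually_at_within_atLeast[of t]
    proof eventually_elim
      case (elim s)
      have "?q s \<in> L2 \<Omega>" using elim u t by (simp add: L2_intros)
      then show ?case
        using nrm_triangle_diff[of v \<Omega> "?q s" w] v w by (simp add: nrm_minus_commute[of \<Omega> v])
    qed
  qed
  then have "nrm \<Omega> (\<lambda>x. v x - w x) = 0"
    using at_within_atLeast_neq_bot[OF t] by (simp add: tendsto_const_iff)
  then show ?thesis by (simp add: aeq_iff_nrm_diff v w)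
qed

text \<open>The exceptional null set may vary with time, since each difference quotient involves
  only the two times \<open>s\<close> and \<open>t\<close>.\<close>

lemma has_time_deriv_cong:
  assumes "\<And>s. 0 \<le> s \<Longrightarrow> aeq \<Omega> (u s) (u' s)" "aeq \<Omega> v v'"
    and "\<And>s. 0 \<le> s \<Longrightarrow> u s \<in> L2 \<Omega>" "\<And>s. 0 \<le> s \<Longrightarrow> u' s \<in> L2 \<Omega>" "v \<in> L2 \<Omega>" "v' \<in> L2 \<Omega>" "0 \<le> t"
    and d: "has_time_deriv (nrm \<Omega>) u v t"
  shows "has_time_deriv (nrm \<Omega>) u' v' t"
  unfolding has_time_deriv_def
proof (rule Lim_transform_eventually[OF d[unfolded has_time_deriv_def]])
  show "\<forall>\<^sub>F s in at t within {0..}. nrm \<Omega> (\<lambda>x. (u s x - u t x) / (s - t) - v x)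
      = nrm \<Omega> (\<lambda>x. (u' s x - u' t x) / (s - t) - v' x)"
    using eventually_at_within_atLeast[of t]
  proof eventually_elim
    case (elim s)
    have "aeq \<Omega> (u s) (u' s)" "aeq \<Omega> (u t) (u' t)" using elim assms by auto
    then have "aeq \<Omega> (\<lambda>x. (u s x - u t x) / (s - t) - v x) (\<lambda>x. (u' s x - u' t x) / (s - t) - v' x)"
      using assms(2) unfolding aeq_def by eventually_elim simp
    then show ?case by (rule nrm_cong) (use elim assms in \<open>auto intro!: L2_intros\<close>)
  qed
qed

lemma has_time_deriv_imp_continuous:
  assumes u: "\<And>s. 0 \<le> s \<Longrightarrow> u s \<in> L2 \<Omega>" and v: "v \<in> L2 \<Omega>" and t: "0 \<le> t"
    and d: "has_time_deriv (nrm \<Omega>) u v t"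
  shows "((\<lambda>s. nrm \<Omega> (\<lambda>x. u s x - u t x)) \<longlongrightarrow> 0) (at t within {0..})"
proof (rule Lim_null_comparison)
  let ?q = "\<lambda>s x. (u s x - u t x) / (s - t)"
  show "((\<lambda>s. \<bar>s - t\<bar> * (nrm \<Omega> (\<lambda>x. ?q s x - v x) + nrm \<Omega> v)) \<longlongrightarrow> 0) (at t within {0..})"
    using d unfolding has_time_deriv_def by (auto intro!: tendsto_eq_intros)
  show "\<forall>\<^sub>F s in at t within {0..}. norm (nrm \<Omega> (\<lambda>x. u s x - u t x))
      \<le> \<bar>s - t\<bar> * (nrm \<Omega> (\<lambda>x. ?q s x - v x) + nrm \<Omega> v)"
    using eventually_at_within_atLeast[of t]
  proof eventually_elim
    case (elim s)
    have q: "?q s \<in> L2 \<Omega>" using elim u t by (simp add: L2_intros)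
    have "nrm \<Omega> (\<lambda>x. u s x - u t x) = \<bar>s - t\<bar> * nrm \<Omega> (?q s)"
      using elim by (simp add: nrm_divide)
    also have "nrm \<Omega> (?q s) \<le> nrm \<Omega> (\<lambda>x. ?q s x - v x) + nrm \<Omega> v"
      using nrm_triangle[of "\<lambda>x. ?q s x - v x" \<Omega> v] q v by (simp add: L2_diff)
    finally show ?case by (simp add: mult_left_mono)
  qed
qed

lemma ip_has_real_derivative:
  assumes u: "\<And>s. 0 \<le> s \<Longrightarrow> u s \<in> L2 \<Omega>" and w: "\<And>s. 0 \<le> s \<Longrightarrow> w s \<in> L2 \<Omega>"
    and u': "u' \<in> L2 \<Omega>" and w': "w' \<in> L2 \<Omega>" and t: "0 \<le> t"
    and du: "has_time_deriv (nrm \<Omega>) u u' t" and dw: "has_time_deriv (nrm \<Omega>) w w' t"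
  shows "((\<lambda>s. ip \<Omega> (u s) (w s)) has_real_derivative (ip \<Omega> u' (w t) + ip \<Omega> (u t) w')) (at t within {0..})"
  unfolding has_field_derivative_iff
proof (rule Lim_transform_eventually)
  let ?q = "\<lambda>s x. (u s x - u t x) / (s - t)" and ?r = "\<lambda>s x. (w s x - w t x) / (s - t)"
  have ev: "\<forall>\<^sub>F s in at t within {0..}. ?q s \<in> L2 \<Omega>" "\<forall>\<^sub>F s in at t within {0..}. ?r s \<in> L2 \<Omega>"
    "\<forall>\<^sub>F s in at t within {0..}. w s \<in> L2 \<Omega>"
    by (rule eventually_mono[OF eventually_at_within_atLeast], use u w t in \<open>auto intro!: L2_intros\<close>)+
  have "((\<lambda>s. ip \<Omega> (?q s) (w s)) \<longlongrightarrow> ip \<Omega> u' (w t)) (at t within {0..})"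
    using du[unfolded has_time_deriv_def] has_time_deriv_imp_continuous[OF w w' t dw] ev u' w t
    by (intro ip_tendsto) auto
  moreover have "((\<lambda>s. ip \<Omega> (u t) (?r s)) \<longlongrightarrow> ip \<Omega> (u t) w') (at t within {0..})"
    using dw[unfolded has_time_deriv_def] ev u w' t
    by (intro ip_tendsto) (auto simp: nrm_def)
  ultimately show "((\<lambda>s. ip \<Omega> (?q s) (w s) + ip \<Omega> (u t) (?r s)) \<longlongrightarrow> ip \<Omega> u' (w t) + ip \<Omega> (u t) w')
      (at t within {0..})"
    by (rule tendsto_add)
  show "\<forall>\<^sub>F s in at t within {0..}. ip \<Omega> (?q s) (w s) + ip \<Omega> (u t) (?r s)
      = (ip \<Omega> (u s) (w s) - ip \<Omega> (u t) (w t)) / (s - t)"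
    using eventually_at_within_atLeast[of t]
    by eventually_elim (use u w t in \<open>auto simp: ip_linear simp flip: add_divide_distrib\<close>)
qed

lemma has_time_deriv_const: "has_time_deriv (nrm \<Omega>) (\<lambda>_. w) (\<lambda>x. 0) t"
  by (simp add: has_time_deriv_def nrm_def)

text \<open>Forward shifts map \<open>{0..}\<close> into itself and so respect the one-sided
  derivative at 0; the difference quotients below are forward for this reason.\<close>

lemma has_time_deriv_shift:
  assumes "0 \<le> t" "0 \<le> h" "has_time_deriv N u v (t + h)"
  shows "has_time_deriv N (\<lambda>s. u (s + h)) v t"
proof -
  have lim: "filterlim (\<lambda>s. s + h) (at (t + h) within {0..}) (at t within {0..})"
    unfolding filterlim_at
    using assms(2) by (auto intro!: tendsto_intros eventually_mono[OF eventually_at_within_atLeast])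
  show ?thesis
    using filterlim_compose[OF assms(3)[unfolded has_time_deriv_def] lim]
    by (simp add: has_time_deriv_def algebra_simps)
qed

lemma has_time_deriv_diff_divide:
  assumes u: "\<And>s. 0 \<le> s \<Longrightarrow> u s \<in> L2 \<Omega>" and w: "\<And>s. 0 \<le> s \<Longrightarrow> w s \<in> L2 \<Omega>"
    and u': "u' \<in> L2 \<Omega>" and w': "w' \<in> L2 \<Omega>" and t: "0 \<le> t"
    and du: "has_time_deriv (nrm \<Omega>) u u' t" and dw: "has_time_deriv (nrm \<Omega>) w w' t"
  shows "has_time_deriv (nrm \<Omega>) (\<lambda>s x. (u s x - w s x) / h) (\<lambda>x. (u' x - w' x) / h) t"
  unfolding has_time_deriv_def
proof (rule Lim_null_comparison)
  let ?q = "\<lambda>s x. (u s x - u t x) / (s - t) - u' x" and ?r = "\<lambda>s x. (w s x - w t x) / (s - t) - w' x"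
  show "((\<lambda>s. (nrm \<Omega> (?q s) + nrm \<Omega> (?r s)) / \<bar>h\<bar>) \<longlongrightarrow> 0) (at t within {0..})"
    using tendsto_divide[OF tendsto_add[OF du[unfolded has_time_deriv_def] dw[unfolded has_time_deriv_def]]
        tendsto_const[of "\<bar>h\<bar>"]]
    by (cases "h = 0") auto
  show "\<forall>\<^sub>F s in at t within {0..}.
      norm (nrm \<Omega> (\<lambda>x. ((u s x - w s x) / h - (u t x - w t x) / h) / (s - t) - (u' x - w' x) / h))
      \<le> (nrm \<Omega> (?q s) + nrm \<Omega> (?r s)) / \<bar>h\<bar>"
    using eventually_at_within_atLeast[of t]
  proof eventually_elim
    case (elim s)
    have "nrm \<Omega> (\<lambda>x. ((u s x - w s x) / h - (u t x - w t x) / h) / (s - t) - (u' x - w' x) / h)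
        = nrm \<Omega> (\<lambda>x. (?q s x - ?r s x) / h)"
      by (simp add: diff_divide_distrib add_divide_distrib mult.commute algebra_simps)
    also have "\<dots> = nrm \<Omega> (\<lambda>x. ?q s x - ?r s x) / \<bar>h\<bar>" by (rule nrm_divide)
    also have "\<dots> \<le> (nrm \<Omega> (?q s) + nrm \<Omega> (?r s)) / \<bar>h\<bar>"
    proof (rule divide_right_mono)
      show "nrm \<Omega> (\<lambda>x. ?q s x - ?r s x) \<le> nrm \<Omega> (?q s) + nrm \<Omega> (?r s)"
        using nrm_triangle_diff[of "?q s" \<Omega> "\<lambda>x. 0" "?r s"] nrm_minus_commute[of \<Omega> "\<lambda>x. 0" "?r s"]
          elim u w u' w' t
        by (simp add: L2_intros)
    qed simp
    finally show ?case by simp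
  qed
qed

text \<open>\<open>C_time\<close> hides the successive derivatives in nested existentials. A single
  family \<open>V\<close> with \<open>V 0 = u\<close> makes all of them available at once.\<close>

lemma C_time_chain:
  assumes "C_time X N k u"
  shows "\<exists>V. V 0 = u \<and> (\<forall>i\<le>k. \<forall>t\<ge>0. V i t \<in> X) \<and>
    (\<forall>i<k. \<forall>t\<ge>0. has_time_deriv N (V i) (V (Suc i) t) t) \<and>
    (\<forall>t\<ge>0. ((\<lambda>s. N (\<lambda>x. V k s x - V k t x)) \<longlongrightarrow> 0) (at t within {0..}))"
  using assms
proof (induction k arbitrary: u)
  case 0
  then show ?case by (intro exI[of _ "\<lambda>_. u"]) auto
next
  case (Suc k)
  then obtain v where u: "\<forall>t\<ge>0. u t \<in> X" and v: "\<forall>t\<ge>0. has_time_deriv N u (v t) t"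
    and "C_time X N k v" by auto
  from Suc.IH[OF this(3)] obtain V where V: "V 0 = v" "\<forall>i\<le>k. \<forall>t\<ge>0. V i t \<in> X"
    "\<forall>i<k. \<forall>t\<ge>0. has_time_deriv N (V i) (V (Suc i) t) t"
    "\<forall>t\<ge>0. ((\<lambda>s. N (\<lambda>x. V k s x - V k t x)) \<longlongrightarrow> 0) (at t within {0..})"
    by blast
  let ?W = "\<lambda>i. case i of 0 \<Rightarrow> u | Suc i \<Rightarrow> V i"
  have "\<forall>i\<le>Suc k. \<forall>t\<ge>0. ?W i t \<in> X" using u V by (auto split: nat.split)
  moreover have "\<forall>i<Suc k. \<forall>t\<ge>0. has_time_deriv N (?W i) (?W (Suc i) t) t"
    using v V by (auto split: nat.split)
  ultimately show ?case using V(4) by (intro exI[of _ ?W]) simp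
qed

text \<open>\<open>time_deriv\<close> chooses every derivative anew, separately at each time;
  uniqueness of derivatives in the norm ties these choices to a given chain almost
  everywhere.\<close>

lemma time_deriv_aeq_chain:
  assumes V: "\<And>i t. i \<le> k \<Longrightarrow> 0 \<le> t \<Longrightarrow> V i t \<in> L2 \<Omega>"
    and d: "\<And>i t. i < k \<Longrightarrow> 0 \<le> t \<Longrightarrow> has_time_deriv (nrm \<Omega>) (V i) (V (Suc i) t) t"
    and i: "i \<le> k" and t: "0 \<le> t"
  shows "time_deriv \<Omega> i (V 0) t \<in> L2 \<Omega> \<and> aeq \<Omega> (V i t) (time_deriv \<Omega> i (V 0) t)"
  using i t
proof (induction i arbitrary: t)
  case 0
  then show ?case using V by simp
next
  case (Suc i)
  let ?T = "time_deriv \<Omega> i (V 0)"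
  have IH: "\<And>s. 0 \<le> s \<Longrightarrow> ?T s \<in> L2 \<Omega>" "\<And>s. 0 \<le> s \<Longrightarrow> aeq \<Omega> (V i s) (?T s)"
    using Suc by auto
  have dT: "has_time_deriv (nrm \<Omega>) ?T (V (Suc i) t) t"
    by (rule has_time_deriv_cong[of \<Omega> "V i" ?T "V (Suc i) t"]) (use IH Suc.prems V d in auto)
  have "time_deriv \<Omega> (Suc i) (V 0) t \<in> L2 \<Omega> \<and> has_time_deriv (nrm \<Omega>) ?T (time_deriv \<Omega> (Suc i) (V 0) t) t"
    using someI[of "\<lambda>v. v \<in> L2 \<Omega> \<and> has_time_deriv (nrm \<Omega>) ?T v t" "V (Suc i) t"] dT V Suc.prems
    by simp
  then show ?case
    using has_time_deriv_unique[OF IH(1) _ _ Suc.prems(2) dT] V Suc.prems by blast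
qed

text \<open>Here \<open>pp\<close>, \<open>bb\<close>, \<open>ww\<close> are the squared norms of
  \<open>w'\<close>, \<open>B w\<close>, \<open>w\<close>, and \<open>wp\<close> is the cross term.
  The hypotheses give \<delta> |\<open>wp\<close>| \<le> \<open>pp\<close>/6 + \<open>bb\<close>/12
  and \<delta> \<alpha> \<open>ww\<close> \<le> \<open>bb\<close>/6. With a general \<kappa> in
  place of 3\<delta>/2, the last inequality needs \<delta> + \<kappa>/3 \<le> \<kappa> for
  \<open>bb\<close> and \<delta> + 4\<kappa>/3 \<le> \<alpha> for \<open>pp\<close>. The first says
  \<kappa> \<ge> 3\<delta>/2; at equality the second becomes 3\<delta> \<le> \<alpha>.\<close>

lemma lyapunov_bounds:
  fixes \<alpha> \<delta> lam pp bb ww wp :: real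
  assumes a: "\<alpha> > 0" and d: "0 < \<delta>" "\<delta> \<le> 1/3 * min \<alpha> (lam / (2 * \<alpha>))"
    and nn: "0 \<le> pp" "0 \<le> bb" "0 \<le> ww" and lam: "lam * ww \<le> bb"
    and wp: "2 * \<bar>wp\<bar> \<le> \<alpha> * ww + pp / \<alpha>"
  defines "L \<equiv> pp / 2 + bb / 2 + 3 * \<delta> / 2 * wp + 3 * \<delta> * \<alpha> / 4 * ww"
  shows "(pp + bb) / 4 \<le> L" "L \<le> 3 / 4 * (pp + bb)"
    "2 * \<delta> * L \<le> (\<alpha> - 3 * \<delta> / 2) * pp + 3 * \<delta> / 2 * bb"
proof -
  have d1: "3 * \<delta> \<le> \<alpha>" and "\<delta> \<le> lam / (6 * \<alpha>)" using d by auto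
  then have "6 * (\<delta> * \<alpha>) \<le> lam" using a by (simp add: field_simps)
  then have "6 * (\<delta> * \<alpha>) * ww \<le> lam * ww" using nn by (intro mult_right_mono)
  then have ww: "6 * (\<delta> * \<alpha> * ww) \<le> bb" using lam by simp
  have pp: "3 * (\<delta> * (pp / \<alpha>)) \<le> pp"
  proof -
    have "(3 * \<delta>) * (pp / \<alpha>) \<le> \<alpha> * (pp / \<alpha>)" using d1 nn a by (intro mult_right_mono) auto
    then show ?thesis using a by simp
  qed
  have "\<delta> * (2 * \<bar>wp\<bar>) \<le> \<delta> * (\<alpha> * ww + pp / \<alpha>)" using wp d by (intro mult_left_mono) auto
  then have "2 * (\<delta> * \<bar>wp\<bar>) \<le> \<delta> * \<alpha> * ww + \<delta> * (pp / \<alpha>)" by (simp add: algebra_simps)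
  moreover have "\<delta> * wp \<le> \<delta> * \<bar>wp\<bar>" "\<delta> * (- \<bar>wp\<bar>) \<le> \<delta> * wp"
    using d by (intro mult_left_mono; simp)+
  ultimately have wp1: "2 * (\<delta> * wp) \<le> \<delta> * \<alpha> * ww + \<delta> * (pp / \<alpha>)"
    and wp2: "- (\<delta> * \<alpha> * ww + \<delta> * (pp / \<alpha>)) \<le> 2 * (\<delta> * wp)" by linarith+
  have L: "L = pp / 2 + bb / 2 + 3 / 2 * (\<delta> * wp) + 3 / 4 * (\<delta> * \<alpha> * ww)" by (simp add: L_def)
  \<comment> \<open>With the products named, the first two bounds are linear in the remaining
    quantities. In the lower one the two occurrences of \<open>s\<close> cancel.\<close>
  define r s v where "r = \<delta> * (pp / \<alpha>)" and "s = \<delta> * \<alpha> * ww" and "v = \<delta> * wp"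
  note abs = wp1[folded r_def s_def v_def] wp2[folded r_def s_def v_def] pp[folded r_def]
    ww[folded s_def] L[folded s_def v_def] nn
  show "(pp + bb) / 4 \<le> L" using abs by simp
  show "L \<le> 3 / 4 * (pp + bb)" using abs by simp
  \<comment> \<open>The third bound is quadratic in \<delta>, so the linear estimates are multiplied
    by \<delta> once more.\<close>
  have "\<delta> * (2 * (\<delta> * wp)) \<le> \<delta> * (bb / 6 + pp / 3)" "\<delta> * (\<delta> * \<alpha> * ww) \<le> \<delta> * (bb / 6)"
    using wp1 pp ww d by (intro mult_left_mono; linarith)+
  moreover have "\<delta> * pp * 3 \<le> \<alpha> * pp" using d1 nn mult_right_mono[of "3 * \<delta>" \<alpha> pp] by simp
  ultimately show "2 * \<delta> * L \<le> (\<alpha> - 3 * \<delta> / 2) * pp + 3 * \<delta> / 2 * bb"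
    by (simp add: L_def algebra_simps)
qed

text \<open>The functions \<open>p\<close>, \<open>q\<close>, \<open>b\<close>, \<open>c\<close>
  play the roles of \<open>w'\<close>, \<open>w''\<close>, \<open>B w\<close>, \<open>B w'\<close>,
  while \<open>e1\<close> and \<open>e2\<close> are the equation tested with \<open>w'\<close> and
  \<open>w\<close>. Avoiding \<open>B\<close> itself lets \<open>b\<close> be a difference quotient
  of \<open>B z\<close>, which equals \<open>B\<close> of the difference quotient only almost
  everywhere.\<close>

lemma regular_damped_wave_decay:
  fixes w p q b c :: "real \<Rightarrow> ('n::finite) fld"
  assumes a: "\<alpha> > 0" and d: "0 < \<delta>" "\<delta> \<le> 1/3 * min \<alpha> (lam / (2 * \<alpha>))"
    and L: "\<And>t. 0 \<le> t \<Longrightarrow> w t \<in> L2 \<Omega>" "\<And>t. 0 \<le> t \<Longrightarrow> p t \<in> L2 \<Omega>" "\<And>t. 0 \<le> t \<Longrightarrow> q t \<in> L2 \<Omega>"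
      "\<And>t. 0 \<le> t \<Longrightarrow> b t \<in> L2 \<Omega>" "\<And>t. 0 \<le> t \<Longrightarrow> c t \<in> L2 \<Omega>"
    and dw: "\<And>t. 0 \<le> t \<Longrightarrow> has_time_deriv (nrm \<Omega>) w (p t) t"
    and dp: "\<And>t. 0 \<le> t \<Longrightarrow> has_time_deriv (nrm \<Omega>) p (q t) t"
    and db: "\<And>t. 0 \<le> t \<Longrightarrow> has_time_deriv (nrm \<Omega>) b (c t) t"
    and e1: "\<And>t. 0 \<le> t \<Longrightarrow> ip \<Omega> (q t) (p t) + \<alpha> * ip \<Omega> (p t) (p t) + ip \<Omega> (b t) (c t) = 0"
    and e2: "\<And>t. 0 \<le> t \<Longrightarrow> ip \<Omega> (q t) (w t) + \<alpha> * ip \<Omega> (p t) (w t) + ip \<Omega> (b t) (b t) = 0"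
    and lam: "\<And>t. 0 \<le> t \<Longrightarrow> lam * ip \<Omega> (w t) (w t) \<le> ip \<Omega> (b t) (b t)"
    and t: "0 \<le> t"
  shows "ip \<Omega> (p t) (p t) + ip \<Omega> (b t) (b t)
    \<le> 3 * exp (- 2 * \<delta> * t) * (ip \<Omega> (p 0) (p 0) + ip \<Omega> (b 0) (b 0))"
proof -
  define F where "F s = ip \<Omega> (p s) (p s) / 2 + ip \<Omega> (b s) (b s) / 2
    + 3 * \<delta> / 2 * ip \<Omega> (w s) (p s) + 3 * \<delta> * \<alpha> / 4 * ip \<Omega> (w s) (w s)" for s
  have wp: "2 * \<bar>ip \<Omega> (w s) (p s)\<bar> \<le> \<alpha> * ip \<Omega> (w s) (w s) + ip \<Omega> (p s) (p s) / \<alpha>"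
    if s: "0 \<le> s" for s
  proof -
    let ?ww = "ip \<Omega> (w s) (w s)" and ?wp = "ip \<Omega> (w s) (p s)" and ?pp = "ip \<Omega> (p s) (p s)"
    have "0 \<le> \<alpha> * \<alpha> * ?ww + 2 * \<alpha> * ?wp + ?pp" "0 \<le> \<alpha> * \<alpha> * ?ww - 2 * \<alpha> * ?wp + ?pp"
      using ip_self_nonneg[of \<Omega> "\<lambda>x. \<alpha> * w s x + p s x"] ip_self_nonneg[of \<Omega> "\<lambda>x. \<alpha> * w s x - p s x"]
        L(1,2)[OF s]
      by (simp_all add: ip_square_add ip_square_diff L2_scale)
    then have "2 * \<alpha> * \<bar>?wp\<bar> \<le> \<alpha> * \<alpha> * ?ww + ?pp" by (cases "?wp \<ge> 0") auto
    then show ?thesis using a by (simp add: field_simps)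
  qed
  note bounds = lyapunov_bounds[OF a d ip_self_nonneg ip_self_nonneg ip_self_nonneg lam wp, folded F_def]
  have dF: "(F has_real_derivative
      - ((\<alpha> - 3 * \<delta> / 2) * ip \<Omega> (p s) (p s) + 3 * \<delta> / 2 * ip \<Omega> (b s) (b s))) (at s within {0..})"
    if s: "0 \<le> s" for s
  proof -
    note D = ip_has_real_derivative[OF _ _ _ _ s]
    note Dpp = D[OF L(2) L(2) L(3)[OF s] L(3)[OF s] dp[OF s] dp[OF s]]
      and Dbb = D[OF L(4) L(4) L(5)[OF s] L(5)[OF s] db[OF s] db[OF s]]
      and Dwp = D[OF L(1) L(2) L(2)[OF s] L(3)[OF s] dw[OF s] dp[OF s]]
      and Dww = D[OF L(1) L(1) L(2)[OF s] L(2)[OF s] dw[OF s] dw[OF s]]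
    have E1: "ip \<Omega> (q s) (p s) = - \<alpha> * ip \<Omega> (p s) (p s) - ip \<Omega> (b s) (c s)"
      and E2: "ip \<Omega> (q s) (w s) = - \<alpha> * ip \<Omega> (p s) (w s) - ip \<Omega> (b s) (b s)"
      using e1[OF s] e2[OF s] by auto
    show ?thesis
      unfolding F_def[abs_def]
    proof (rule DERIV_cong[OF DERIV_add[OF DERIV_add[OF DERIV_add[OF DERIV_cdivide[OF Dpp]
              DERIV_cdivide[OF Dbb]] DERIV_cmult[OF Dwp]] DERIV_cmult[OF Dww]]])
      have *: "ip \<Omega> (p s) (q s) = ip \<Omega> (q s) (p s)" "ip \<Omega> (c s) (b s) = ip \<Omega> (b s) (c s)"
        "ip \<Omega> (w s) (q s) = ip \<Omega> (q s) (w s)" "ip \<Omega> (w s) (p s) = ip \<Omega> (p s) (w s)"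
        by (rule ip_commute)+
      \<comment> \<open>The terms with \<open>ip \<Omega> (b s) (c s)\<close> cancel by
        \<open>E1\<close>. The damping part of \<open>E2\<close> cancels against the derivative of
        the term in \<open>ip \<Omega> (w s) (w s)\<close>, which is why \<open>F\<close> contains
        that term.\<close>
      show "(ip \<Omega> (q s) (p s) + ip \<Omega> (p s) (q s)) / 2 + (ip \<Omega> (c s) (b s) + ip \<Omega> (b s) (c s)) / 2 +
          3 * \<delta> / 2 * (ip \<Omega> (p s) (p s) + ip \<Omega> (w s) (q s)) +
          3 * \<delta> * \<alpha> / 4 * (ip \<Omega> (p s) (w s) + ip \<Omega> (w s) (p s)) =
          - ((\<alpha> - 3 * \<delta> / 2) * ip \<Omega> (p s) (p s) + 3 * \<delta> / 2 * ip \<Omega> (b s) (b s))"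
        unfolding * E1 E2 by (simp add: field_simps)
    qed
  qed
  \<comment> \<open>Monotonicity from the open interval and continuity: at time 0 only a one-sided
    derivative of \<open>F\<close> exists.\<close>
  have "exp (2 * \<delta> * t) * F t \<le> exp (2 * \<delta> * 0) * F 0"
  proof (rule DERIV_nonpos_imp_decreasing_open[OF t])
    show "\<exists>y. DERIV (\<lambda>s. exp (2 * \<delta> * s) * F s) s :> y \<and> y \<le> 0" if s: "0 < s" "s < t" for s
    proof -
      let ?D = "- ((\<alpha> - 3 * \<delta> / 2) * ip \<Omega> (p s) (p s) + 3 * \<delta> / 2 * ip \<Omega> (b s) (b s))"
      have "at s within {0..} = at s" using s by (intro at_within_interior) auto
      then have "DERIV F s :> ?D" using dF[of s] s by simp
      then have "DERIV (\<lambda>s. exp (2 * \<delta> * s) * F s) s :> exp (2 * \<delta> * s) * (2 * \<delta> * F s + ?D)"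
        by (auto intro!: derivative_eq_intros simp: algebra_simps)
      moreover have "exp (2 * \<delta> * s) * (2 * \<delta> * F s + ?D) \<le> 0"
        using bounds(3)[of s] s by (intro mult_nonneg_nonpos) auto
      ultimately show ?thesis by blast
    qed
    have "continuous_on {0..} F"
      using dF by (auto simp: continuous_on_eq_continuous_within intro: DERIV_continuous)
    then have "continuous_on {0..t} F" by (rule continuous_on_subset) auto
    then show "continuous_on {0..t} (\<lambda>s. exp (2 * \<delta> * s) * F s)"
      by (intro continuous_intros)
  qed
  then have "F t \<le> exp (- 2 * \<delta> * t) * F 0"
    by (simp add: exp_minus field_simps)
  also have "\<dots> \<le> exp (- 2 * \<delta> * t) * (3 / 4 * (ip \<Omega> (p 0) (p 0) + ip \<Omega> (b 0) (b 0)))"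
    using bounds(2)[of 0] by (intro mult_left_mono) auto
  finally show ?thesis using bounds(1)[OF t t] by (simp add: algebra_simps)
qed


text \<open>The weak equation only makes \<open>z'\<close> a solution of finite energy, for which \<open>z''\<close> is not an
  admissible test function. The difference quotients of \<open>z\<close> are regular solutions, and their energy
  tends to that of \<open>z'\<close>.\<close>

lemma derivative_damped_wave_decay:
  fixes z p q :: "real \<Rightarrow> ('n::finite) fld"
  assumes lin: "linear_operator \<Omega> V B"
    and lam: "\<And>f. f \<in> V \<Longrightarrow> lam * ip \<Omega> f f \<le> ip \<Omega> (B f) (B f)"
    and a: "\<alpha> > 0" and d: "0 < \<delta>" "\<delta> \<le> 1/3 * min \<alpha> (lam / (2 * \<alpha>))"
    and zV: "\<And>t. 0 \<le> t \<Longrightarrow> z t \<in> V" and pV: "\<And>t. 0 \<le> t \<Longrightarrow> p t \<in> V"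
    and qL: "\<And>t. 0 \<le> t \<Longrightarrow> q t \<in> L2 \<Omega>"
    and dz: "\<And>t. 0 \<le> t \<Longrightarrow> has_time_deriv (nrm \<Omega>) z (p t) t"
    and dp: "\<And>t. 0 \<le> t \<Longrightarrow> has_time_deriv (nrm \<Omega>) p (q t) t"
    and db: "\<And>t. 0 \<le> t \<Longrightarrow> has_time_deriv (nrm \<Omega>) (\<lambda>s. B (z s)) (B (p t)) t"
    and eq: "\<And>t w. 0 \<le> t \<Longrightarrow> w \<in> V \<Longrightarrow> ip \<Omega> (q t) w + \<alpha> * ip \<Omega> (p t) w + ip \<Omega> (B (z t)) (B w) = 0"
    and t: "0 \<le> t"
  shows "ip \<Omega> (q t) (q t) + ip \<Omega> (B (p t)) (B (p t))
    \<le> 3 * exp (- 2 * \<delta> * t) * (ip \<Omega> (q 0) (q 0) + ip \<Omega> (B (p 0)) (B (p 0)))"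
proof -
  have VL: "f \<in> L2 \<Omega>" "B f \<in> L2 \<Omega>" if "f \<in> V" for f
    using lin that by (auto simp: linear_operator_def)
  define Q where "Q h f s = (\<lambda>x. (f (s + h) x - f s x) / h)" for h and f :: "real \<Rightarrow> 'n fld" and s
  have QV: "Q h f s \<in> V" and QB: "aeq \<Omega> (B (Q h f s)) (Q h (\<lambda>s. B (f s)) s)"
    if f: "\<And>t. 0 \<le> t \<Longrightarrow> f t \<in> V" and h: "0 < h" and s: "0 \<le> s" for h s f
  proof -
    have lc: "(\<lambda>x. c * f x + g x) \<in> V"
      "aeq \<Omega> (B (\<lambda>x. c * f x + g x)) (\<lambda>x. c * B f x + B g x)" if "f \<in> V" "g \<in> V" for f g c
      using lin that by (auto simp: linear_operator_def)
    have z0: "(\<lambda>x. 0) \<in> V" using lin by (auto simp: linear_operator_def)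
    have fs: "f s \<in> V" "f (s + h) \<in> V" using f s h by auto
    \<comment> \<open>\<open>linear_operator\<close> speaks only of combinations
      \<open>c * f + g\<close>, so the difference quotient is built from zero in two such
      steps.\<close>
    let ?g = "\<lambda>x. (1/h) * f (s + h) x + 0"
    let ?k = "\<lambda>x. (-1/h) * f s x + ?g x"
    have k: "?k = Q h f s" by (simp add: Q_def diff_divide_distrib)
    have B0: "aeq \<Omega> (B (\<lambda>x. 0)) (\<lambda>x. 0)"
    proof -
      have "aeq \<Omega> (B (\<lambda>x. 1 * 0 + 0)) (\<lambda>x. 1 * B (\<lambda>x. 0) x + B (\<lambda>x. 0) x)"
        by (rule lc(2)[OF z0 z0])
      then show ?thesis by (simp add: aeq_def)
    qed
    have g: "?g \<in> V" by (rule lc(1)[OF fs(2) z0])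
    then show "Q h f s \<in> V" using lc(1)[OF fs(1) g] k by metis
    have "aeq \<Omega> (B ?k) (\<lambda>x. (-1/h) * B (f s) x + B ?g x)" by (rule lc(2)[OF fs(1) g])
    moreover have "aeq \<Omega> (B ?g) (\<lambda>x. (1/h) * B (f (s+h)) x + B (\<lambda>x. 0) x)"
      by (rule lc(2)[OF fs(2) z0])
    ultimately have "aeq \<Omega> (B ?k) (Q h (\<lambda>s. B (f s)) s)"
      using B0 unfolding aeq_def
      by eventually_elim (simp add: Q_def diff_divide_distrib; linarith)
    then show "aeq \<Omega> (B (Q h f s)) (Q h (\<lambda>s. B (f s)) s)" unfolding k .
  qed
  have QL: "Q h f s \<in> L2 \<Omega>" if "\<And>t. 0 \<le> t \<Longrightarrow> f t \<in> L2 \<Omega>" "0 < h" "0 \<le> s" for h s f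
    unfolding Q_def using that by (intro L2_intros) auto
  have dQ: "has_time_deriv (nrm \<Omega>) (Q h f) (Q h f' s) s"
    if "\<And>t. 0 \<le> t \<Longrightarrow> f t \<in> L2 \<Omega>" "\<And>t. 0 \<le> t \<Longrightarrow> f' t \<in> L2 \<Omega>"
      "\<And>t. 0 \<le> t \<Longrightarrow> has_time_deriv (nrm \<Omega>) f (f' t) t" "0 < h" "0 \<le> s" for h s f f'
    unfolding Q_def[abs_def]
    using that by (intro has_time_deriv_diff_divide has_time_deriv_shift) auto
  let ?b = "\<lambda>s. B (z s)" and ?c = "\<lambda>s. B (p s)"
  note Ls = VL(1)[OF zV] VL(1)[OF pV] qL VL(2)[OF zV] VL(2)[OF pV]
  have step: "ip \<Omega> (Q h p t) (Q h p t) + ip \<Omega> (Q h ?b t) (Q h ?b t)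
    \<le> 3 * exp (- 2 * \<delta> * t) * (ip \<Omega> (Q h p 0) (Q h p 0) + ip \<Omega> (Q h ?b 0) (Q h ?b 0))"
    if h: "0 < h" for h
  proof (rule regular_damped_wave_decay[OF a d, where w = "Q h z" and q = "Q h q" and c = "Q h ?c"])
    fix s :: real assume s: "0 \<le> s"
    have eqQ: "ip \<Omega> (Q h q s) w + \<alpha> * ip \<Omega> (Q h p s) w + ip \<Omega> (Q h ?b s) (B w) = 0"
      if w: "w \<in> V" for w
    proof -
      have "ip \<Omega> (Q h q s) w + \<alpha> * ip \<Omega> (Q h p s) w + ip \<Omega> (Q h ?b s) (B w)
        = ((ip \<Omega> (q (s+h)) w + \<alpha> * ip \<Omega> (p (s+h)) w + ip \<Omega> (B (z (s+h))) (B w))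
          - (ip \<Omega> (q s) w + \<alpha> * ip \<Omega> (p s) w + ip \<Omega> (B (z s)) (B w))) / h"
        unfolding Q_def using s h VL[OF w] Ls by (simp add: ip_diff_left field_simps)
      also have "\<dots> = 0" using eq[OF _ w, of s] eq[OF _ w, of "s+h"] s h by simp
      finally show ?thesis .
    qed
    \<comment> \<open>For positive \<open>h\<close> both \<open>Q h z s\<close> and
      \<open>Q h p s\<close> lie in \<open>V\<close> and may be used as test functions, although the
      limit \<open>q s\<close> of the latter need not. \<open>B\<close> commutes with the quotient
      only up to null sets.\<close>
    have "ip \<Omega> (Q h ?b s) (B (Q h z s)) = ip \<Omega> (Q h ?b s) (Q h ?b s)"
      "ip \<Omega> (Q h ?b s) (B (Q h p s)) = ip \<Omega> (Q h ?b s) (Q h ?c s)"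
      by (rule ip_cong; use QB QV QL VL zV pV h s in auto)+
    then show "ip \<Omega> (Q h q s) (Q h p s) + \<alpha> * ip \<Omega> (Q h p s) (Q h p s) + ip \<Omega> (Q h ?b s) (Q h ?c s) = 0"
      "ip \<Omega> (Q h q s) (Q h z s) + \<alpha> * ip \<Omega> (Q h p s) (Q h z s) + ip \<Omega> (Q h ?b s) (Q h ?b s) = 0"
      using eqQ[OF QV[where f = p, OF pV h s]] eqQ[OF QV[where f = z, OF zV h s]] by simp_all
    have "ip \<Omega> (B (Q h z s)) (B (Q h z s)) = ip \<Omega> (Q h ?b s) (Q h ?b s)"
      by (rule ip_cong; use QB QV QL VL zV h s in auto)
    then show "lam * ip \<Omega> (Q h z s) (Q h z s) \<le> ip \<Omega> (Q h ?b s) (Q h ?b s)"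
      using lam[OF QV[where f = z, OF zV h s]] by simp
  qed (use Ls dz dp db h t in \<open>auto intro!: QL dQ\<close>)
  have lim: "((\<lambda>h. ip \<Omega> (Q h f s) (Q h f s)) \<longlongrightarrow> ip \<Omega> f' f') (at_right 0)"
    if f: "\<And>t. 0 \<le> t \<Longrightarrow> f t \<in> L2 \<Omega>" and f': "f' \<in> L2 \<Omega>" and s: "0 \<le> s"
      and df: "has_time_deriv (nrm \<Omega>) f f' s" for f f' s
  proof -
    have "filterlim (\<lambda>h. s + h) (at s within {0..}) (at_right 0)"
      unfolding filterlim_at using s
      by (auto intro!: tendsto_eq_intros simp: eventually_at_filter)
    from filterlim_compose[OF df[unfolded has_time_deriv_def] this]
    have "((\<lambda>h. nrm \<Omega> (\<lambda>x. Q h f s x - f' x)) \<longlongrightarrow> 0) (at_right 0)" by (simp add: Q_def)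
    moreover have "\<forall>\<^sub>F h in at_right 0. Q h f s \<in> L2 \<Omega>"
      using QL[of f, OF f _ s] by (auto simp: eventually_at_filter)
    ultimately show ?thesis using f' by (intro ip_tendsto)
  qed
  show ?thesis
  proof (rule tendsto_le)
    show "((\<lambda>h. ip \<Omega> (Q h p t) (Q h p t) + ip \<Omega> (Q h ?b t) (Q h ?b t)) \<longlongrightarrow>
        ip \<Omega> (q t) (q t) + ip \<Omega> (?c t) (?c t)) (at_right 0)"
      using Ls dp db t by (intro tendsto_add lim) auto
    show "((\<lambda>h. 3 * exp (- 2 * \<delta> * t) * (ip \<Omega> (Q h p 0) (Q h p 0) + ip \<Omega> (Q h ?b 0) (Q h ?b 0))) \<longlongrightarrow>
        3 * exp (- 2 * \<delta> * t) * (ip \<Omega> (q 0) (q 0) + ip \<Omega> (?c 0) (?c 0))) (at_right 0)"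
      using Ls dp db by (intro tendsto_mult_left tendsto_add lim) auto
    show "\<forall>\<^sub>F h in at_right 0. ip \<Omega> (Q h p t) (Q h p t) + ip \<Omega> (Q h ?b t) (Q h ?b t)
      \<le> 3 * exp (- 2 * \<delta> * t) * (ip \<Omega> (Q h p 0) (Q h p 0) + ip \<Omega> (Q h ?b 0) (Q h ?b 0))"
      using step by (auto simp: eventually_at_filter)
  qed simp
qed


section \<open>Smooth and test functions\<close>

text \<open>A partial derivative at a point depends on the values nearby, hence the open set:
  equality on it passes to all derivatives.\<close>

lemma Ck_on_cong:
  assumes "open S" "\<And>x. x \<in> S \<Longrightarrow> f x = g x" "Ck_on k S f"
  shows "Ck_on k S g"
  using assms(2,3)
proof (induction k arbitrary: f g)
  case 0
  then show ?case by (simp cong: continuous_on_cong)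
next
  case (Suc k)
  have d: "f differentiable (at x)" if "x \<in> S" for x using Suc that by simp
  have "g differentiable (at x)" if "x \<in> S" for x
    using d[OF that] has_derivative_transform_within_open[OF _ assms(1) that, of f _ UNIV g] Suc.prems(1)
    unfolding differentiable_def by blast
  moreover have "Ck_on k S (pderiv_at i g)" for i
  proof (rule Suc.IH)
    show "Ck_on k S (pderiv_at i f)" using Suc by simp
    show "pderiv_at i f x = pderiv_at i g x" if "x \<in> S" for x
      using frechet_derivative_transform_within_open[OF d[OF that] assms(1) that, of g] Suc.prems(1)
      by (simp add: pderiv_at_def)
  qed
  ultimately show ?case by simp
qed

lemma Ck_on_subset: "Ck_on k S f \<Longrightarrow> T \<subseteq> S \<Longrightarrow> Ck_on k T f"
  by (induction k arbitrary: f) (auto intro: continuous_on_subset)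

lemma Ck_on_Un: "open S \<Longrightarrow> open T \<Longrightarrow> Ck_on k S f \<Longrightarrow> Ck_on k T f \<Longrightarrow> Ck_on k (S \<union> T) f"
  by (induction k arbitrary: f) (auto intro: continuous_on_open_Un)

lemma Ck_on_const:
  fixes S :: "(real^'n::finite) set"
  shows "Ck_on k S (\<lambda>x. c)"
proof (induction k arbitrary: c)
  case (Suc k)
  have "pderiv_at i (\<lambda>x. c) = (\<lambda>x. 0)" for i :: 'n by (simp add: pderiv_at_def)
  then show ?case using Suc by simp
qed simp

lemma pderiv_at_eqI: "(f has_derivative D) (at x) \<Longrightarrow> pderiv_at i f x = D (axis i 1)"
  unfolding pderiv_at_def by (metis frechet_derivative_at)

lemma pderiv_at_add:
  "f differentiable (at x) \<Longrightarrow> g differentiable (at x) \<Longrightarrow>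
    pderiv_at i (\<lambda>y. f y + g y) x = pderiv_at i f x + pderiv_at i g x"
  unfolding frechet_derivative_works
  by (drule (1) has_derivative_add, drule pderiv_at_eqI[of _ _ _ i]) (simp add: pderiv_at_def)

lemma pderiv_at_mult:
  fixes f g :: "('n::finite) fld"
  shows "f differentiable (at x) \<Longrightarrow> g differentiable (at x) \<Longrightarrow>
    pderiv_at i (\<lambda>y. f y * g y) x = f x * pderiv_at i g x + pderiv_at i f x * g x"
  unfolding frechet_derivative_works
  by (drule (1) has_derivative_mult, drule pderiv_at_eqI[of _ _ _ i]) (simp add: pderiv_at_def)

lemma Ck_on_add:
  assumes "open S" "Ck_on k S f" "Ck_on k S g"
  shows "Ck_on k S (\<lambda>x. f x + g x)"
  using assms(2,3)
proof (induction k arbitrary: f g)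
  case 0
  then show ?case by (simp add: continuous_on_add)
next
  case (Suc k)
  have "Ck_on k S (pderiv_at i (\<lambda>x. f x + g x))" for i
    by (rule Ck_on_cong[OF assms(1) _ Suc.IH[of "pderiv_at i f" "pderiv_at i g"]])
       (use Suc in \<open>auto simp: pderiv_at_add\<close>)
  then show ?case using Suc by auto
qed

lemma smooth_on_pderiv_at: "smooth_on S f \<Longrightarrow> smooth_on S (pderiv_at i f)"
  unfolding smooth_on_def by (metis Ck_on.simps(2))

lemma smooth_on_imp_differentiable: "smooth_on S f \<Longrightarrow> x \<in> S \<Longrightarrow> f differentiable (at x)"
  unfolding smooth_on_def by (metis Ck_on.simps(2))

lemma smooth_on_imp_continuous_on: "smooth_on S f \<Longrightarrow> continuous_on S f"
  unfolding smooth_on_def by (metis Ck_on.simps(1))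

lemma smooth_on_const: "smooth_on S (\<lambda>x. c)"
  by (simp add: smooth_on_def Ck_on_const)

lemma smooth_on_add: "open S \<Longrightarrow> smooth_on S f \<Longrightarrow> smooth_on S g \<Longrightarrow> smooth_on S (\<lambda>x. f x + g x)"
  by (simp add: smooth_on_def Ck_on_add)

text \<open>The induction assumes full smoothness of both factors at every order. In the Leibniz
  rule one factor stays undifferentiated, and this spares descending from order \<open>Suc k\<close>
  to order \<open>k\<close>.\<close>

lemma smooth_on_mult:
  assumes S: "open S" and "smooth_on S f" "smooth_on S g"
  shows "smooth_on S (\<lambda>x. f x * g x)"
proof -
  have "Ck_on k S (\<lambda>x. f x * g x)" for k
    using assms(2,3)
  proof (induction k arbitrary: f g)
    case 0
    then show ?case by (simp add: continuous_on_mult smooth_on_imp_continuous_on)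
  next
    case (Suc k)
    have "Ck_on k S (pderiv_at i (\<lambda>x. f x * g x))" for i
      by (rule Ck_on_cong[OF S _ Ck_on_add[OF S Suc.IH[of f "pderiv_at i g"] Suc.IH[of "pderiv_at i f" g]]])
         (use Suc.prems in \<open>auto simp: pderiv_at_mult smooth_on_imp_differentiable smooth_on_pderiv_at\<close>)
    moreover have "(\<lambda>x. f x * g x) differentiable (at x)" if "x \<in> S" for x
      using Suc.prems that by (intro differentiable_mult) (auto intro: smooth_on_imp_differentiable)
    ultimately show ?case by simp
  qed
  then show ?thesis by (simp add: smooth_on_def)
qed

section \<open>Closure properties of test functions\<close>

lemma test_functionsE:
  assumes "\<psi> \<in> test_functions \<Omega>"
  obtains K where "compact K" "K \<subseteq> \<Omega>" "\<And>x. x \<notin> K \<Longrightarrow> \<psi> x = 0" "smooth_on UNIV \<psi>"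
  using assms by (auto simp: test_functions_def)

lemma test_function_smooth: "\<psi> \<in> test_functions \<Omega> \<Longrightarrow> smooth_on UNIV \<psi>"
  by (simp add: test_functions_def)

lemma test_function_differentiable: "\<psi> \<in> test_functions \<Omega> \<Longrightarrow> \<psi> differentiable (at x)"
  by (auto intro: smooth_on_imp_differentiable test_function_smooth)

lemma test_function_outside: "\<psi> \<in> test_functions \<Omega> \<Longrightarrow> x \<notin> \<Omega> \<Longrightarrow> \<psi> x = 0"
  by (auto simp: test_functions_def)

lemma test_function_continuous: "\<psi> \<in> test_functions \<Omega> \<Longrightarrow> continuous_on A \<psi>"
  by (meson continuous_on_subset smooth_on_imp_continuous_on test_function_smooth subset_UNIV)

lemma test_function_borel: "\<psi> \<in> test_functions \<Omega> \<Longrightarrow> \<psi> \<in> borel_measurable borel"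
  by (intro borel_measurable_continuous_onI test_function_continuous)

lemma test_function_pderiv:
  assumes "\<psi> \<in> test_functions \<Omega>"
  shows "pderiv_at i \<psi> \<in> test_functions \<Omega>"
proof -
  from assms obtain K where K: "compact K" "K \<subseteq> \<Omega>" "\<And>x. x \<notin> K \<Longrightarrow> \<psi> x = 0"
    and s: "smooth_on UNIV \<psi>" by (elim test_functionsE) blast
  have "pderiv_at i \<psi> x = 0" if "x \<notin> K" for x
  proof -
    have "frechet_derivative (\<lambda>x. 0) (at x) = frechet_derivative \<psi> (at x)"
      by (rule frechet_derivative_transform_within_open[of _ _ "- K"])
         (use K that in \<open>auto intro: compact_imp_closed\<close>)
    then show ?thesis by (simp add: pderiv_at_def fun_eq_iff)
  qed
  then show ?thesis using K smooth_on_pderiv_at[OF s] by (auto simp: test_functions_def)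
qed

lemma test_function_add:
  assumes "\<psi> \<in> test_functions \<Omega>" "\<phi> \<in> test_functions \<Omega>"
  shows "(\<lambda>x. \<psi> x + \<phi> x) \<in> test_functions \<Omega>"
proof -
  from assms obtain K L where "compact K" "K \<subseteq> \<Omega>" "\<And>x. x \<notin> K \<Longrightarrow> \<psi> x = 0"
    "compact L" "L \<subseteq> \<Omega>" "\<And>x. x \<notin> L \<Longrightarrow> \<phi> x = 0" by (metis test_functionsE)
  then have "compact (K \<union> L)" "K \<union> L \<subseteq> \<Omega>" "\<forall>x. x \<notin> K \<union> L \<longrightarrow> \<psi> x + \<phi> x = 0" by auto
  then show ?thesis using smooth_on_add[of UNIV \<psi> \<phi>] assms
    unfolding test_functions_def by blast
qed

lemma test_function_zero: "(\<lambda>x. 0) \<in> test_functions \<Omega>"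
  by (auto simp: test_functions_def smooth_on_const)

lemma test_function_sum:
  "(\<And>i. i \<in> I \<Longrightarrow> f i \<in> test_functions \<Omega>) \<Longrightarrow> (\<lambda>x. \<Sum>i\<in>I. f i x) \<in> test_functions \<Omega>"
  by (induction I rule: infinite_finite_induct) (auto intro: test_function_add test_function_zero)

text \<open>The coefficient is smooth only on a neighbourhood \<open>U\<close> of the closure.
  Outside the compact support the product vanishes, and \<open>U\<close> together with the
  complement of the support is an open cover of the space.\<close>

lemma test_function_smooth_mult:
  assumes a: "smooth_closure \<Omega> a" and p: "\<psi> \<in> test_functions \<Omega>"
  shows "(\<lambda>x. a x * \<psi> x) \<in> test_functions \<Omega>"
proof -
  from p obtain K where K: "compact K" "K \<subseteq> \<Omega>" "\<And>x. x \<notin> K \<Longrightarrow> \<psi> x = 0" "smooth_on UNIV \<psi>"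
    by (elim test_functionsE) blast
  from a obtain U where U: "open U" "closure \<Omega> \<subseteq> U" "smooth_on U a" by (auto simp: smooth_closure_def)
  have KU: "U \<union> - K = UNIV" using K U closure_subset[of \<Omega>] by auto
  have "smooth_on U (\<lambda>x. a x * \<psi> x)"
    using U K by (intro smooth_on_mult) (auto simp: smooth_on_def intro: Ck_on_subset)
  moreover have "Ck_on k (- K) (\<lambda>x. a x * \<psi> x)" for k
    by (rule Ck_on_cong[of "- K" "\<lambda>x. 0"]) (use K in \<open>auto intro: compact_imp_closed Ck_on_const\<close>)
  moreover have "open (- K)" using K by (simp add: compact_imp_closed open_Compl)
  ultimately have "smooth_on UNIV (\<lambda>x. a x * \<psi> x)"
    using Ck_on_Un[of U "- K"] U(1) KU unfolding smooth_on_def by metis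
  then show ?thesis using K by (auto simp: test_functions_def)
qed

lemma smooth_closure_const: "smooth_closure \<Omega> (\<lambda>x. c)"
  by (auto simp: smooth_closure_def smooth_on_const)

lemma test_function_scale: "\<psi> \<in> test_functions \<Omega> \<Longrightarrow> (\<lambda>x. c * \<psi> x) \<in> test_functions \<Omega>"
  by (intro test_function_smooth_mult smooth_closure_const)

lemma test_function_diff:
  "\<psi> \<in> test_functions \<Omega> \<Longrightarrow> \<phi> \<in> test_functions \<Omega> \<Longrightarrow> (\<lambda>x. \<psi> x - \<phi> x) \<in> test_functions \<Omega>"
  using test_function_add[of \<psi> \<Omega> "\<lambda>x. (-1) * \<phi> x"] test_function_scale[of \<phi> \<Omega> "-1"] by simp

lemma test_function_mult:
  assumes "\<psi> \<in> test_functions \<Omega>" "\<phi> \<in> test_functions \<Omega>"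
  shows "(\<lambda>x. \<psi> x * \<phi> x) \<in> test_functions \<Omega>"
  using assms by (intro test_function_smooth_mult) (auto simp: smooth_closure_def intro!: exI[of _ UNIV] test_function_smooth)

section \<open>Integration of test functions and integration by parts\<close>

lemma test_function_integrable:
  assumes "\<psi> \<in> test_functions \<Omega>"
  shows "integrable lborel \<psi>"
proof -
  from assms obtain K where K: "compact K" "\<And>x. x \<notin> K \<Longrightarrow> \<psi> x = 0" by (elim test_functionsE) blast
  have "integrable lborel (\<lambda>x. indicator K x *\<^sub>R \<psi> x)"
    by (rule borel_integrable_compact[OF K(1) test_function_continuous[OF assms]])
  also have "(\<lambda>x. indicator K x *\<^sub>R \<psi> x) = \<psi>" by (rule ext) (use K in \<open>auto simp: indicator_def\<close>)
  finally show ?thesis .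
qed

text \<open>Bridges the two settings: inner products live on \<open>lebesgue_on \<Omega>\<close>,
  while translations and Fubini need the whole space.\<close>

lemma integral_lebesgue_on_eq_lborel:
  fixes F :: "'a::euclidean_space \<Rightarrow> real"
  assumes "F \<in> borel_measurable borel" "\<And>x. x \<notin> \<Omega> \<Longrightarrow> F x = 0" "\<Omega> \<in> sets lebesgue"
  shows "(LINT x|lebesgue_on \<Omega>. F x) = (LINT x|lborel. F x)"
proof -
  have "(LINT x|lebesgue_on \<Omega>. F x) = (LINT x|lebesgue. indicator \<Omega> x *\<^sub>R F x)"
    using assms by (intro integral_restrict_space) auto
  also have "(\<lambda>x. indicator \<Omega> x *\<^sub>R F x) = F" by (rule ext) (use assms(2) in \<open>auto simp: indicator_def\<close>)
  also have "(LINT x|lebesgue. F x) = (LINT x|lborel. F x)"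
    using assms(1) by (intro integral_completion) auto
  finally show ?thesis .
qed

lemma test_function_L2:
  assumes "\<psi> \<in> test_functions \<Omega>" "\<Omega> \<in> sets lebesgue"
  shows "\<psi> \<in> L2 \<Omega>"
proof -
  have "integrable lborel (\<lambda>x. (\<psi> x)\<^sup>2)"
    using test_function_integrable[OF test_function_mult[OF assms(1,1)]] by (simp add: power2_eq_square)
  then have int: "integrable lebesgue (\<lambda>x. (\<psi> x)\<^sup>2)"
    using test_function_borel[OF assms(1)] by (subst integrable_completion) auto
  have "integrable (lebesgue_on \<Omega>) (\<lambda>x. (\<psi> x)\<^sup>2)"
    by (subst integrable_restrict_space) (use integrable_mult_indicator[OF assms(2) int] assms(2) in auto)
  moreover have "\<psi> \<in> borel_measurable (lebesgue_on \<Omega>)"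
    using test_function_borel[OF assms(1)]
    by (intro measurable_restrict_space1) (auto intro: measurable_completion)
  ultimately show ?thesis by (simp add: L2_def)
qed

lemma ip_test_function:
  assumes "\<psi> \<in> test_functions \<Omega>" "\<phi> \<in> borel_measurable borel" "\<Omega> \<in> sets lebesgue"
  shows "ip \<Omega> \<psi> \<phi> = (LINT x|lborel. \<psi> x * \<phi> x)"
  unfolding ip_def using assms test_function_borel[OF assms(1)]
  by (intro integral_lebesgue_on_eq_lborel) (auto simp: test_function_outside)

lemma frechet_derivative_eq_sum_pderiv:
  fixes f :: "('n::finite) fld"
  assumes "f differentiable (at x)"
  shows "frechet_derivative f (at x) y = (\<Sum>i\<in>UNIV. y $ i * pderiv_at i f x)"
proof -
  have lin: "linear (frechet_derivative f (at x))" by (rule linear_frechet_derivative[OF assms])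
  have "frechet_derivative f (at x) y = frechet_derivative f (at x) (\<Sum>i\<in>UNIV. y $ i *\<^sub>R axis i 1)"
    using basis_expansion[of y] by (simp add: scalar_mult_eq_scaleR)
  also have "\<dots> = (\<Sum>i\<in>UNIV. y $ i * pderiv_at i f x)"
    by (simp add: linear_sum[OF lin] linear_scale[OF lin] pderiv_at_def)
  finally show ?thesis .
qed

lemma has_real_derivative_along_line:
  fixes f :: "('n::finite) fld"
  assumes "\<And>x. f differentiable (at x)"
  shows "((\<lambda>t. f (x + t *\<^sub>R y)) has_real_derivative (\<Sum>i\<in>UNIV. y $ i * pderiv_at i f (x + t *\<^sub>R y))) (at t)"
proof -
  have "(f has_derivative frechet_derivative f (at (x + t *\<^sub>R y))) (at (x + t *\<^sub>R y))"
    using assms frechet_derivative_works by blast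
  then have "((\<lambda>t. f (x + t *\<^sub>R y)) has_derivative
      (\<lambda>s. frechet_derivative f (at (x + t *\<^sub>R y)) (s *\<^sub>R y))) (at t)"
    by (rule has_derivative_compose[rotated]) (auto intro!: derivative_eq_intros)
  moreover have "(\<lambda>s. frechet_derivative f (at (x + t *\<^sub>R y)) (s *\<^sub>R y))
      = (*) (\<Sum>i\<in>UNIV. y $ i * pderiv_at i f (x + t *\<^sub>R y))"
    by (rule ext) (simp add: frechet_derivative_eq_sum_pderiv[OF assms] sum_distrib_left algebra_simps)
  ultimately show ?thesis by (simp only: has_field_derivative_def)
qed

lemma lborel_integral_translate:
  fixes f :: "'a::euclidean_space \<Rightarrow> real"
  assumes "f \<in> borel_measurable borel"
  shows "(LINT x|lborel. f (x + c)) = (LINT x|lborel. f x)"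
proof -
  have "(LINT x|lborel. f x) = (LINT x|distr lborel borel ((+) c). f x)" by (simp add: lborel_distr_plus)
  also have "\<dots> = (LINT x|lborel. f (c + x))" using assms by (intro integral_distr) auto
  finally show ?thesis by (simp add: add.commute)
qed

lemma lborel_nn_integral_translate:
  fixes f :: "'a::euclidean_space \<Rightarrow> ennreal"
  assumes "f \<in> borel_measurable borel"
  shows "(\<integral>\<^sup>+x. f (x + c) \<partial>lborel) = (\<integral>\<^sup>+x. f x \<partial>lborel)"
proof -
  have "(\<integral>\<^sup>+x. f x \<partial>lborel) = (\<integral>\<^sup>+x. f x \<partial>distr lborel borel ((+) c))" by (simp add: lborel_distr_plus)
  also have "\<dots> = (\<integral>\<^sup>+x. f (c + x) \<partial>lborel)" using assms by (intro nn_integral_distr) auto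
  finally show ?thesis by (simp add: add.commute)
qed

text \<open>The integral of \<psi>(x + e) - \<psi>(x) vanishes by translation invariance. Writing
  the difference as an integral of the derivative along the unit step and exchanging the integrals
  turns it into the integral of the derivative.\<close>

lemma integral_pderiv_test_function:
  fixes \<psi> :: "('n::finite) fld"
  assumes p: "\<psi> \<in> test_functions \<Omega>"
  shows "(LINT x|lborel. pderiv_at i \<psi> x) = 0"
proof -
  let ?e = "axis i 1 :: real^'n" and ?G = "pderiv_at i \<psi>"
  have G: "?G \<in> test_functions \<Omega>" by (rule test_function_pderiv[OF p])
  obtain K where K: "compact K" "\<And>x. x \<notin> K \<Longrightarrow> ?G x = 0" using G by (elim test_functionsE) blast
  \<comment> \<open>All points from which the unit step meets the support \<open>K\<close>. It is
    compact, which gives the joint integrability that Fubini requires.\<close>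
  define K' where "K' = (\<lambda>z. fst z - snd z *\<^sub>R ?e) ` (K \<times> {0..1})"
  have "compact K'"
    unfolding K'_def using K by (intro compact_continuous_image continuous_intros compact_Times) auto
  then have "compact (K' \<times> {0..1::real})" by (intro compact_Times) auto
  then have "integrable lborel (\<lambda>z. indicator (K' \<times> {0..1}) z *\<^sub>R ?G (fst z + snd z *\<^sub>R ?e))"
    by (rule borel_integrable_compact)
       (intro continuous_on_compose2[OF test_function_continuous[OF G, of UNIV]] continuous_intros, auto)
  also have "(\<lambda>z. indicator (K' \<times> {0..1}) z *\<^sub>R ?G (fst z + snd z *\<^sub>R ?e))
      = (\<lambda>(x, t). ?G (x + t *\<^sub>R ?e) * indicator {0..1} t)"
  proof (rule ext, safe)
    fix x t
    have "x \<in> K'" if "t \<in> {0..1}" "?G (x + t *\<^sub>R ?e) \<noteq> 0"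
      unfolding K'_def using that K by (intro image_eqI[of _ _ "(x + t *\<^sub>R ?e, t)"]) auto
    then show "indicator (K' \<times> {0..1}) (x, t) *\<^sub>R ?G (fst (x, t) + snd (x, t) *\<^sub>R ?e)
      = ?G (x + t *\<^sub>R ?e) * indicator {0..1} t"
      by (auto simp: indicator_def)
  qed
  finally have int: "integrable (lborel \<Otimes>\<^sub>M lborel) (\<lambda>(x, t::real). ?G (x + t *\<^sub>R ?e) * indicator {0..1} t)"
    by (simp add: lborel_prod)
  have FTC: "(LINT t|lborel. ?G (x + t *\<^sub>R ?e) * indicator {0..1} t) = \<psi> (x + ?e) - \<psi> x" for x
  proof -
    have d: "((\<lambda>t. \<psi> (x + t *\<^sub>R ?e)) has_real_derivative ?G (x + t *\<^sub>R ?e)) (at t)" for t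
      using has_real_derivative_along_line[of \<psi> x ?e t] test_function_differentiable[OF p]
      by (simp add: axis_def if_distrib[of "\<lambda>z. z * _"] cong: if_cong)
    have "continuous_on UNIV (\<lambda>t. ?G (x + t *\<^sub>R ?e))"
      by (rule continuous_on_compose2[OF test_function_continuous[OF G, of UNIV]])
         (auto intro!: continuous_intros)
    then have "isCont (\<lambda>t. ?G (x + t *\<^sub>R ?e)) t" for t
      by (simp add: continuous_on_eq_continuous_at)
    then show ?thesis
      using integral_FTC_Icc_real[of 0 1 "\<lambda>t. \<psi> (x + t *\<^sub>R ?e)" "\<lambda>t. ?G (x + t *\<^sub>R ?e)"] d by simp
  qed
  have "0 = (LINT x|lborel. \<psi> (x + ?e)) - (LINT x|lborel. \<psi> x)"
    using lborel_integral_translate[OF test_function_borel[OF p]] by simp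
  also have "\<dots> = (LINT x|lborel. \<psi> (x + ?e) - \<psi> x)"
  proof (rule Bochner_Integration.integral_diff[symmetric])
    show "integrable lborel (\<lambda>x. \<psi> (x + ?e))"
      using test_function_integrable[OF p] integrable_distr[of "(+) ?e" lborel borel \<psi>]
      by (simp add: lborel_distr_plus add.commute)
  qed (rule test_function_integrable[OF p])
  also have "\<dots> = (LINT x|lborel. LINT t|lborel. ?G (x + t *\<^sub>R ?e) * indicator {0..1} t)"
    by (simp only: FTC)
  also have "\<dots> = (LINT t|lborel. LINT x|lborel. ?G (x + t *\<^sub>R ?e) * indicator {0..1} t)"
    by (rule lborel_pair.Fubini_integral[symmetric, OF int])
  also have "\<dots> = (LINT t|lborel. (LINT x|lborel. ?G x) * indicator {0..1::real} t)"
    using lborel_integral_translate[OF test_function_borel[OF G]] by simp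
  also have "\<dots> = (LINT x|lborel. ?G x)" by simp
  finally show ?thesis ..
qed

lemma has_weak_pderiv_test_function:
  fixes \<psi> :: "('n::finite) fld"
  assumes p: "\<psi> \<in> test_functions \<Omega>" and S: "\<Omega> \<in> sets lebesgue"
  shows "has_weak_pderiv \<Omega> i \<psi> (pderiv_at i \<psi>)"
  unfolding has_weak_pderiv_def
proof (intro conjI ballI)
  show "\<psi> \<in> L2 \<Omega>" "pderiv_at i \<psi> \<in> L2 \<Omega>"
    using p S by (auto intro: test_function_L2 test_function_pderiv)
  fix \<phi> :: "'n fld" assume q: "\<phi> \<in> test_functions \<Omega>"
  note p' = test_function_pderiv[OF p, of i] and q' = test_function_pderiv[OF q, of i]
  have "ip \<Omega> \<psi> (pderiv_at i \<phi>) + ip \<Omega> (pderiv_at i \<psi>) \<phi>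
      = (LINT x|lborel. \<psi> x * pderiv_at i \<phi> x) + (LINT x|lborel. pderiv_at i \<psi> x * \<phi> x)"
    using p q p' q' S by (simp add: ip_test_function test_function_borel)
  also have "\<dots> = (LINT x|lborel. \<psi> x * pderiv_at i \<phi> x + pderiv_at i \<psi> x * \<phi> x)"
    using p q p' q'
    by (intro Bochner_Integration.integral_add[symmetric] test_function_integrable[OF test_function_mult])
  also have "\<dots> = (LINT x|lborel. pderiv_at i (\<lambda>x. \<psi> x * \<phi> x) x)"
    using p q by (simp add: pderiv_at_mult test_function_differentiable)
  also have "\<dots> = 0" by (rule integral_pderiv_test_function[OF test_function_mult[OF p q]])
  finally show "ip \<Omega> \<psi> (pderiv_at i \<phi>) = - ip \<Omega> (pderiv_at i \<psi>) \<phi>" by simp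
qed


section \<open>Rellich compactness on a grid of cubes\<close>

lemma nn_integral_test_function_square:
  assumes "\<psi> \<in> test_functions \<Omega>"
  shows "(\<integral>\<^sup>+x. ennreal ((\<psi> x)\<^sup>2) \<partial>lborel) = ennreal (LINT x|lborel. (\<psi> x)\<^sup>2)"
  using test_function_integrable[OF test_function_mult[OF assms assms]]
  by (intro nn_integral_eq_integral) (auto simp: power2_eq_square)

text \<open>Jensen's inequality on the unit interval, read off from the nonnegative integral of
  \<open>(g t - D)^2\<close>.\<close>

lemma square_integral_Icc_le:
  fixes g :: "real \<Rightarrow> real"
  assumes c: "continuous_on UNIV g" and D: "(LINT t|lborel. g t * indicator {0..1} t) = D"
  shows "ennreal (D\<^sup>2) \<le> (\<integral>\<^sup>+t. ennreal ((g t)\<^sup>2 * indicator {0..1} t) \<partial>lborel)"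
proof -
  have cont: "isCont (\<lambda>t. (g t)\<^sup>2) t" "isCont g t" for t
    using c by (auto simp: continuous_on_eq_continuous_at intro!: continuous_intros)
  note i = borel_integrable_atLeastAtMost[of 0 1 g] borel_integrable_atLeastAtMost[of 0 1 "\<lambda>t. (g t)\<^sup>2"]
  have i1: "integrable lborel (\<lambda>t. g t * indicator {0..1} t)"
    and i2: "integrable lborel (\<lambda>t. (g t)\<^sup>2 * indicator {0..1} t)"
    using i cont by auto
  have i3: "integrable lborel (\<lambda>t::real. indicat_real {0..1} t)" by simp
  have "0 \<le> (LINT t|lborel. (g t - D)\<^sup>2 * indicator {0..1} t)" by (intro Bochner_Integration.integral_nonneg) auto
  also have "(\<lambda>t. (g t - D)\<^sup>2 * indicat_real {0..1} t)
      = (\<lambda>t. (g t)\<^sup>2 * indicator {0..1} t - 2 * D * (g t * indicator {0..1} t) + D\<^sup>2 * indicat_real {0..1} t)"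
    by (auto simp: power2_diff algebra_simps)
  also have "(LINT t|lborel. \<dots> t) = (LINT t|lborel. (g t)\<^sup>2 * indicator {0..1} t) - 2 * D * D + D\<^sup>2"
    using i1 i2 i3 by (simp add: D)
  finally have "D\<^sup>2 \<le> (LINT t|lborel. (g t)\<^sup>2 * indicator {0..1} t)" by (simp add: power2_eq_square)
  then show ?thesis using i2 by (simp add: nn_integral_eq_integral)
qed

text \<open>The difference is the integral of the directional derivative \<open>G\<close> along the
  segment. After Jensen, Tonelli puts the integral over \<open>x\<close> inside, where translation
  invariance removes the dependence on the position on the segment. Cauchy-Schwarz in the direction
  \<open>y\<close> finishes the bound.\<close>

lemma translation_L2_bound:
  fixes \<psi> :: "('n::finite) fld"
  assumes p: "\<psi> \<in> test_functions \<Omega>"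
  shows "(\<integral>\<^sup>+x. ennreal ((\<psi> (x + y) - \<psi> x)\<^sup>2) \<partial>lborel)
    \<le> ennreal ((norm y)\<^sup>2 * (\<Sum>i\<in>UNIV. LINT x|lborel. (pderiv_at i \<psi> x)\<^sup>2))"
proof -
  define G where "G z = (\<Sum>i\<in>UNIV. y $ i * pderiv_at i \<psi> z)" for z
  have p': "pderiv_at i \<psi> \<in> test_functions \<Omega>" for i by (rule test_function_pderiv[OF p])
  have G: "G \<in> test_functions \<Omega>"
    unfolding G_def[abs_def] by (intro test_function_sum test_function_scale p')
  note [measurable] = test_function_borel[OF G]
  have "ennreal ((\<psi> (x + y) - \<psi> x)\<^sup>2) \<le> (\<integral>\<^sup>+t. ennreal ((G (x + t *\<^sub>R y))\<^sup>2 * indicator {0..1} t) \<partial>lborel)" for x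
  proof (rule square_integral_Icc_le)
    show c: "continuous_on UNIV (\<lambda>t. G (x + t *\<^sub>R y))"
      by (rule continuous_on_compose2[OF test_function_continuous[OF G, of UNIV]])
         (auto intro!: continuous_intros)
    have "((\<lambda>t. \<psi> (x + t *\<^sub>R y)) has_real_derivative G (x + t *\<^sub>R y)) (at t)" for t
      unfolding G_def by (rule has_real_derivative_along_line[OF test_function_differentiable[OF p]])
    then show "(LINT t|lborel. G (x + t *\<^sub>R y) * indicator {0..1} t) = \<psi> (x + y) - \<psi> x"
      using integral_FTC_Icc_real[of 0 1 "\<lambda>t. \<psi> (x + t *\<^sub>R y)" "\<lambda>t. G (x + t *\<^sub>R y)"] c
      by (simp add: continuous_on_eq_continuous_at)
  qed
  then have "(\<integral>\<^sup>+x. ennreal ((\<psi> (x + y) - \<psi> x)\<^sup>2) \<partial>lborel)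
      \<le> (\<integral>\<^sup>+x. \<integral>\<^sup>+t. ennreal ((G (x + t *\<^sub>R y))\<^sup>2 * indicator {0..1} t) \<partial>lborel \<partial>lborel)"
    by (intro nn_integral_mono)
  also have "\<dots> = (\<integral>\<^sup>+t. \<integral>\<^sup>+x. ennreal ((G (x + t *\<^sub>R y))\<^sup>2 * indicator {0..1} t) \<partial>lborel \<partial>lborel)"
    by (rule lborel_pair.Fubini'[symmetric]) measurable
  also have "\<dots> = (\<integral>\<^sup>+t. \<integral>\<^sup>+x. ennreal ((G x)\<^sup>2 * indicator {0..1::real} t) \<partial>lborel \<partial>lborel)"
  proof (rule nn_integral_cong)
    show "(\<integral>\<^sup>+x. ennreal ((G (x + t *\<^sub>R y))\<^sup>2 * indicator {0..1} t) \<partial>lborel)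
        = (\<integral>\<^sup>+x. ennreal ((G x)\<^sup>2 * indicator {0..1} t) \<partial>lborel)" for t
      by (rule lborel_nn_integral_translate[of "\<lambda>x. ennreal ((G x)\<^sup>2 * indicat_real {0..1} t)"]) measurable
  qed
  also have "\<dots> = (\<integral>\<^sup>+t. (\<integral>\<^sup>+x. ennreal ((G x)\<^sup>2) \<partial>lborel) * indicator {0..1::real} t \<partial>lborel)"
    by (intro nn_integral_cong) (auto simp: indicator_def)
  also have "\<dots> = (\<integral>\<^sup>+x. ennreal ((G x)\<^sup>2) \<partial>lborel)"
    by (simp add: nn_integral_cmult)
  also have "\<dots> = ennreal (LINT x|lborel. (G x)\<^sup>2)" by (rule nn_integral_test_function_square[OF G])
  also have "\<dots> \<le> ennreal ((norm y)\<^sup>2 * (\<Sum>i\<in>UNIV. LINT x|lborel. (pderiv_at i \<psi> x)\<^sup>2))"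
  proof (rule ennreal_leI)
    have int: "integrable lborel (\<lambda>x. (f x)\<^sup>2)" if "f \<in> test_functions \<Omega>" for f
      using test_function_integrable[OF test_function_mult[OF that that]] by (simp add: power2_eq_square)
    have "(G x)\<^sup>2 \<le> (norm y)\<^sup>2 * (\<Sum>i\<in>UNIV. (pderiv_at i \<psi> x)\<^sup>2)" for x
    proof -
      let ?g = "\<chi> i. pderiv_at i \<psi> x"
      have "G x = y \<bullet> ?g" by (simp add: G_def inner_vec_def)
      then have "(G x)\<^sup>2 \<le> (y \<bullet> y) * (?g \<bullet> ?g)" by (simp add: Cauchy_Schwarz_ineq)
      then show ?thesis by (simp add: power2_norm_eq_inner) (simp add: inner_vec_def power2_eq_square)
    qed
    then have "(LINT x|lborel. (G x)\<^sup>2) \<le> (LINT x|lborel. (norm y)\<^sup>2 * (\<Sum>i\<in>UNIV. (pderiv_at i \<psi> x)\<^sup>2))"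
      using int[OF G] int[OF p'] by (intro integral_mono) auto
    also have "\<dots> = (norm y)\<^sup>2 * (\<Sum>i\<in>UNIV. LINT x|lborel. (pderiv_at i \<psi> x)\<^sup>2)"
      using int[OF p'] by simp
    finally show "(LINT x|lborel. (G x)\<^sup>2) \<le> (norm y)\<^sup>2 * (\<Sum>i\<in>UNIV. LINT x|lborel. (pderiv_at i \<psi> x)\<^sup>2)" .
  qed
  finally show ?thesis .
qed

text \<open>Summands of either sign are allowed because \<open>ennreal\<close> cuts negative numbers
  off at 0.\<close>

lemma ennreal_sum_le: "ennreal (\<Sum>i\<in>I. f i) \<le> (\<Sum>i\<in>I. ennreal (f i))"
proof (induction I rule: infinite_finite_induct)
  case (insert i I)
  have "ennreal (a + b) \<le> ennreal a + ennreal b" for a b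
  proof -
    have "ennreal (a + b) \<le> ennreal (max 0 a + max 0 b)" by (rule ennreal_leI) simp
    then show ?thesis by (simp add: max_def ennreal_plus_if ennreal_neg split: if_splits)
  qed
  then have "ennreal (f i + (\<Sum>i\<in>I. f i)) \<le> ennreal (f i) + ennreal (\<Sum>i\<in>I. f i)" .
  also have "\<dots> \<le> ennreal (f i) + (\<Sum>i\<in>I. ennreal (f i))" using insert.IH by (rule add_left_mono)
  finally show ?case using insert.hyps by simp
qed auto

text \<open>Half-open cubes of side \<open>h\<close>. Encoding them by \<open>floor\<close> makes
  membership an equation for the index, so that every point lies in exactly one cube.\<close>

definition grid_cube :: "real \<Rightarrow> ('n \<Rightarrow> int) \<Rightarrow> (real^'n) set" where
  "grid_cube h k = {x. \<forall>i. \<lfloor>x $ i / h\<rfloor> = k i}"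

lemma mem_grid_cube_iff: "x \<in> grid_cube h k \<longleftrightarrow> k = (\<lambda>i. \<lfloor>x $ i / h\<rfloor>)"
  by (auto simp: grid_cube_def intro!: ext)

lemma grid_cube_eq:
  assumes "h > 0"
  shows "grid_cube h k = {x. \<forall>i. h * of_int (k i) \<le> x $ i \<and> x $ i < h * (of_int (k i) + 1)}"
  using assms by (auto simp: grid_cube_def floor_eq_iff field_simps)

lemma grid_cube_borel [measurable]:
  assumes "h > 0"
  shows "grid_cube h k \<in> sets (borel :: (real^'n::finite) measure)"
proof -
  have "grid_cube h k = (\<Inter>i. {x. h * of_int (k i) \<le> x $ i} \<inter> {x. x $ i < h * (of_int (k i) + 1)})"
    by (auto simp: grid_cube_eq[OF assms])
  also have "\<dots> \<in> sets borel"
    by (intro sets.finite_INT sets.Int borel_closed closed_Collect_le borel_open open_Collect_less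
        continuous_intros) auto
  finally show ?thesis .
qed

lemma emeasure_grid_cube:
  assumes h: "h > 0"
  shows "emeasure lborel (grid_cube h k :: (real^'n::finite) set) = ennreal (h ^ DIM(real^'n))"
proof -
  let ?a = "\<chi> i. h * of_int (k i) :: real^'n" and ?b = "\<chi> i. h * (of_int (k i) + 1) :: real^'n"
  have B: "(?b - ?a) \<bullet> e = h" "?a \<bullet> e \<le> ?b \<bullet> e" if "e \<in> Basis" for e
    using that h by (auto simp: Basis_vec_def inner_axis algebra_simps)
  have "emeasure lborel (box ?a ?b) = ennreal (\<Prod>e\<in>Basis. (?b - ?a) \<bullet> e)"
    using B(2) by (rule emeasure_lborel_box)
  moreover have "emeasure lborel (cbox ?a ?b) = ennreal (\<Prod>e\<in>Basis. (?b - ?a) \<bullet> e)"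
    using B(2) by (rule emeasure_lborel_cbox)
  moreover have "(\<Prod>e\<in>Basis. (?b - ?a) \<bullet> e) = h ^ DIM(real^'n)" using B(1) by simp
  moreover have "box ?a ?b \<subseteq> grid_cube h k" "grid_cube h k \<subseteq> cbox ?a ?b"
    by (auto simp: grid_cube_eq[OF h] mem_box_cart less_imp_le)
  then have "emeasure lborel (box ?a ?b) \<le> emeasure lborel (grid_cube h k)"
    "emeasure lborel (grid_cube h k) \<le> emeasure lborel (cbox ?a ?b)"
    using grid_cube_borel[OF h, of k] by (auto intro!: emeasure_mono)
  ultimately show ?thesis by simp
qed

lemma finite_grid_cubes:
  assumes "bounded S" "h > 0"
  shows "finite ((\<lambda>x i. \<lfloor>x $ i / h\<rfloor>) ` (S :: (real^'n::finite) set))"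
proof -
  obtain R where R: "\<And>x. x \<in> S \<Longrightarrow> norm x \<le> R" using assms(1) by (auto simp: bounded_iff)
  let ?B = "{\<lfloor>- R / h\<rfloor>..\<lfloor>R / h\<rfloor>}"
  have "\<lfloor>x $ i / h\<rfloor> \<in> ?B" if "x \<in> S" for x i
  proof -
    have "- R \<le> x $ i" "x $ i \<le> R" using component_le_norm_cart[of x i] R[OF that] by auto
    then have "- R / h \<le> x $ i / h" "x $ i / h \<le> R / h"
      using assms(2) by (intro divide_right_mono; simp)+
    then show ?thesis by (auto intro!: floor_mono)
  qed
  then have "(\<lambda>x i. \<lfloor>x $ i / h\<rfloor>) ` S \<subseteq> {f. \<forall>i. (i \<in> UNIV \<longrightarrow> f i \<in> ?B) \<and> (i \<notin> UNIV \<longrightarrow> f i = 0)}"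
    by auto
  then show ?thesis by (rule finite_subset) (intro finite_set_of_finite_funs; simp)
qed

text \<open>For positive \<open>m\<close> the right side is \<open>2 * m\<close> times the integral
  over \<open>Q\<close> of the squared deviation from the mean; the left side contains no mean, only
  differences of values.\<close>

lemma variance_on_set:
  fixes \<psi> :: "'a::euclidean_space \<Rightarrow> real"
  assumes Q [measurable]: "Q \<in> sets borel" and m: "emeasure lborel Q = ennreal m" "0 \<le> m"
    and i1: "integrable lborel \<psi>" and i2: "integrable lborel (\<lambda>x. (\<psi> x)\<^sup>2)"
  shows "(\<integral>\<^sup>+x. \<integral>\<^sup>+z. ennreal (indicator Q x * indicator Q z * (\<psi> x - \<psi> z)\<^sup>2) \<partial>lborel \<partial>lborel)
    = ennreal (2 * m * (LINT x|lborel. indicator Q x * (\<psi> x)\<^sup>2) - 2 * (LINT x|lborel. \<psi> x * indicator Q x)\<^sup>2)"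
proof -
  define s where "s = (LINT x|lborel. indicator Q x * (\<psi> x)\<^sup>2)"
  define a where "a = (LINT x|lborel. \<psi> x * indicator Q x)"
  have j0: "integrable lborel (indicat_real Q)" using m Q by (simp add: integrable_indicator_iff)
  have mQ: "measure lborel Q = m" using m by (simp add: measure_def)
  have j1: "integrable lborel (\<lambda>x. \<psi> x * indicator Q x)"
    using integrable_mult_indicator[of Q lborel \<psi>] i1 Q by (simp add: mult.commute)
  have j2: "integrable lborel (\<lambda>x. indicator Q x * (\<psi> x)\<^sup>2)"
    using integrable_mult_indicator[of Q lborel "\<lambda>x. (\<psi> x)\<^sup>2"] i2 Q by simp
  have eq: "(\<lambda>z. indicator Q x * indicator Q z * (\<psi> x - \<psi> z)\<^sup>2)
     = (\<lambda>z. indicator Q x * ((\<psi> x)\<^sup>2 * indicat_real Q z - 2 * \<psi> x * (\<psi> z * indicator Q z)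
          + indicator Q z * (\<psi> z)\<^sup>2))" for x
    by (auto simp: indicator_def power2_diff algebra_simps)
  have int: "integrable lborel (\<lambda>z. indicator Q x * indicator Q z * (\<psi> x - \<psi> z)\<^sup>2)" for x
    unfolding eq using j0 j1 j2
    by (intro integrable_mult_right Bochner_Integration.integrable_add Bochner_Integration.integrable_diff) auto
  have val: "(LINT z|lborel. indicator Q x * indicator Q z * (\<psi> x - \<psi> z)\<^sup>2)
      = indicator Q x * (m * (\<psi> x)\<^sup>2 - 2 * \<psi> x * a + s)" for x
    unfolding eq using j0 j1 j2 by (simp add: mQ a_def s_def mult.commute)
  have inner: "(\<integral>\<^sup>+z. ennreal (indicator Q x * indicator Q z * (\<psi> x - \<psi> z)\<^sup>2) \<partial>lborel)
      = ennreal (indicator Q x * (m * (\<psi> x)\<^sup>2 - 2 * \<psi> x * a + s))" for x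
    using nn_integral_eq_integral[OF int, of x] val by simp
  let ?J = "\<lambda>x. indicator Q x * (m * (\<psi> x)\<^sup>2 - 2 * \<psi> x * a + s)"
  have J: "?J = (\<lambda>x. m * (indicator Q x * (\<psi> x)\<^sup>2) - 2 * a * (\<psi> x * indicator Q x) + s * indicat_real Q x)"
    by (auto simp: algebra_simps)
  have Jint: "integrable lborel ?J"
    unfolding J using j0 j1 j2
    by (intro Bochner_Integration.integrable_add Bochner_Integration.integrable_diff) auto
  have Jval: "(LINT x|lborel. ?J x) = 2 * m * s - 2 * a\<^sup>2"
    unfolding J using j0 j1 j2 by (simp add: mQ flip: a_def s_def) (simp add: power2_eq_square)
  have Jnn: "0 \<le> ?J x" for x
    unfolding val[symmetric] by (intro Bochner_Integration.integral_nonneg) auto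
  have "(\<integral>\<^sup>+x. ennreal (?J x) \<partial>lborel) = ennreal (2 * m * s - 2 * a\<^sup>2)"
    using nn_integral_eq_integral[OF Jint] Jnn Jval by simp
  then show ?thesis by (simp add: inner a_def s_def)
qed

text \<open>Rellich compactness in quantitative form. On each cube of side \<open>h\<close> the deviation of \<open>\<psi>\<close> from
  its mean is a double integral of squared differences of \<open>\<psi>\<close>, and these are controlled by
  \<open>translation_L2_bound\<close> since two points of a cube differ by a vector in \<open>[-h,h]\<^sup>n\<close>.\<close>

lemma test_function_cube_estimate:
  fixes \<psi> :: "('n::finite) fld" and \<Omega> :: "(real^'n) set"
  assumes p: "\<psi> \<in> test_functions \<Omega>" and bnd: "bounded \<Omega>" and h: "h > 0"
  defines "N \<equiv> DIM(real^'n)" and "I \<equiv> (\<lambda>x i. \<lfloor>x $ i / h\<rfloor>) ` \<Omega>"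
  shows "h ^ N * (LINT x|lborel. (\<psi> x)\<^sup>2)
    \<le> (2 * h) ^ N * (real N * h)\<^sup>2 * (\<Sum>i\<in>UNIV. LINT x|lborel. (pderiv_at i \<psi> x)\<^sup>2)
      + (\<Sum>k\<in>I. (LINT x|lborel. \<psi> x * indicator (grid_cube h k) x)\<^sup>2)"
proof -
  have finI: "finite I" unfolding I_def by (rule finite_grid_cubes[OF bnd h])
  note [measurable] = test_function_borel[OF p] grid_cube_borel[OF h]
  have i1: "integrable lborel \<psi>" and i2: "integrable lborel (\<lambda>x. (\<psi> x)\<^sup>2)"
    using test_function_integrable[OF p] test_function_integrable[OF test_function_mult[OF p p]]
    by (auto simp: power2_eq_square)
  let ?m = "h ^ N"
  define s where "s k = (LINT x|lborel. indicator (grid_cube h k) x * (\<psi> x)\<^sup>2)" for k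
  define a where "a k = (LINT x|lborel. \<psi> x * indicator (grid_cube h k) x)" for k
  define D where "D = (\<Sum>i\<in>UNIV. LINT x|lborel. (pderiv_at i \<psi> x)\<^sup>2)"
  have D0: "0 \<le> D" unfolding D_def by (intro sum_nonneg Bochner_Integration.integral_nonneg) auto
  have m: "emeasure lborel (grid_cube h k) = ennreal ?m" for k :: "'n \<Rightarrow> int"
    unfolding N_def by (rule emeasure_grid_cube[OF h])
  let ?C = "cbox (\<chi> i. - h) (\<chi> i. h) :: (real^'n) set"
  let ?ind = "\<lambda>k. indicat_real (grid_cube h k)"
  have var: "ennreal (2 * ?m * s k - 2 * (a k)\<^sup>2)
      = (\<integral>\<^sup>+x. \<integral>\<^sup>+z. ennreal (?ind k x * ?ind k z * (\<psi> x - \<psi> z)\<^sup>2) \<partial>lborel \<partial>lborel)" for k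
    unfolding s_def a_def
    by (rule variance_on_set[symmetric, OF _ m _ i1 i2]) (use h in auto)
  have "ennreal (\<Sum>k\<in>I. 2 * ?m * s k - 2 * (a k)\<^sup>2) \<le> (\<Sum>k\<in>I. ennreal (2 * ?m * s k - 2 * (a k)\<^sup>2))"
    by (rule ennreal_sum_le)
  also have "\<dots> = (\<integral>\<^sup>+x. \<integral>\<^sup>+z. (\<Sum>k\<in>I. ennreal (?ind k x * ?ind k z * (\<psi> x - \<psi> z)\<^sup>2)) \<partial>lborel \<partial>lborel)"
    unfolding var by (simp add: nn_integral_sum del: sum_ennreal)
  \<comment> \<open>At most one index contributes for a given \<open>x\<close>, namely its own cube.
    Membership of \<open>z\<close> in that cube is weakened to \<open>z - x\<close> lying in
    \<open>?C\<close>, after which the grid has disappeared.\<close>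
  also have "\<dots> \<le> (\<integral>\<^sup>+x. \<integral>\<^sup>+z. ennreal (indicator ?C (z - x) * (\<psi> (x + (z - x)) - \<psi> x)\<^sup>2) \<partial>lborel \<partial>lborel)"
  proof (intro nn_integral_mono)
    fix x z :: "real^'n"
    let ?k = "\<lambda>x i. \<lfloor>x $ i / h\<rfloor>"
    have g: "?ind k x = (if k = ?k x then 1 else 0)" for k and x :: "real^'n"
      by (simp add: mem_grid_cube_iff indicator_def)
    have "(\<Sum>k\<in>I. ennreal (?ind k x * ?ind k z * (\<psi> x - \<psi> z)\<^sup>2))
        = (\<Sum>k\<in>I. if k = ?k x then ennreal (?ind (?k x) z * (\<psi> x - \<psi> z)\<^sup>2) else 0)"
      by (intro sum.cong) (auto simp: g)
    also have "\<dots> \<le> ennreal (?ind (?k x) z * (\<psi> x - \<psi> z)\<^sup>2)"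
      using finI by simp
    also have "\<dots> \<le> ennreal (indicator ?C (z - x) * (\<psi> (x + (z - x)) - \<psi> x)\<^sup>2)"
    proof (rule ennreal_leI)
      have "z - x \<in> ?C" if "z \<in> grid_cube h (?k x)"
      proof -
        have "x \<in> grid_cube h (?k x)" by (simp add: grid_cube_def)
        with that have c: "h * of_int (?k x i) \<le> x $ i" "x $ i < h * of_int (?k x i) + h"
          "h * of_int (?k x i) \<le> z $ i" "z $ i < h * of_int (?k x i) + h" for i
          unfolding grid_cube_eq[OF h] by (auto simp: distrib_left)
        have "- h \<le> z $ i - x $ i \<and> z $ i - x $ i \<le> h" for i
          using c[of i] by argo
        then show ?thesis by (simp add: mem_box_cart)
      qed
      then show "?ind (?k x) z * (\<psi> x - \<psi> z)\<^sup>2 \<le> indicator ?C (z - x) * (\<psi> (x + (z - x)) - \<psi> x)\<^sup>2"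
        by (auto simp: indicator_def power2_commute)
    qed
    finally show "(\<Sum>k\<in>I. ennreal (?ind k x * ?ind k z * (\<psi> x - \<psi> z)\<^sup>2))
        \<le> ennreal (indicator ?C (z - x) * (\<psi> (x + (z - x)) - \<psi> x)\<^sup>2)" .
  qed
  \<comment> \<open>Substitution of \<open>z = x + y\<close>, so that the order of integration can
    be exchanged and each translation by \<open>y\<close> estimated separately.\<close>
  also have "\<dots> = (\<integral>\<^sup>+x. \<integral>\<^sup>+y. ennreal (indicator ?C y * (\<psi> (x + y) - \<psi> x)\<^sup>2) \<partial>lborel \<partial>lborel)"
    using lborel_nn_integral_translate[of "\<lambda>y. ennreal (indicator ?C y * (\<psi> (x + y) - \<psi> x)\<^sup>2)" "- x" for x]
    by simp
  also have "\<dots> = (\<integral>\<^sup>+y. \<integral>\<^sup>+x. ennreal (indicator ?C y * (\<psi> (x + y) - \<psi> x)\<^sup>2) \<partial>lborel \<partial>lborel)"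
    by (rule lborel_pair.Fubini'[symmetric]) measurable
  also have "\<dots> \<le> (\<integral>\<^sup>+y. ennreal ((real N * h)\<^sup>2 * D) * indicator ?C y \<partial>lborel)"
  proof (rule nn_integral_mono)
    fix y :: "real^'n"
    show "(\<integral>\<^sup>+x. ennreal (indicator ?C y * (\<psi> (x + y) - \<psi> x)\<^sup>2) \<partial>lborel)
        \<le> ennreal ((real N * h)\<^sup>2 * D) * indicator ?C y"
    proof (cases "y \<in> ?C")
      case True
      have "norm y \<le> (\<Sum>i\<in>UNIV. \<bar>y $ i\<bar>)" by (rule norm_le_l1_cart)
      also have "\<dots> \<le> (\<Sum>i\<in>(UNIV::'n set). h)"
        using True by (intro sum_mono) (auto simp: mem_box_cart abs_le_iff minus_le_iff)
      also have "\<dots> = real N * h" by (simp add: N_def)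
      finally have "(norm y)\<^sup>2 \<le> (real N * h)\<^sup>2" by (intro power_mono) auto
      then have "(norm y)\<^sup>2 * D \<le> (real N * h)\<^sup>2 * D" using D0 by (rule mult_right_mono)
      then show ?thesis
        using translation_L2_bound[OF p, of y, folded D_def] True
        by (auto intro: order_trans ennreal_leI)
    qed simp
  qed
  also have "\<dots> = ennreal ((real N * h)\<^sup>2 * D) * emeasure lborel ?C"
    by (simp add: nn_integral_cmult)
  also have "emeasure lborel ?C = ennreal ((2 * h) ^ N)"
  proof -
    have B: "((\<chi> i. h) - (\<chi> i. - h) :: real^'n) \<bullet> e = 2 * h" "(\<chi> i. - h :: real^'n) \<bullet> e \<le> (\<chi> i. h) \<bullet> e"
      if "e \<in> Basis" for e
      using that h by (auto simp: Basis_vec_def inner_axis)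
    show ?thesis unfolding N_def using emeasure_lborel_cbox[OF B(2)] B(1) by simp
  qed
  also have "ennreal ((real N * h)\<^sup>2 * D) * ennreal ((2 * h) ^ N) = ennreal ((2 * h) ^ N * (real N * h)\<^sup>2 * D)"
    using h D0 by (simp add: ennreal_mult[symmetric] mult_ac)
  finally have main: "(\<Sum>k\<in>I. 2 * ?m * s k - 2 * (a k)\<^sup>2) \<le> (2 * h) ^ N * (real N * h)\<^sup>2 * D"
    using h D0 by (subst (asm) ennreal_le_iff) auto
  have "(\<Sum>k\<in>I. s k) = (LINT x|lborel. (\<Sum>k\<in>I. ?ind k x * (\<psi> x)\<^sup>2))"
    unfolding s_def
    by (rule Bochner_Integration.integral_sum[symmetric])
       (use integrable_mult_indicator[OF _ i2] in \<open>auto simp: grid_cube_borel[OF h]\<close>)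
  also have "\<dots> = (LINT x|lborel. (\<psi> x)\<^sup>2)"
  proof (rule Bochner_Integration.integral_cong)
    fix x :: "real^'n"
    show "(\<Sum>k\<in>I. ?ind k x * (\<psi> x)\<^sup>2) = (\<psi> x)\<^sup>2"
    proof (cases "x \<in> \<Omega>")
      case True
      let ?k = "\<lambda>i. \<lfloor>x $ i / h\<rfloor>"
      have "(\<Sum>k\<in>I. ?ind k x * (\<psi> x)\<^sup>2) = (\<Sum>k\<in>I. if k = ?k then (\<psi> x)\<^sup>2 else 0)"
        by (intro sum.cong) (simp_all add: mem_grid_cube_iff indicator_def)
      then show ?thesis using True finI by (simp add: I_def)
    qed (simp add: test_function_outside[OF p])
  qed simp
  finally have s: "(\<Sum>k\<in>I. s k) = (LINT x|lborel. (\<psi> x)\<^sup>2)" .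
  have "(\<Sum>k\<in>I. 2 * ?m * s k - 2 * (a k)\<^sup>2) = 2 * (?m * (LINT x|lborel. (\<psi> x)\<^sup>2)) - 2 * (\<Sum>k\<in>I. (a k)\<^sup>2)"
    by (simp add: sum_subtractf sum_distrib_left[symmetric] s mult.assoc)
  \<comment> \<open>\<open>main\<close> bounds twice the difference in question; the factor 2 may be
    dropped because the gradient term is nonnegative.\<close>
  moreover have "0 \<le> (2 * h) ^ N * (real N * h)\<^sup>2 * D" using h D0 by simp
  ultimately show ?thesis using main by (simp add: a_def[symmetric] D_def[symmetric])
qed


section \<open>The square root of the elliptic operator\<close>

lemma has_weak_pderiv_cong:
  assumes "has_weak_pderiv \<Omega> i f g" "aeq \<Omega> f f'" "f' \<in> L2 \<Omega>" and S: "\<Omega> \<in> sets lebesgue"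
  shows "has_weak_pderiv \<Omega> i f' g"
  unfolding has_weak_pderiv_def
proof (intro conjI ballI)
  show "f' \<in> L2 \<Omega>" "g \<in> L2 \<Omega>" using assms by (auto simp: has_weak_pderiv_def)
  fix \<psi> assume p: "\<psi> \<in> test_functions \<Omega>"
  have "ip \<Omega> f' (pderiv_at i \<psi>) = ip \<Omega> f (pderiv_at i \<psi>)"
    using assms p
    by (intro ip_cong) (auto simp: has_weak_pderiv_def intro: aeq_sym test_function_L2 test_function_pderiv)
  then show "ip \<Omega> f' (pderiv_at i \<psi>) = - ip \<Omega> g \<psi>" using assms(1) p by (simp add: has_weak_pderiv_def)
qed

lemma has_weak_pderiv_diff:
  assumes "has_weak_pderiv \<Omega> i f g" "has_weak_pderiv \<Omega> i f' g'" and S: "\<Omega> \<in> sets lebesgue"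
  shows "has_weak_pderiv \<Omega> i (\<lambda>x. f x - f' x) (\<lambda>x. g x - g' x)"
proof -
  have "\<psi> \<in> L2 \<Omega>" "pderiv_at i \<psi> \<in> L2 \<Omega>" if "\<psi> \<in> test_functions \<Omega>" for \<psi>
    using that S by (auto intro: test_function_L2 test_function_pderiv)
  then show ?thesis using assms(1,2) by (auto simp: has_weak_pderiv_def ip_diff_left L2_diff)
qed

lemma has_weak_pderiv_wpd: "has_weak_pderiv \<Omega> i f g \<Longrightarrow> has_weak_pderiv \<Omega> i f (wpd \<Omega> i f)"
  unfolding wpd_def by (rule someI[where P = "has_weak_pderiv \<Omega> i f"])

lemma nrm_le_H1_norm: "nrm \<Omega> f \<le> H1_norm \<Omega> f"
  unfolding H1_norm_def by (rule real_le_rsqrt) (simp add: sum_nonneg)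

lemma nrm_wpd_le_H1_norm: "nrm \<Omega> (wpd \<Omega> i f) \<le> H1_norm \<Omega> f"
  unfolding H1_norm_def
proof (rule real_le_rsqrt)
  have "(nrm \<Omega> (wpd \<Omega> i f))\<^sup>2 \<le> (\<Sum>i\<in>UNIV. (nrm \<Omega> (wpd \<Omega> i f))\<^sup>2)"
    by (rule member_le_sum) auto
  then show "(nrm \<Omega> (wpd \<Omega> i f))\<^sup>2 \<le> (nrm \<Omega> f)\<^sup>2 + (\<Sum>i\<in>UNIV. (nrm \<Omega> (wpd \<Omega> i f))\<^sup>2)"
    by (simp add: add_increasing)
qed

text \<open>Takes the place of weak compactness. For one fixed precision the compactness estimate
  involves finitely many functionals, so repeated extraction suffices and no diagonal sequence is
  formed.\<close>

lemma finite_family_convergent_subseq: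
  fixes s :: "'k \<Rightarrow> nat \<Rightarrow> real"
  assumes "finite I" "\<And>k. k \<in> I \<Longrightarrow> bounded (range (s k))"
  shows "\<exists>r::nat\<Rightarrow>nat. strict_mono r \<and> (\<forall>k\<in>I. convergent (s k \<circ> r))"
  using assms
proof (induction I rule: finite_induct)
  case empty
  show ?case by (intro exI[of _ id]) (auto simp: strict_mono_def)
next
  case (insert k I)
  have "\<exists>r::nat\<Rightarrow>nat. strict_mono r \<and> (\<forall>k\<in>I. convergent (s k \<circ> r))"
    by (rule insert.IH) (simp add: insert.prems)
  then obtain r :: "nat \<Rightarrow> nat" where r: "strict_mono r" "\<forall>k\<in>I. convergent (s k \<circ> r)" by blast
  have "bounded (range (s k \<circ> r))"
    by (rule bounded_subset[of "range (s k)"]) (use insert in auto)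
  from bounded_imp_convergent_subsequence[OF this]
  obtain l q where q: "strict_mono (q :: nat \<Rightarrow> nat)" "((s k \<circ> r) \<circ> q) \<longlonglongrightarrow> l" by blast
  have "convergent (s k' \<circ> (r \<circ> q))" if "k' \<in> insert k I" for k'
    using that q r convergent_subseq_convergent[of "s k' \<circ> r" q] by (auto simp: convergent_def o_assoc)
  then show ?case using strict_mono_o[OF r(1) q(1)] by blast
qed

text \<open>\<open>B\<close> is any operator with the abstract properties of the square root. Its
  link with gradients is derived inside the locale, on test functions first.\<close>

locale elliptic_sqrt =
  fixes \<Omega> :: "(real^'n::finite) set" and M :: "real^'n \<Rightarrow> real^'n^'n" and a0 :: "real^'n \<Rightarrow> real"
    and B :: "(real^'n \<Rightarrow> real) \<Rightarrow> (real^'n \<Rightarrow> real)"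
  assumes open_\<Omega>: "open \<Omega>" and bounded_\<Omega>: "bounded \<Omega>"
    and coeff: "admissible_coefficients \<Omega> M a0"
    and sqrt_op: "is_sqrt_operator \<Omega> (H10 \<Omega>) B (elliptic_dom \<Omega>) (elliptic_op \<Omega> M a0)"
begin

section \<open>Self-adjointness and closedness of the square root\<close>

lemma lebesgue_\<Omega>: "\<Omega> \<in> sets lebesgue"
  using open_\<Omega> by (simp add: borel_open)

lemmas test_L2 = test_function_L2[OF _ lebesgue_\<Omega>]

lemma self_adjoint_B: "self_adjoint \<Omega> (H10 \<Omega>) B"
  using sqrt_op by (simp add: is_sqrt_operator_def)

lemma linear_B: "linear_operator \<Omega> (H10 \<Omega>) B"
  using self_adjoint_B by (simp add: self_adjoint_def)

lemma H10_L2: "f \<in> H10 \<Omega> \<Longrightarrow> f \<in> L2 \<Omega>" and B_L2: "f \<in> H10 \<Omega> \<Longrightarrow> B f \<in> L2 \<Omega>"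
  using linear_B by (auto simp: linear_operator_def)

lemma H10_lincomb: "f \<in> H10 \<Omega> \<Longrightarrow> g \<in> H10 \<Omega> \<Longrightarrow> (\<lambda>x. c * f x + g x) \<in> H10 \<Omega>"
  and B_lincomb: "f \<in> H10 \<Omega> \<Longrightarrow> g \<in> H10 \<Omega> \<Longrightarrow>
    aeq \<Omega> (B (\<lambda>x. c * f x + g x)) (\<lambda>x. c * B f x + B g x)"
  using linear_B by (auto simp: linear_operator_def)

lemma ip_B_lincomb:
  assumes "f \<in> H10 \<Omega>" "g \<in> H10 \<Omega>"
  shows "ip \<Omega> (B (\<lambda>x. c * f x + g x)) (B (\<lambda>x. c * f x + g x))
    = c\<^sup>2 * ip \<Omega> (B f) (B f) + 2 * c * ip \<Omega> (B f) (B g) + ip \<Omega> (B g) (B g)"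
proof -
  have "ip \<Omega> (B (\<lambda>x. c * f x + g x)) (B (\<lambda>x. c * f x + g x))
      = ip \<Omega> (\<lambda>x. c * B f x + B g x) (\<lambda>x. c * B f x + B g x)"
    using assms by (intro ip_cong B_lincomb) (auto intro!: B_L2 H10_lincomb L2_intros)
  then show ?thesis using assms by (simp add: ip_square_add L2_scale B_L2 power2_eq_square)
qed

lemma ip_lincomb:
  assumes "f \<in> H10 \<Omega>" "g \<in> H10 \<Omega>"
  shows "ip \<Omega> (\<lambda>x. c * f x + g x) (\<lambda>x. c * f x + g x)
    = c\<^sup>2 * ip \<Omega> f f + 2 * c * ip \<Omega> f g + ip \<Omega> g g"
  using assms by (simp add: ip_square_add L2_scale H10_L2 power2_eq_square)

text \<open>This is the forward half of the adjoint equivalence, taken at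
  \<open>h = B f\<close>.\<close>

lemma B_symmetric: "f \<in> H10 \<Omega> \<Longrightarrow> g \<in> H10 \<Omega> \<Longrightarrow> ip \<Omega> f (B g) = ip \<Omega> (B f) g"
  using self_adjoint_B H10_L2 B_L2 unfolding self_adjoint_def by (metis aeq_refl)

text \<open>The source of all membership in the form domain that is not given: for limits of
  sequences, for \<open>B f\<close> of a minimizer \<open>f\<close>, and for functions that agree
  almost everywhere with an element of \<open>H10\<close>.\<close>

lemma B_adjointI:
  assumes "f \<in> L2 \<Omega>" "h \<in> L2 \<Omega>" "\<And>g. g \<in> H10 \<Omega> \<Longrightarrow> ip \<Omega> f (B g) = ip \<Omega> h g"
  shows "f \<in> H10 \<Omega> \<and> aeq \<Omega> (B f) h"
  using self_adjoint_B assms unfolding self_adjoint_def by blast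

lemma B_closed:
  assumes s: "\<And>n. s n \<in> H10 \<Omega>" and f: "f \<in> L2 \<Omega>" and h: "h \<in> L2 \<Omega>"
    and sf: "(\<lambda>n. nrm \<Omega> (\<lambda>x. s n x - f x)) \<longlonglongrightarrow> 0"
    and sh: "(\<lambda>n. nrm \<Omega> (\<lambda>x. B (s n) x - h x)) \<longlonglongrightarrow> 0"
  shows "f \<in> H10 \<Omega> \<and> aeq \<Omega> (B f) h"
proof (rule B_adjointI[OF f h])
  fix g assume g: "g \<in> H10 \<Omega>"
  have c: "(\<lambda>n. nrm \<Omega> (\<lambda>x. v x - v x)) \<longlonglongrightarrow> 0" for v by (simp add: nrm_def)
  have "(\<lambda>n. ip \<Omega> (s n) (B g)) \<longlonglongrightarrow> ip \<Omega> f (B g)"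
    using sf c f g s by (intro ip_tendsto) (auto intro: H10_L2 B_L2 always_eventually)
  moreover have "(\<lambda>n. ip \<Omega> (B (s n)) g) \<longlonglongrightarrow> ip \<Omega> h g"
    using sh c h g s by (intro ip_tendsto) (auto intro: H10_L2 B_L2 always_eventually)
  ultimately show "ip \<Omega> f (B g) = ip \<Omega> h g"
    using LIMSEQ_unique by (simp add: B_symmetric[OF s g])
qed

text \<open>A self-adjoint operator is densely defined by definition, so the density of test functions is
  inherited from that of \<open>H10\<close>, and with it the uniqueness of weak derivatives.\<close>

lemma test_functions_dense:
  assumes "f \<in> L2 \<Omega>" "e > 0"
  shows "\<exists>\<psi>\<in>test_functions \<Omega>. nrm \<Omega> (\<lambda>x. f x - \<psi> x) < e"
proof -
  obtain g where g: "g \<in> H10 \<Omega>" "nrm \<Omega> (\<lambda>x. f x - g x) < e/2"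
    using self_adjoint_B assms unfolding self_adjoint_def by (meson half_gt_zero)
  have "\<forall>e>0. \<exists>\<psi>\<in>test_functions \<Omega>. H1_norm \<Omega> (\<lambda>x. g x - \<psi> x) < e" using g(1) by (simp add: H10_def)
  from this[rule_format, of "e/2"]
  obtain \<psi> where p: "\<psi> \<in> test_functions \<Omega>" "H1_norm \<Omega> (\<lambda>x. g x - \<psi> x) < e/2"
    using assms(2) by auto
  have "nrm \<Omega> (\<lambda>x. f x - \<psi> x) \<le> nrm \<Omega> (\<lambda>x. f x - g x) + nrm \<Omega> (\<lambda>x. g x - \<psi> x)"
    using assms g p by (intro nrm_triangle_diff) (auto intro: H10_L2 test_L2)
  then show ?thesis using p g nrm_le_H1_norm[of \<Omega> "\<lambda>x. g x - \<psi> x"] by (intro bexI[of _ \<psi>]) auto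
qed

lemma orthogonal_test_functions_imp_zero:
  assumes g: "g \<in> L2 \<Omega>" and o: "\<And>\<psi>. \<psi> \<in> test_functions \<Omega> \<Longrightarrow> ip \<Omega> g \<psi> = 0"
  shows "nrm \<Omega> g = 0"
proof (rule ccontr)
  assume "nrm \<Omega> g \<noteq> 0"
  then have pos: "nrm \<Omega> g > 0" by (simp add: order_less_le)
  obtain \<psi> where p: "\<psi> \<in> test_functions \<Omega>" "nrm \<Omega> (\<lambda>x. g x - \<psi> x) < nrm \<Omega> g"
    using test_functions_dense[OF g pos] by blast
  have "(nrm \<Omega> g)\<^sup>2 = ip \<Omega> g (\<lambda>x. g x - \<psi> x)"
    using g p o by (simp add: nrm_square ip_diff_right test_L2)
  also have "\<dots> \<le> nrm \<Omega> g * nrm \<Omega> (\<lambda>x. g x - \<psi> x)"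
    using Cauchy_Schwarz_ip[of g \<Omega> "\<lambda>x. g x - \<psi> x"] g p by (simp add: L2_diff test_L2)
  also have "\<dots> < nrm \<Omega> g * nrm \<Omega> g" using p pos by (intro mult_strict_left_mono) auto
  finally show False by (simp add: power2_eq_square)
qed

lemma weak_pderiv_unique:
  assumes "has_weak_pderiv \<Omega> i f g" "has_weak_pderiv \<Omega> i f h"
  shows "aeq \<Omega> g h"
proof -
  have L: "g \<in> L2 \<Omega>" "h \<in> L2 \<Omega>" using assms by (auto simp: has_weak_pderiv_def)
  have eq: "ip \<Omega> g \<psi> = ip \<Omega> h \<psi>" if "\<psi> \<in> test_functions \<Omega>" for \<psi>
  proof -
    have "- ip \<Omega> g \<psi> = - ip \<Omega> h \<psi>" using assms that unfolding has_weak_pderiv_def by metis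
    then show ?thesis by simp
  qed
  have "nrm \<Omega> (\<lambda>x. g x - h x) = 0"
    by (rule orthogonal_test_functions_imp_zero) (simp_all add: L L2_diff ip_diff_left test_L2 eq)
  then show ?thesis using L by (simp add: aeq_iff_nrm_diff)
qed

lemmas test_weak_pderiv = has_weak_pderiv_test_function[OF _ lebesgue_\<Omega>]

lemma wpd_test_function: "\<psi> \<in> test_functions \<Omega> \<Longrightarrow> aeq \<Omega> (pderiv_at i \<psi>) (wpd \<Omega> i \<psi>)"
  using weak_pderiv_unique test_weak_pderiv has_weak_pderiv_wpd by blast

lemma wpd_test_function_L2: "\<psi> \<in> test_functions \<Omega> \<Longrightarrow> wpd \<Omega> i \<psi> \<in> L2 \<Omega>"
  using has_weak_pderiv_wpd[OF test_weak_pderiv] by (simp add: has_weak_pderiv_def)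

lemma test_function_H1: "\<psi> \<in> test_functions \<Omega> \<Longrightarrow> \<psi> \<in> H1 \<Omega>"
  using test_weak_pderiv unfolding H1_def by (blast intro: test_L2)

lemma test_function_H10:
  assumes "\<psi> \<in> test_functions \<Omega>"
  shows "\<psi> \<in> H10 \<Omega>"
proof -
  \<comment> \<open>Even for the zero function \<open>wpd\<close> is an arbitrary choice, so its
    norm vanishes only through uniqueness of weak derivatives.\<close>
  have z: "has_weak_pderiv \<Omega> i (\<lambda>x. 0) (\<lambda>x. 0)" for i by (simp add: has_weak_pderiv_def)
  have "nrm \<Omega> (wpd \<Omega> i (\<lambda>x. 0)) = 0" for i
    using weak_pderiv_unique[OF has_weak_pderiv_wpd[OF z] z] has_weak_pderiv_wpd[OF z]
    by (subst nrm_eq_0_iff) (auto simp: has_weak_pderiv_def)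
  then have "H1_norm \<Omega> (\<lambda>x. \<psi> x - \<psi> x) = 0" by (simp add: H1_norm_def nrm_def)
  then have "\<forall>e>0. \<exists>\<phi>\<in>test_functions \<Omega>. H1_norm \<Omega> (\<lambda>x. \<psi> x - \<phi> x) < e" using assms by metis
  then show ?thesis using test_function_H1[OF assms] by (simp add: H10_def)
qed

text \<open>Gives access to the identity \<open>B (B \<psi>) = A \<psi>\<close>, which is available
  only on the domain of \<open>A\<close>. The chosen first derivatives agree with the classical ones
  almost everywhere and inherit their weak derivatives.\<close>

lemma test_function_elliptic_dom:
  assumes p: "\<psi> \<in> test_functions \<Omega>"
  shows "\<psi> \<in> elliptic_dom \<Omega>"
proof -
  have "has_weak_pderiv \<Omega> k (wpd \<Omega> i \<psi>) (pderiv_at k (pderiv_at i \<psi>))" for i k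
    by (rule has_weak_pderiv_cong[OF test_weak_pderiv[OF test_function_pderiv[OF p]]
          wpd_test_function[OF p] wpd_test_function_L2[OF p] lebesgue_\<Omega>])
  then have "wpd \<Omega> i \<psi> \<in> H1 \<Omega>" for i
    using wpd_test_function_L2[OF p] by (auto simp: H1_def)
  then show ?thesis
    using test_function_H10[OF p] test_function_H1[OF p] by (simp add: elliptic_dom_def H2_def)
qed

section \<open>The quadratic form on test functions and density in the graph norm\<close>

lemma coeff_smooth: "smooth_closure \<Omega> (\<lambda>x. M x $ i $ k)" "smooth_closure \<Omega> a0"
  using coeff by (auto simp: admissible_coefficients_def)

lemma smooth_closure_continuous: "smooth_closure \<Omega> f \<Longrightarrow> continuous_on (closure \<Omega>) f"
  by (meson continuous_on_subset smooth_closure_def smooth_on_imp_continuous_on)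

lemma smooth_closure_measurable: "smooth_closure \<Omega> f \<Longrightarrow> f \<in> borel_measurable (lebesgue_on \<Omega>)"
  by (meson closure_subset continuous_imp_measurable_on_sets_lebesgue continuous_on_subset
      lebesgue_\<Omega> smooth_closure_continuous)

text \<open>Component of \<open>M\<close> applied to the gradient. Classical derivatives are used so
  that it is itself a test function and has weak derivatives.\<close>

definition flux :: "'n \<Rightarrow> ('n fld) \<Rightarrow> 'n fld" where
  "flux i \<psi> x = (\<Sum>k\<in>UNIV. M x $ i $ k * pderiv_at k \<psi> x)"

lemma flux_test_function: "\<psi> \<in> test_functions \<Omega> \<Longrightarrow> flux i \<psi> \<in> test_functions \<Omega>"
  unfolding flux_def[abs_def]
  by (intro test_function_sum test_function_smooth_mult coeff_smooth test_function_pderiv)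

text \<open>Symmetry moves one \<open>B\<close> across, which leaves \<open>A \<psi>\<close> tested
  with \<psi>. Integration by parts then produces the form \<open>a(\<psi>, \<psi>)\<close> of the
  weak equation.\<close>

lemma ip_B_test_function:
  assumes p: "\<psi> \<in> test_functions \<Omega>"
  shows "ip \<Omega> (B \<psi>) (B \<psi>)
    = (LINT x|lebesgue_on \<Omega>. (\<Sum>i\<in>UNIV. flux i \<psi> x * pderiv_at i \<psi> x) + a0 x * \<psi> x * \<psi> x)"
proof -
  \<comment> \<open>The flux as \<open>elliptic_op\<close> forms it, from chosen weak derivatives.
    It equals \<open>flux i \<psi>\<close> almost everywhere, which is what makes it weakly
    differentiable.\<close>
  define F where "F i = (\<lambda>y. (M y *v wgrad \<Omega> \<psi> y) $ i)" for i
  have F: "F i = (\<lambda>y. \<Sum>k\<in>UNIV. M y $ i $ k * wpd \<Omega> k \<psi> y)" for i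
    by (auto simp: F_def matrix_vector_mult_def wgrad_def)
  have FF: "aeq \<Omega> (flux i \<psi>) (F i)" for i
  proof -
    have "AE x in lebesgue_on \<Omega>. \<forall>k\<in>UNIV. pderiv_at k \<psi> x = wpd \<Omega> k \<psi> x"
      by (rule AE_finite_allI) (use wpd_test_function[OF p] in \<open>auto simp: aeq_def\<close>)
    then show ?thesis unfolding aeq_def F flux_def by eventually_elim simp
  qed
  have fluxL: "flux i \<psi> \<in> L2 \<Omega>" for i by (rule test_L2[OF flux_test_function[OF p]])
  have FL: "F i \<in> L2 \<Omega>" for i
  proof (rule L2_cong_AE[OF fluxL FF])
    show "F i \<in> borel_measurable (lebesgue_on \<Omega>)"
      unfolding F
      by (intro borel_measurable_sum borel_measurable_times smooth_closure_measurable[OF coeff_smooth(1)]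
          L2_measurable[OF wpd_test_function_L2[OF p]])
  qed
  have FW: "has_weak_pderiv \<Omega> i (F i) (wpd \<Omega> i (F i))" for i
    by (rule has_weak_pderiv_wpd,
        rule has_weak_pderiv_cong[OF test_weak_pderiv[OF flux_test_function[OF p]] FF FL lebesgue_\<Omega>])
  then have WL: "wpd \<Omega> i (F i) \<in> L2 \<Omega>" for i by (simp add: has_weak_pderiv_def)
  have a0L: "(\<lambda>x. a0 x * \<psi> x) \<in> L2 \<Omega>" by (intro test_L2 test_function_smooth_mult coeff_smooth p)
  have PL: "pderiv_at i \<psi> \<in> L2 \<Omega>" for i by (rule test_L2[OF test_function_pderiv[OF p]])
  have D: "\<psi> \<in> H10 \<Omega>" "B \<psi> \<in> H10 \<Omega>" "aeq \<Omega> (B (B \<psi>)) (elliptic_op \<Omega> M a0 \<psi>)"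
    using sqrt_op test_function_elliptic_dom[OF p] by (auto simp: is_sqrt_operator_def)
  have op: "elliptic_op \<Omega> M a0 \<psi> = (\<lambda>x. - (\<Sum>i\<in>UNIV. wpd \<Omega> i (F i) x) + a0 x * \<psi> x)"
    by (simp add: elliptic_op_def wdiv_def F_def)
  have "ip \<Omega> (B \<psi>) (B \<psi>) = ip \<Omega> (B (B \<psi>)) \<psi>" by (rule B_symmetric[OF D(2,1)])
  also have "\<dots> = ip \<Omega> (\<lambda>x. - (\<Sum>i\<in>UNIV. wpd \<Omega> i (F i) x) + a0 x * \<psi> x) \<psi>"
    by (rule ip_cong[OF D(3)[unfolded op] aeq_refl B_L2[OF D(2)] _ test_L2[OF p] test_L2[OF p]])
       (intro L2_add L2_uminus L2_sum WL a0L)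
  also have "\<dots> = - (\<Sum>i\<in>UNIV. ip \<Omega> (wpd \<Omega> i (F i)) \<psi>) + ip \<Omega> (\<lambda>x. a0 x * \<psi> x) \<psi>"
    using WL a0L test_L2[OF p] by (simp add: ip_linear L2_uminus L2_sum)
  also have "\<dots> = (\<Sum>i\<in>UNIV. ip \<Omega> (F i) (pderiv_at i \<psi>)) + ip \<Omega> (\<lambda>x. a0 x * \<psi> x) \<psi>"
    using FW p by (simp add: has_weak_pderiv_def sum_negf)
  also have "\<dots> = (\<Sum>i\<in>UNIV. ip \<Omega> (flux i \<psi>) (pderiv_at i \<psi>)) + ip \<Omega> (\<lambda>x. a0 x * \<psi> x) \<psi>"
    using ip_cong[OF FF aeq_refl fluxL FL PL PL] by simp
  also have "\<dots> = (LINT x|lebesgue_on \<Omega>. (\<Sum>i\<in>UNIV. flux i \<psi> x * pderiv_at i \<psi> x) + a0 x * \<psi> x * \<psi> x)"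
    using L2_integrable_mult[OF fluxL PL] L2_integrable_mult[OF a0L test_L2[OF p]] by (simp add: ip_def)
  finally show ?thesis .
qed

lemma test_form_integrable:
  assumes p: "\<psi> \<in> test_functions \<Omega>"
  shows "integrable (lebesgue_on \<Omega>) (\<lambda>x. (\<Sum>i\<in>UNIV. flux i \<psi> x * pderiv_at i \<psi> x) + a0 x * \<psi> x * \<psi> x)"
proof -
  have "integrable (lebesgue_on \<Omega>) (\<lambda>x. flux i \<psi> x * pderiv_at i \<psi> x)" for i
    by (intro L2_integrable_mult test_L2 flux_test_function test_function_pderiv p)
  moreover have "integrable (lebesgue_on \<Omega>) (\<lambda>x. a0 x * \<psi> x * \<psi> x)"
    by (intro L2_integrable_mult test_L2 test_function_smooth_mult coeff_smooth p)
  ultimately show ?thesis by simp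
qed

lemma test_gradient_integrable:
  assumes p: "\<psi> \<in> test_functions \<Omega>"
  shows "integrable (lebesgue_on \<Omega>) (\<lambda>x. (\<psi> x)\<^sup>2)" "integrable (lebesgue_on \<Omega>) (\<lambda>x. (pderiv_at i \<psi> x)\<^sup>2)"
  using test_L2[OF p] test_L2[OF test_function_pderiv[OF p]] by (auto simp: L2_def)

lemma ellipticity:
  "\<exists>c>0. \<forall>\<psi>\<in>test_functions \<Omega>. c * (\<Sum>i\<in>UNIV. ip \<Omega> (pderiv_at i \<psi>) (pderiv_at i \<psi>)) \<le> ip \<Omega> (B \<psi>) (B \<psi>)"
proof -
  obtain c where c: "c > 0" "\<And>x \<xi>. x \<in> \<Omega> \<Longrightarrow> c * (norm \<xi>)\<^sup>2 \<le> \<xi> \<bullet> (M x *v \<xi>)"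
    and a0: "\<And>x. x \<in> \<Omega> \<Longrightarrow> a0 x \<ge> 0"
    using coeff by (auto simp: admissible_coefficients_def)
  have "c * (\<Sum>i\<in>UNIV. ip \<Omega> (pderiv_at i \<psi>) (pderiv_at i \<psi>)) \<le> ip \<Omega> (B \<psi>) (B \<psi>)"
    if p: "\<psi> \<in> test_functions \<Omega>" for \<psi>
  proof -
    have "c * (\<Sum>i\<in>UNIV. ip \<Omega> (pderiv_at i \<psi>) (pderiv_at i \<psi>))
        = (LINT x|lebesgue_on \<Omega>. c * (\<Sum>i\<in>UNIV. (pderiv_at i \<psi> x)\<^sup>2))"
      using test_gradient_integrable[OF p] by (simp add: ip_def power2_eq_square)
    also have "\<dots> \<le> ip \<Omega> (B \<psi>) (B \<psi>)"
      unfolding ip_B_test_function[OF p]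
    proof (rule integral_mono)
      fix x assume "x \<in> space (lebesgue_on \<Omega>)"
      then have x: "x \<in> \<Omega>" by simp
      let ?g = "\<chi> i. pderiv_at i \<psi> x"
      have "c * (norm ?g)\<^sup>2 \<le> ?g \<bullet> (M x *v ?g)" by (rule c(2)[OF x])
      moreover have "(norm ?g)\<^sup>2 = (\<Sum>i\<in>UNIV. (pderiv_at i \<psi> x)\<^sup>2)"
        by (simp add: power2_norm_eq_inner) (simp add: inner_vec_def power2_eq_square)
      moreover have "?g \<bullet> (M x *v ?g) = (\<Sum>i\<in>UNIV. flux i \<psi> x * pderiv_at i \<psi> x)"
        by (simp add: inner_vec_def matrix_vector_mult_def flux_def mult.commute)
      moreover have "0 \<le> a0 x * \<psi> x * \<psi> x" using a0[OF x] by (simp add: mult.assoc)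
      ultimately show "c * (\<Sum>i\<in>UNIV. (pderiv_at i \<psi> x)\<^sup>2)
          \<le> (\<Sum>i\<in>UNIV. flux i \<psi> x * pderiv_at i \<psi> x) + a0 x * \<psi> x * \<psi> x" by simp
    qed (use test_gradient_integrable[OF p] test_form_integrable[OF p] in auto)
    finally show ?thesis .
  qed
  then show ?thesis using c(1) by blast
qed

lemma smooth_closure_bounded:
  assumes "smooth_closure \<Omega> f"
  shows "\<exists>K\<ge>0. \<forall>x\<in>\<Omega>. \<bar>f x\<bar> \<le> K"
proof -
  have "compact (f ` closure \<Omega>)"
    using bounded_\<Omega> smooth_closure_continuous[OF assms]
    by (intro compact_continuous_image) (auto simp: compact_closure)
  then obtain K where "\<forall>x\<in>closure \<Omega>. \<bar>f x\<bar> \<le> K"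
    by (auto dest!: compact_imp_bounded simp: bounded_iff)
  then show ?thesis
    using closure_subset[of \<Omega>] by (intro exI[of _ "max 0 K"]) (auto simp: le_max_iff_disj)
qed

text \<open>On test functions the norm of \<open>B \<psi>\<close> is controlled by the
  \<open>H1\<close> norm, so that approximation in \<open>H1\<close> becomes approximation in the
  graph norm. The coefficients are bounded as continuous functions on a compact closure.\<close>

lemma form_upper_bound:
  "\<exists>C\<ge>0. \<forall>\<psi>\<in>test_functions \<Omega>. ip \<Omega> (B \<psi>) (B \<psi>)
    \<le> C * (ip \<Omega> \<psi> \<psi> + (\<Sum>i\<in>UNIV. ip \<Omega> (pderiv_at i \<psi>) (pderiv_at i \<psi>)))"
proof -
  obtain K0 where K0: "K0 \<ge> 0" "\<And>x. x \<in> \<Omega> \<Longrightarrow> \<bar>a0 x\<bar> \<le> K0"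
    using smooth_closure_bounded[OF coeff_smooth(2)] by blast
  have "\<forall>i k. \<exists>K\<ge>0. \<forall>x\<in>\<Omega>. \<bar>M x $ i $ k\<bar> \<le> K"
    using smooth_closure_bounded[OF coeff_smooth(1)] by blast
  then obtain Kf where Kf: "\<And>i k. Kf i k \<ge> 0" "\<And>i k x. x \<in> \<Omega> \<Longrightarrow> \<bar>M x $ i $ k\<bar> \<le> Kf i k"
    by metis
  define C where "C = (\<Sum>i\<in>UNIV. \<Sum>k\<in>UNIV. Kf i k) + K0"
  have S0: "0 \<le> (\<Sum>i\<in>UNIV. \<Sum>k\<in>UNIV. Kf i k)" by (intro sum_nonneg Kf)
  have C0: "C \<ge> 0" using S0 K0 by (simp add: C_def)
  have "ip \<Omega> (B \<psi>) (B \<psi>) \<le> C * (ip \<Omega> \<psi> \<psi> + (\<Sum>i\<in>UNIV. ip \<Omega> (pderiv_at i \<psi>) (pderiv_at i \<psi>)))"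
    if p: "\<psi> \<in> test_functions \<Omega>" for \<psi>
  proof -
    have "ip \<Omega> (B \<psi>) (B \<psi>) \<le> (LINT x|lebesgue_on \<Omega>. C * ((\<psi> x)\<^sup>2 + (\<Sum>i\<in>UNIV. (pderiv_at i \<psi> x)\<^sup>2)))"
      unfolding ip_B_test_function[OF p]
    proof (rule integral_mono)
      fix x assume "x \<in> space (lebesgue_on \<Omega>)"
      then have x: "x \<in> \<Omega>" by simp
      let ?g = "\<lambda>i. pderiv_at i \<psi> x"
      let ?G = "\<Sum>i\<in>UNIV. (?g i)\<^sup>2"
      have G0: "0 \<le> ?G" by (intro sum_nonneg) auto
      have "M x $ i $ k * ?g k * ?g i \<le> Kf i k * ?G" for i k
      proof -
        have "(?g k)\<^sup>2 \<le> ?G" "(?g i)\<^sup>2 \<le> ?G" by (rule member_le_sum; simp)+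
        moreover have "2 * \<bar>?g k\<bar> * \<bar>?g i\<bar> \<le> (?g k)\<^sup>2 + (?g i)\<^sup>2"
          using sum_squares_bound[of "\<bar>?g k\<bar>" "\<bar>?g i\<bar>"] by simp
        ultimately have g: "\<bar>?g k\<bar> * \<bar>?g i\<bar> \<le> ?G" by simp
        have "M x $ i $ k * ?g k * ?g i \<le> \<bar>M x $ i $ k\<bar> * (\<bar>?g k\<bar> * \<bar>?g i\<bar>)"
          by (metis abs_ge_self abs_mult mult.assoc)
        also have "\<dots> \<le> Kf i k * ?G"
          using Kf(2)[OF x, of i k] g Kf(1) by (intro mult_mono) auto
        finally show ?thesis .
      qed
      then have "(\<Sum>i\<in>UNIV. \<Sum>k\<in>UNIV. M x $ i $ k * ?g k * ?g i) \<le> (\<Sum>i\<in>UNIV. \<Sum>k\<in>UNIV. Kf i k * ?G)"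
        by (intro sum_mono)
      then have fl: "(\<Sum>i\<in>UNIV. flux i \<psi> x * ?g i) \<le> (\<Sum>i\<in>UNIV. \<Sum>k\<in>UNIV. Kf i k) * ?G"
        by (simp add: flux_def sum_distrib_right)
      have "a0 x * \<psi> x * \<psi> x \<le> K0 * (\<psi> x)\<^sup>2"
        using K0(2)[OF x] by (simp add: power2_eq_square mult.assoc mult_right_mono)
      then have "(\<Sum>i\<in>UNIV. flux i \<psi> x * ?g i) + a0 x * \<psi> x * \<psi> x
          \<le> (\<Sum>i\<in>UNIV. \<Sum>k\<in>UNIV. Kf i k) * ?G + K0 * (\<psi> x)\<^sup>2" using fl by simp
      also have "\<dots> \<le> C * ?G + C * (\<psi> x)\<^sup>2"
        using S0 K0 G0 by (intro add_mono mult_right_mono) (auto simp: C_def)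
      finally show "(\<Sum>i\<in>UNIV. flux i \<psi> x * ?g i) + a0 x * \<psi> x * \<psi> x \<le> C * ((\<psi> x)\<^sup>2 + ?G)"
        by (simp add: algebra_simps)
    qed (use test_gradient_integrable[OF p] test_form_integrable[OF p] in auto)
    also have "\<dots> = C * (ip \<Omega> \<psi> \<psi> + (\<Sum>i\<in>UNIV. ip \<Omega> (pderiv_at i \<psi>) (pderiv_at i \<psi>)))"
      using test_gradient_integrable[OF p] by (simp add: ip_def power2_eq_square)
    finally show ?thesis .
  qed
  then show ?thesis using C0 by blast
qed

text \<open>Membership in \<open>H10\<close> supplies test functions converging in
  \<open>H1\<close>. The upper bound of the form makes their images under \<open>B\<close> Cauchy,
  completeness gives a limit, and closedness identifies it with \<open>B f\<close>.\<close>

lemma graph_approximation: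
  assumes f: "f \<in> H10 \<Omega>"
  shows "\<exists>\<psi>. (\<forall>n::nat. \<psi> n \<in> test_functions \<Omega>) \<and> (\<lambda>n. nrm \<Omega> (\<lambda>x. \<psi> n x - f x)) \<longlonglongrightarrow> 0
    \<and> (\<lambda>n. nrm \<Omega> (\<lambda>x. B (\<psi> n) x - B f x)) \<longlonglongrightarrow> 0"
proof -
  have "\<forall>n::nat. \<exists>\<psi>\<in>test_functions \<Omega>. H1_norm \<Omega> (\<lambda>x. f x - \<psi> x) < 1 / real (Suc n)"
    using f by (auto simp: H10_def)
  then obtain \<psi> where p: "\<And>n. \<psi> n \<in> test_functions \<Omega>"
    and H: "\<And>n::nat. H1_norm \<Omega> (\<lambda>x. f x - \<psi> n x) < 1 / real (Suc n)" by metis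
  let ?e = "\<lambda>m n. 1 / real (Suc m) + 1 / real (Suc n)"
  have fL: "f \<in> L2 \<Omega>" by (rule H10_L2[OF f])
  have lim0: "(\<lambda>n. nrm \<Omega> (\<lambda>x. \<psi> n x - f x)) \<longlonglongrightarrow> 0"
  proof (rule Lim_null_comparison[OF _ LIMSEQ_Suc[OF lim_1_over_n]])
    have "nrm \<Omega> (\<lambda>x. \<psi> n x - f x) \<le> 1 / real (Suc n)" for n
      using H[of n] nrm_le_H1_norm[of \<Omega> "\<lambda>x. f x - \<psi> n x"]
      by (simp add: nrm_minus_commute[of \<Omega> "\<psi> n" f])
    then show "\<forall>\<^sub>F n in sequentially. norm (nrm \<Omega> (\<lambda>x. \<psi> n x - f x)) \<le> 1 / real (Suc n)"
      by simp
  qed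
  have d0: "nrm \<Omega> (\<lambda>x. \<psi> m x - \<psi> n x) \<le> ?e m n" for m n
  proof -
    have "nrm \<Omega> (\<lambda>x. \<psi> m x - \<psi> n x) \<le> nrm \<Omega> (\<lambda>x. \<psi> m x - f x) + nrm \<Omega> (\<lambda>x. f x - \<psi> n x)"
      by (intro nrm_triangle_diff test_L2 p fL)
    then show ?thesis
      using H[of m] H[of n] nrm_le_H1_norm[of \<Omega> "\<lambda>x. f x - \<psi> m x"] nrm_le_H1_norm[of \<Omega> "\<lambda>x. f x - \<psi> n x"]
      by (simp add: nrm_minus_commute[of \<Omega> "\<psi> m" f])
  qed
  \<comment> \<open>\<open>wpd\<close> is not literally linear. The derivative of \<psi> m - \<psi>
    n is compared with the difference of the derivatives of f - \<psi> n and f - \<psi> m, whose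
    norms are known to be small.\<close>
  have d1: "nrm \<Omega> (pderiv_at i (\<lambda>x. \<psi> m x - \<psi> n x)) \<le> ?e m n" for m n i
  proof -
    let ?w = "\<lambda>n. wpd \<Omega> i (\<lambda>x. f x - \<psi> n x)"
    obtain g where g: "has_weak_pderiv \<Omega> i f g" using f by (auto simp: H10_def H1_def)
    have w: "has_weak_pderiv \<Omega> i (\<lambda>x. f x - \<psi> n x) (?w n)" for n
      by (rule has_weak_pderiv_wpd, rule has_weak_pderiv_diff[OF g test_weak_pderiv[OF p] lebesgue_\<Omega>])
    then have wL: "?w n \<in> L2 \<Omega>" for n by (simp add: has_weak_pderiv_def)
    have "has_weak_pderiv \<Omega> i (\<lambda>x. \<psi> m x - \<psi> n x) (\<lambda>x. ?w n x - ?w m x)"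
      using has_weak_pderiv_diff[OF w[of n] w[of m] lebesgue_\<Omega>] by simp
    then have "aeq \<Omega> (pderiv_at i (\<lambda>x. \<psi> m x - \<psi> n x)) (\<lambda>x. ?w n x - ?w m x)"
      by (rule weak_pderiv_unique[OF test_weak_pderiv[OF test_function_diff[OF p p]]])
    then have "nrm \<Omega> (pderiv_at i (\<lambda>x. \<psi> m x - \<psi> n x)) = nrm \<Omega> (\<lambda>x. ?w n x - ?w m x)"
      by (rule nrm_cong) (intro test_L2 test_function_pderiv test_function_diff p L2_diff wL)+
    also have "\<dots> \<le> nrm \<Omega> (?w n) + nrm \<Omega> (?w m)"
      using nrm_triangle[of "?w n" \<Omega> "\<lambda>x. - ?w m x"] wL by (simp add: L2_uminus nrm_def)
    also have "\<dots> \<le> ?e m n"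
      using H[of m] H[of n] nrm_wpd_le_H1_norm[of \<Omega> i "\<lambda>x. f x - \<psi> m x"]
        nrm_wpd_le_H1_norm[of \<Omega> i "\<lambda>x. f x - \<psi> n x"] by simp
    finally show ?thesis .
  qed
  obtain C where C: "C \<ge> 0" "\<And>\<psi>. \<psi> \<in> test_functions \<Omega> \<Longrightarrow> ip \<Omega> (B \<psi>) (B \<psi>)
    \<le> C * (ip \<Omega> \<psi> \<psi> + (\<Sum>i\<in>UNIV. ip \<Omega> (pderiv_at i \<psi>) (pderiv_at i \<psi>)))"
    using form_upper_bound by blast
  have dB: "(nrm \<Omega> (\<lambda>x. B (\<psi> m) x - B (\<psi> n) x))\<^sup>2 \<le> C * (1 + real CARD('n)) * (?e m n)\<^sup>2" for m n
  proof -
    let ?d = "\<lambda>x. \<psi> m x - \<psi> n x"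
    have d: "?d \<in> test_functions \<Omega>" by (rule test_function_diff[OF p p])
    have eq: "?d = (\<lambda>x. (-1) * \<psi> n x + \<psi> m x)" by auto
    have "aeq \<Omega> (B ?d) (\<lambda>x. (-1) * B (\<psi> n) x + B (\<psi> m) x)"
      unfolding eq by (intro B_lincomb test_function_H10 p)
    then have "aeq \<Omega> (\<lambda>x. B (\<psi> m) x - B (\<psi> n) x) (B ?d)" by (auto simp: aeq_def elim: eventually_mono)
    then have "(nrm \<Omega> (\<lambda>x. B (\<psi> m) x - B (\<psi> n) x))\<^sup>2 = ip \<Omega> (B ?d) (B ?d)"
      unfolding nrm_square by (rule ip_cong) (fact | intro L2_diff B_L2 test_function_H10 p d)+
    also have "\<dots> \<le> C * (ip \<Omega> ?d ?d + (\<Sum>i\<in>UNIV. ip \<Omega> (pderiv_at i ?d) (pderiv_at i ?d)))"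
      by (rule C(2)[OF d])
    also have "\<dots> \<le> C * ((?e m n)\<^sup>2 + (\<Sum>i\<in>(UNIV::'n set). (?e m n)\<^sup>2))"
      unfolding nrm_square[symmetric]
      by (intro mult_left_mono add_mono sum_mono power_mono d0 d1 C nrm_nonneg)
    finally show ?thesis by (simp add: algebra_simps)
  qed
  have elim: "((\<lambda>(m, n). C * (1 + real CARD('n)) * (?e m n)\<^sup>2) \<longlongrightarrow> 0) (sequentially \<times>\<^sub>F sequentially)"
  proof -
    note l = LIMSEQ_Suc[OF lim_1_over_n]
    have "((\<lambda>z. C * (1 + real CARD('n)) * (1 / real (Suc (fst z)) + 1 / real (Suc (snd z)))\<^sup>2)
        \<longlongrightarrow> C * (1 + real CARD('n)) * (0 + 0)\<^sup>2) (sequentially \<times>\<^sub>F sequentially)"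
      by (intro tendsto_intros filterlim_compose[OF l filterlim_fst] filterlim_compose[OF l filterlim_snd])
    then show ?thesis by (simp add: case_prod_beta')
  qed
  have "\<exists>h\<in>L2 \<Omega>. (\<lambda>n. nrm \<Omega> (\<lambda>x. B (\<psi> n) x - h x)) \<longlonglongrightarrow> 0"
  proof (rule L2_complete)
    fix e :: real assume "e > 0"
    then have "\<forall>\<^sub>F z in sequentially \<times>\<^sub>F sequentially. (case z of (m, n) \<Rightarrow> C * (1 + real CARD('n)) * (?e m n)\<^sup>2) < e\<^sup>2"
      by (intro order_tendstoD(2)[OF elim]) simp
    then obtain N where N: "\<And>m n. m \<ge> N \<Longrightarrow> n \<ge> N \<Longrightarrow> C * (1 + real CARD('n)) * (?e m n)\<^sup>2 < e\<^sup>2"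
      unfolding eventually_prod_sequentially by auto
    have "nrm \<Omega> (\<lambda>x. B (\<psi> m) x - B (\<psi> n) x) < e" if "m \<ge> N" "n \<ge> N" for m n
      by (rule power2_less_imp_less) (use N[OF that] dB[of m n] \<open>e > 0\<close> in auto)
    then show "\<exists>N. \<forall>m\<ge>N. \<forall>n\<ge>N. nrm \<Omega> (\<lambda>x. B (\<psi> m) x - B (\<psi> n) x) < e" by blast
  qed (intro B_L2 test_function_H10 p)
  then obtain h where h: "h \<in> L2 \<Omega>" "(\<lambda>n. nrm \<Omega> (\<lambda>x. B (\<psi> n) x - h x)) \<longlonglongrightarrow> 0" by blast
  \<comment> \<open>At this point the abstract limit \<open>h\<close> is recognised as
    \<open>B f\<close>, without any formula for \<open>B\<close> outside the test functions.\<close>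
  have "aeq \<Omega> (B f) h" using B_closed[OF test_function_H10[OF p] fL h(1) lim0 h(2)] by blast
  then have "aeq \<Omega> (\<lambda>x. B (\<psi> n) x - h x) (\<lambda>x. B (\<psi> n) x - B f x)" for n
    by (auto simp: aeq_def elim: eventually_mono)
  then have "nrm \<Omega> (\<lambda>x. B (\<psi> n) x - h x) = nrm \<Omega> (\<lambda>x. B (\<psi> n) x - B f x)" for n
    by (rule nrm_cong) (intro L2_diff B_L2 test_function_H10 p h f)+
  then show ?thesis using p lim0 h(2) by auto
qed

end


section \<open>The smallest eigenvalue and the Rayleigh quotient\<close>

context elliptic_sqrt
begin

lemma grid_cube_L2:
  assumes h: "h > 0"
  shows "indicat_real (grid_cube h k) \<in> L2 \<Omega>"
proof -
  note [measurable] = grid_cube_borel[OF h]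
  have "integrable lborel (\<lambda>x. (indicat_real (grid_cube h k :: (real^'n) set) x)\<^sup>2)"
    using emeasure_grid_cube[OF h, of k]
    by (simp add: power2_eq_square indicator_inter_arith[symmetric] integrable_indicator_iff)
  then have int: "integrable lebesgue (\<lambda>x. (indicat_real (grid_cube h k :: (real^'n) set) x)\<^sup>2)"
    by (subst integrable_completion) auto
  have "integrable (lebesgue_on \<Omega>) (\<lambda>x. (indicat_real (grid_cube h k) x)\<^sup>2)"
    by (subst integrable_restrict_space)
       (use integrable_mult_indicator[OF lebesgue_\<Omega> int] lebesgue_\<Omega> in auto)
  moreover have "indicat_real (grid_cube h k) \<in> borel_measurable (lebesgue_on \<Omega>)"
    by (intro measurable_restrict_space1 measurable_completion) simp
  ultimately show ?thesis by (simp add: L2_def)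
qed

text \<open>The compact embedding in the form of an inequality: up to a small multiple of the
  energy, the norm is determined by finitely many functionals, the integrals over the grid
  cubes.\<close>

lemma H10_finite_rank_estimate:
  assumes \<eta>: "\<eta> > 0"
  shows "\<exists>I g. \<exists>C\<ge>0. finite (I :: ('n \<Rightarrow> int) set) \<and> (\<forall>k\<in>I. g k \<in> L2 \<Omega>) \<and>
    (\<forall>f\<in>H10 \<Omega>. ip \<Omega> f f \<le> \<eta> * ip \<Omega> (B f) (B f) + C * (\<Sum>k\<in>I. (ip \<Omega> f (g k))\<^sup>2))"
proof -
  obtain c where c: "c > 0" "\<And>\<psi>. \<psi> \<in> test_functions \<Omega> \<Longrightarrow>
      c * (\<Sum>i\<in>UNIV. ip \<Omega> (pderiv_at i \<psi>) (pderiv_at i \<psi>)) \<le> ip \<Omega> (B \<psi>) (B \<psi>)"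
    using ellipticity by blast
  define N where "N = DIM(real^'n)"
  have N: "N > 0" by (simp add: N_def)
  \<comment> \<open>The side length that solves \<open>2^N * (N * h)^2 = \<eta> * c\<close>, so that
    the gradient term of the cube estimate becomes \<eta> times the energy after
    ellipticity.\<close>
  define h where "h = sqrt (\<eta> * c / 2 ^ N) / N"
  have h: "h > 0" using \<eta> c N by (simp add: h_def)
  have h2: "2 ^ N * (real N * h)\<^sup>2 = \<eta> * c"
    using \<eta> c N by (simp add: h_def)
  define I where "I = (\<lambda>x i. \<lfloor>x $ i / h\<rfloor>) ` \<Omega>"
  define g where "g k = indicat_real (grid_cube h k :: (real^'n) set)" for k
  have I: "finite I" unfolding I_def by (rule finite_grid_cubes[OF bounded_\<Omega> h])
  have g: "g k \<in> L2 \<Omega>" for k unfolding g_def by (rule grid_cube_L2[OF h])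
  have test: "ip \<Omega> \<psi> \<psi> \<le> \<eta> * ip \<Omega> (B \<psi>) (B \<psi>) + (1 / h ^ N) * (\<Sum>k\<in>I. (ip \<Omega> \<psi> (g k))\<^sup>2)"
    if p: "\<psi> \<in> test_functions \<Omega>" for \<psi>
  proof -
    note p' = test_function_pderiv[OF p]
    let ?D = "\<Sum>i\<in>UNIV. ip \<Omega> (pderiv_at i \<psi>) (pderiv_at i \<psi>)"
    have ips: "ip \<Omega> \<psi> \<psi> = (LINT x|lborel. (\<psi> x)\<^sup>2)"
      "ip \<Omega> (pderiv_at i \<psi>) (pderiv_at i \<psi>) = (LINT x|lborel. (pderiv_at i \<psi> x)\<^sup>2)"
      for i
      by (simp_all add: ip_test_function[OF p _ lebesgue_\<Omega>] ip_test_function[OF p' _ lebesgue_\<Omega>]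
          test_function_borel[OF p] test_function_borel[OF p'] power2_eq_square)
    have ipg: "ip \<Omega> \<psi> (g k) = (LINT x|lborel. \<psi> x * indicator (grid_cube h k) x)" for k
      unfolding g_def
      by (rule ip_test_function[OF p borel_measurable_indicator[OF grid_cube_borel[OF h]] lebesgue_\<Omega>])
    have "h ^ N * ip \<Omega> \<psi> \<psi> \<le> (2 * h) ^ N * (real N * h)\<^sup>2 * ?D + (\<Sum>k\<in>I. (ip \<Omega> \<psi> (g k))\<^sup>2)"
      using test_function_cube_estimate[OF p bounded_\<Omega> h] by (simp only: ips ipg N_def I_def)
    also have "(2 * h) ^ N * (real N * h)\<^sup>2 * ?D = h ^ N * (\<eta> * (c * ?D))"
    proof -
      have "(2 * h) ^ N * (real N * h)\<^sup>2 * ?D = h ^ N * ((2 ^ N * (real N * h)\<^sup>2) * ?D)"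
        by (simp add: power_mult_distrib)
      then show ?thesis by (simp only: h2 mult.assoc)
    qed
    also have "\<dots> \<le> h ^ N * (\<eta> * ip \<Omega> (B \<psi>) (B \<psi>))"
      using c(2)[OF p] \<eta> h by (intro mult_left_mono) auto
    finally show ?thesis using h by (simp add: field_simps)
  qed
  \<comment> \<open>Both sides are continuous in the graph norm, so the estimate passes from test
    functions to their limits.\<close>
  have "ip \<Omega> f f \<le> \<eta> * ip \<Omega> (B f) (B f) + (1 / h ^ N) * (\<Sum>k\<in>I. (ip \<Omega> f (g k))\<^sup>2)" if f: "f \<in> H10 \<Omega>" for f
  proof -
    obtain \<psi> where p: "\<And>n::nat. \<psi> n \<in> test_functions \<Omega>" and l0: "(\<lambda>n. nrm \<Omega> (\<lambda>x. \<psi> n x - f x)) \<longlonglongrightarrow> 0"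
      and l1: "(\<lambda>n. nrm \<Omega> (\<lambda>x. B (\<psi> n) x - B f x)) \<longlonglongrightarrow> 0"
      using graph_approximation[OF f] by blast
    have cst: "(\<lambda>n. nrm \<Omega> (\<lambda>x. v x - v x)) \<longlonglongrightarrow> 0" for v by (simp add: nrm_def)
    have ev: "\<forall>\<^sub>F n in sequentially. \<psi> n \<in> L2 \<Omega>" "\<forall>\<^sub>F n in sequentially. B (\<psi> n) \<in> L2 \<Omega>"
      using p by (auto intro!: always_eventually test_L2 B_L2 test_function_H10)
    have t: "(\<lambda>n. ip \<Omega> (\<psi> n) (\<psi> n)) \<longlonglongrightarrow> ip \<Omega> f f"
      "(\<lambda>n. ip \<Omega> (B (\<psi> n)) (B (\<psi> n))) \<longlonglongrightarrow> ip \<Omega> (B f) (B f)"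
      "(\<lambda>n. ip \<Omega> (\<psi> n) (g k)) \<longlonglongrightarrow> ip \<Omega> f (g k)" for k
      using ip_tendsto[OF l0 l0 ev(1,1)] ip_tendsto[OF l1 l1 ev(2,2)] ip_tendsto[OF l0 cst ev(1) _ _ g] f g
      by (auto intro: H10_L2 B_L2)
    show ?thesis
    proof (rule LIMSEQ_le[OF t(1)])
      show "(\<lambda>n. \<eta> * ip \<Omega> (B (\<psi> n)) (B (\<psi> n)) + (1 / h ^ N) * (\<Sum>k\<in>I. (ip \<Omega> (\<psi> n) (g k))\<^sup>2))
        \<longlonglongrightarrow> \<eta> * ip \<Omega> (B f) (B f) + (1 / h ^ N) * (\<Sum>k\<in>I. (ip \<Omega> f (g k))\<^sup>2)"
        by (intro tendsto_intros t)
    qed (use test[OF p] in blast)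
  qed
  then show ?thesis using I g h by (intro exI[of _ I] exI[of _ g] exI[of _ "1 / h ^ N"]) auto
qed

text \<open>A minimizing sequence of the Rayleigh quotient is Cauchy: by the parallelogram law the energy of
  differences is nearly \<open>\<mu>\<close> times their squared norm, and \<open>H10_finite_rank_estimate\<close> with
  \<open>\<eta> = 1/(\<mu>+1)\<close> controls the latter up to finitely many convergent functionals. Its limit is an
  eigenfunction for \<open>\<mu>\<close>.\<close>

lemma Rayleigh_minimizer:
  assumes \<mu>0: "\<mu> \<ge> 0" and low: "\<And>f. f \<in> H10 \<Omega> \<Longrightarrow> \<mu> * ip \<Omega> f f \<le> ip \<Omega> (B f) (B f)"
    and F: "\<And>n::nat. F n \<in> H10 \<Omega>" and F1: "\<And>n. ip \<Omega> (F n) (F n) = 1"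
    and Fm: "\<And>n. ip \<Omega> (B (F n)) (B (F n)) \<le> \<mu> + 1 / real (Suc n)"
  shows "\<exists>f\<in>H10 \<Omega>. ip \<Omega> f f = 1 \<and> ip \<Omega> (B f) (B f) = \<mu>"
proof -
  obtain I and g :: "('n \<Rightarrow> int) \<Rightarrow> 'n fld" and C where I: "finite I" and C: "C \<ge> 0"
    and g: "\<And>k. k \<in> I \<Longrightarrow> g k \<in> L2 \<Omega>"
    and est: "\<And>f. f \<in> H10 \<Omega> \<Longrightarrow> ip \<Omega> f f \<le> 1 / (\<mu> + 1) * ip \<Omega> (B f) (B f) + C * (\<Sum>k\<in>I. (ip \<Omega> f (g k))\<^sup>2)"
    using H10_finite_rank_estimate[of "1 / (\<mu> + 1)"] \<mu>0 by (auto simp: Ball_def)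
  have FL: "F n \<in> L2 \<Omega>" "B (F n) \<in> L2 \<Omega>" for n by (auto intro: H10_L2 B_L2 F)
  have bd: "bounded (range (\<lambda>n. ip \<Omega> (F n) (g k)))" if k: "k \<in> I" for k
  proof -
    have "norm (ip \<Omega> (F n) (g k)) \<le> nrm \<Omega> (g k)" for n
      using Cauchy_Schwarz_ip[OF FL(1)[of n] g[OF k]] F1[of n] by (simp add: nrm_def[of \<Omega> "F n"])
    then show ?thesis by (auto simp: bounded_iff)
  qed
  have "\<exists>r::nat\<Rightarrow>nat. strict_mono r \<and> (\<forall>k\<in>I. convergent ((\<lambda>n. ip \<Omega> (F n) (g k)) \<circ> r))"
    by (rule finite_family_convergent_subseq[OF I]) (rule bd)
  then obtain r :: "nat \<Rightarrow> nat" where r: "strict_mono r"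
    and conv: "\<And>k. k \<in> I \<Longrightarrow> convergent ((\<lambda>n. ip \<Omega> (F n) (g k)) \<circ> r)" by blast
  define L where "L k = lim (\<lambda>n. ip \<Omega> (F (r n)) (g k))" for k
  have Lk: "(\<lambda>n. ip \<Omega> (F (r n)) (g k)) \<longlonglongrightarrow> L k" if "k \<in> I" for k
    using conv[OF that] by (simp add: L_def convergent_LIMSEQ_iff o_def)
  \<comment> \<open>Two estimates are combined: the energy of a difference is at most \<mu> times
    its squared norm plus the first two terms of \<open>E\<close>, and \<mu>+1 times its squared
    norm is at most its energy plus the last term. Adding them leaves exactly one squared norm on
    the left; this is the reason for \<open>1 / (\<mu> + 1)\<close>.\<close>
  define E where "E m n = 2 / real (Suc m) + 2 / real (Suc n)
    + (\<mu> + 1) * C * (\<Sum>k\<in>I. (ip \<Omega> (F (r m)) (g k) - ip \<Omega> (F (r n)) (g k))\<^sup>2)" for m n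
  let ?d = "\<lambda>m n x. F (r m) x - F (r n) x" and ?dB = "\<lambda>m n x. B (F (r m)) x - B (F (r n)) x"
  have d: "(nrm \<Omega> (?d m n))\<^sup>2 \<le> E m n" and dB: "(nrm \<Omega> (?dB m n))\<^sup>2 \<le> (\<mu> + 1) * E m n" for m n
  proof -
    let ?f = "F (r m)" and ?h = "F (r n)"
    have eq: "?d m n = (\<lambda>x. (-1) * ?h x + ?f x)" by auto
    have dH: "?d m n \<in> H10 \<Omega>" unfolding eq by (intro H10_lincomb F)
    have dd: "(nrm \<Omega> (?d m n))\<^sup>2 = 2 - 2 * ip \<Omega> ?f ?h"
      using F1 by (simp add: nrm_square ip_square_diff FL)
    have bb: "ip \<Omega> (B (?d m n)) (B (?d m n)) = (nrm \<Omega> (?dB m n))\<^sup>2"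
      unfolding eq ip_B_lincomb[OF F F] by (simp add: nrm_square ip_square_diff FL ip_commute)
    \<comment> \<open>The lower bound applied to the sum of the two members; through the
      parallelogram law it limits the energy of their difference from above.\<close>
    have sum: "\<mu> * (2 + 2 * ip \<Omega> ?f ?h)
        \<le> ip \<Omega> (B ?f) (B ?f) + 2 * ip \<Omega> (B ?f) (B ?h) + ip \<Omega> (B ?h) (B ?h)"
      using low[OF H10_lincomb[OF F F, of 1 "r m" "r n"]] F1
      unfolding ip_B_lincomb[OF F F] ip_lincomb[OF F F] by simp
    have "1 / real (Suc (r k)) \<le> 1 / real (Suc k)" for k
      using seq_suble[OF r, of k] by (simp add: frac_le)
    then have Fr: "ip \<Omega> (B (F (r k))) (B (F (r k))) \<le> \<mu> + 1 / real (Suc k)" for k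
      using Fm[of "r k"] by (meson add_left_mono order_trans)
    have "(nrm \<Omega> (?dB m n))\<^sup>2 = 2 * ip \<Omega> (B ?f) (B ?f) + 2 * ip \<Omega> (B ?h) (B ?h)
        - (ip \<Omega> (B ?f) (B ?f) + 2 * ip \<Omega> (B ?f) (B ?h) + ip \<Omega> (B ?h) (B ?h))"
      by (simp add: nrm_square ip_square_diff FL)
    also have "\<dots> \<le> 2 * (\<mu> + 1 / real (Suc m)) + 2 * (\<mu> + 1 / real (Suc n)) - \<mu> * (2 + 2 * ip \<Omega> ?f ?h)"
      using sum Fr[of m] Fr[of n] by argo
    also have "\<dots> = \<mu> * (nrm \<Omega> (?d m n))\<^sup>2 + 2 / real (Suc m) + 2 / real (Suc n)"
      unfolding dd by (simp add: algebra_simps)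
    finally have b: "(nrm \<Omega> (?dB m n))\<^sup>2 \<le> \<mu> * (nrm \<Omega> (?d m n))\<^sup>2 + 2 / real (Suc m) + 2 / real (Suc n)" .
    let ?S = "\<Sum>k\<in>I. (ip \<Omega> ?f (g k) - ip \<Omega> ?h (g k))\<^sup>2"
    have "(\<Sum>k\<in>I. (ip \<Omega> (?d m n) (g k))\<^sup>2) = ?S"
      by (intro sum.cong) (auto simp: ip_diff_left FL g)
    then have "(nrm \<Omega> (?d m n))\<^sup>2 \<le> 1 / (\<mu> + 1) * (nrm \<Omega> (?dB m n))\<^sup>2 + C * ?S"
      using est[OF dH] bb by (simp add: nrm_square)
    then have "(\<mu> + 1) * (nrm \<Omega> (?d m n))\<^sup>2 \<le> (\<mu> + 1) * (1 / (\<mu> + 1) * (nrm \<Omega> (?dB m n))\<^sup>2 + C * ?S)"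
      using \<mu>0 by (intro mult_left_mono) auto
    also have "\<dots> = (nrm \<Omega> (?dB m n))\<^sup>2 + (\<mu> + 1) * C * ?S" using \<mu>0 by (simp add: field_simps)
    finally have "(\<mu> + 1) * (nrm \<Omega> (?d m n))\<^sup>2 \<le> (nrm \<Omega> (?dB m n))\<^sup>2 + (\<mu> + 1) * C * ?S" .
    then show D: "(nrm \<Omega> (?d m n))\<^sup>2 \<le> E m n" using b by (simp add: E_def algebra_simps)
    have "0 \<le> ?S" by (intro sum_nonneg) auto
    then have "2 / real (Suc m) + 2 / real (Suc n) \<le> E m n" using C \<mu>0 by (simp add: E_def)
    moreover have "\<mu> * (nrm \<Omega> (?d m n))\<^sup>2 \<le> \<mu> * E m n" using D \<mu>0 by (rule mult_left_mono)
    ultimately show "(nrm \<Omega> (?dB m n))\<^sup>2 \<le> (\<mu> + 1) * E m n" using b by (simp add: algebra_simps)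
  qed
  have El: "((\<lambda>(m, n). E m n) \<longlongrightarrow> 0) (sequentially \<times>\<^sub>F sequentially)"
  proof -
    note l = LIMSEQ_Suc[OF lim_1_over_n]
    have "((\<lambda>z. 2 * (1 / real (Suc (fst z))) + 2 * (1 / real (Suc (snd z)))
        + (\<mu> + 1) * C * (\<Sum>k\<in>I. (ip \<Omega> (F (r (fst z))) (g k) - ip \<Omega> (F (r (snd z))) (g k))\<^sup>2))
      \<longlongrightarrow> 2 * 0 + 2 * 0 + (\<mu> + 1) * C * (\<Sum>k\<in>I. (L k - L k)\<^sup>2)) (sequentially \<times>\<^sub>F sequentially)"
      by (intro tendsto_intros filterlim_compose[OF l filterlim_fst] filterlim_compose[OF l filterlim_snd]
          filterlim_compose[OF Lk filterlim_fst] filterlim_compose[OF Lk filterlim_snd])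
    then show ?thesis by (simp add: E_def case_prod_beta')
  qed
  have Cau: "\<exists>N. \<forall>m\<ge>N. \<forall>n\<ge>N. nrm \<Omega> (v m n) < e"
    if e: "e > 0" and v: "\<And>m n. (nrm \<Omega> (v m n))\<^sup>2 \<le> (\<mu> + 1) * E m n" for v and e :: real
  proof -
    have "0 < e\<^sup>2 / (\<mu> + 1)" using e \<mu>0 by simp
    from order_tendstoD(2)[OF El this] obtain N
      where N: "\<And>m n. m \<ge> N \<Longrightarrow> n \<ge> N \<Longrightarrow> E m n < e\<^sup>2 / (\<mu> + 1)"
      unfolding eventually_prod_sequentially by auto
    have "nrm \<Omega> (v m n) < e" if "m \<ge> N" "n \<ge> N" for m n
    proof (rule power2_less_imp_less)
      have "(\<mu> + 1) * E m n < e\<^sup>2" using N[OF that] \<mu>0 by (simp add: field_simps)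
      then show "(nrm \<Omega> (v m n))\<^sup>2 < e\<^sup>2" using v[of m n] by linarith
    qed (use e in simp)
    then show ?thesis by blast
  qed
  have d': "(nrm \<Omega> (?d m n))\<^sup>2 \<le> (\<mu> + 1) * E m n" for m n
  proof -
    have "0 \<le> E m n" using d[of m n] zero_le_power2 order_trans by blast
    then have "1 * E m n \<le> (\<mu> + 1) * E m n" using \<mu>0 by (intro mult_right_mono) auto
    then show ?thesis using d[of m n] by simp
  qed
  obtain f where f: "f \<in> L2 \<Omega>" "(\<lambda>n. nrm \<Omega> (\<lambda>x. F (r n) x - f x)) \<longlonglongrightarrow> 0"
    using L2_complete[of "\<lambda>n. F (r n)" \<Omega>, OF FL(1) Cau[OF _ d']] by blast
  obtain w where w: "w \<in> L2 \<Omega>" "(\<lambda>n. nrm \<Omega> (\<lambda>x. B (F (r n)) x - w x)) \<longlonglongrightarrow> 0"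
    using L2_complete[of "\<lambda>n. B (F (r n))" \<Omega>, OF FL(2) Cau[OF _ dB]] by blast
  have fH: "f \<in> H10 \<Omega>" and fw: "aeq \<Omega> (B f) w"
    using B_closed[OF F f(1) w(1) f(2) w(2)] by auto
  have "(\<lambda>n. ip \<Omega> (F (r n)) (F (r n))) \<longlonglongrightarrow> ip \<Omega> f f"
    using f FL by (intro ip_tendsto) auto
  then have "(\<lambda>n. 1) \<longlonglongrightarrow> ip \<Omega> f f" by (simp only: F1)
  then have ff: "ip \<Omega> f f = 1" by (rule LIMSEQ_unique[OF _ tendsto_const])
  have "(\<lambda>n. ip \<Omega> (B (F (r n))) (B (F (r n)))) \<longlonglongrightarrow> ip \<Omega> w w"
    using w FL by (intro ip_tendsto) auto
  moreover have "(\<lambda>n. \<mu> + 1 / real (Suc (r n))) \<longlonglongrightarrow> \<mu> + 0"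
    by (rule tendsto_add[OF tendsto_const
          filterlim_compose[OF LIMSEQ_Suc[OF lim_1_over_n] filterlim_subseq[OF r]]])
  ultimately have "ip \<Omega> w w \<le> \<mu> + 0" by (rule LIMSEQ_le) (use Fm in blast)
  moreover have "ip \<Omega> (B f) (B f) = ip \<Omega> w w"
    using ip_cong[OF fw fw B_L2[OF fH] w(1) B_L2[OF fH] w(1)] .
  ultimately have "ip \<Omega> (B f) (B f) = \<mu>" using low[OF fH] ff by simp
  then show ?thesis using fH ff by blast
qed

text \<open>The infimum \<mu> of the Rayleigh quotient is attained, and a minimizer \<open>f\<close>
  satisfies the Euler-Lagrange equation against all of \<open>H10\<close>. By the adjoint criterion
  \<open>B f\<close> lies in \<open>H10\<close> with \<open>B (B f) = \<mu> f\<close>, so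
  \<open>f\<close> is in the domain of \<open>A\<close> and \<mu> is an eigenvalue, hence at least
  \<open>lam\<close>.\<close>

lemma smallest_eigenvalue_Rayleigh:
  assumes lam: "is_smallest_eigenvalue \<Omega> (elliptic_dom \<Omega>) (elliptic_op \<Omega> M a0) lam" and v: "v \<in> H10 \<Omega>"
  shows "lam * ip \<Omega> v v \<le> ip \<Omega> (B v) (B v)"
proof (cases "ip \<Omega> v v = 0")
  case False
  define R where "R = {ip \<Omega> (B f) (B f) | f. f \<in> H10 \<Omega> \<and> ip \<Omega> f f = 1}"
  define \<mu> where "\<mu> = Inf R"
  have z: "(\<lambda>x. 0) \<in> H10 \<Omega>" using linear_B by (simp add: linear_operator_def)
  \<comment> \<open>For two zero functions and coefficient 1 the expansion reads X = 4 X.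
    \<open>B\<close> of zero is thus a null function, though perhaps not literally zero.\<close>
  have B0: "ip \<Omega> (B (\<lambda>x. 0)) (B (\<lambda>x. 0)) = 0"
    using ip_B_lincomb[OF z z, of 1] by simp
  have B0': "ip \<Omega> h (B (\<lambda>x. 0)) = 0" if "h \<in> L2 \<Omega>" for h
    using Cauchy_Schwarz_ip[OF that B_L2[OF z]] B0 by (simp add: nrm_def)
  have scale: "(\<lambda>x. c * f x) \<in> H10 \<Omega>" "ip \<Omega> (B (\<lambda>x. c * f x)) (B (\<lambda>x. c * f x)) = c\<^sup>2 * ip \<Omega> (B f) (B f)"
    if "f \<in> H10 \<Omega>" for f c
    using H10_lincomb[OF that z, of c] ip_B_lincomb[OF that z, of c] B0 B0'[OF B_L2[OF that]] by simp_all
  have normalize: "ip \<Omega> (B f) (B f) / ip \<Omega> f f \<in> R" if f: "f \<in> H10 \<Omega>" "ip \<Omega> f f \<noteq> 0" for f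
  proof -
    let ?c = "1 / nrm \<Omega> f"
    have c2: "?c\<^sup>2 = 1 / ip \<Omega> f f" by (simp add: power_divide nrm_square)
    have "ip \<Omega> (\<lambda>x. ?c * f x) (\<lambda>x. ?c * f x) = ?c\<^sup>2 * ip \<Omega> f f"
      by (simp only: ip_scale_left ip_scale_right) (simp only: power2_eq_square mult.assoc)
    then have "ip \<Omega> (\<lambda>x. ?c * f x) (\<lambda>x. ?c * f x) = 1" using c2 f by simp
    moreover have "ip \<Omega> (B f) (B f) / ip \<Omega> f f = ip \<Omega> (B (\<lambda>x. ?c * f x)) (B (\<lambda>x. ?c * f x))"
      unfolding scale(2)[OF f(1)] c2 by simp
    ultimately show ?thesis unfolding R_def using scale(1)[OF f(1)] by blast
  qed
  \<comment> \<open>The element \<open>v\<close> of nonzero norm is what makes the set of quotients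
    nonempty.\<close>
  have R: "R \<noteq> {}" using normalize[OF v False] by blast
  have Rb: "bdd_below R" by (rule bdd_belowI[of _ 0]) (auto simp: R_def)
  have \<mu>0: "\<mu> \<ge> 0" unfolding \<mu>_def by (rule cInf_greatest[OF R]) (auto simp: R_def)
  have low: "\<mu> * ip \<Omega> f f \<le> ip \<Omega> (B f) (B f)" if f: "f \<in> H10 \<Omega>" for f
  proof (cases "ip \<Omega> f f = 0")
    case False
    then have "ip \<Omega> f f > 0" by (simp add: order_less_le)
    moreover have "\<mu> \<le> ip \<Omega> (B f) (B f) / ip \<Omega> f f"
      unfolding \<mu>_def by (rule cInf_lower[OF normalize[OF f False] Rb])
    ultimately show ?thesis by (simp add: field_simps)
  qed simp
  have "\<forall>n::nat. \<exists>f. f \<in> H10 \<Omega> \<and> ip \<Omega> f f = 1 \<and> ip \<Omega> (B f) (B f) \<le> \<mu> + 1 / real (Suc n)"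
  proof
    fix n :: nat
    have "Inf R < \<mu> + 1 / real (Suc n)" by (simp add: \<mu>_def)
    then obtain y where "y \<in> R" "y < \<mu> + 1 / real (Suc n)" using cInf_lessD[OF R] by blast
    then show "\<exists>f. f \<in> H10 \<Omega> \<and> ip \<Omega> f f = 1 \<and> ip \<Omega> (B f) (B f) \<le> \<mu> + 1 / real (Suc n)"
      unfolding R_def by (auto intro: less_imp_le)
  qed
  then obtain F where F: "\<And>n::nat. F n \<in> H10 \<Omega>" "\<And>n. ip \<Omega> (F n) (F n) = 1"
    "\<And>n. ip \<Omega> (B (F n)) (B (F n)) \<le> \<mu> + 1 / real (Suc n)" by metis
  obtain f where f: "f \<in> H10 \<Omega>" "ip \<Omega> f f = 1" "ip \<Omega> (B f) (B f) = \<mu>"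
    using Rayleigh_minimizer[OF \<mu>0 low F] by blast
  have EL: "ip \<Omega> (B f) (B g) = ip \<Omega> (\<lambda>x. \<mu> * f x) g" if g: "g \<in> H10 \<Omega>" for g
  proof -
    \<comment> \<open>Energy minus \<mu> times squared norm, evaluated at the minimizer perturbed by
      \<open>t * g\<close>; the constant term vanishes because \<open>f\<close> attains the
      infimum.\<close>
    have "0 \<le> 2 * t * (ip \<Omega> (B g) (B f) - \<mu> * ip \<Omega> g f) + t\<^sup>2 * (ip \<Omega> (B g) (B g) - \<mu> * ip \<Omega> g g)" for t
      using low[OF H10_lincomb[OF g f(1), of t]] f(2,3)
      unfolding ip_B_lincomb[OF g f(1)] ip_lincomb[OF g f(1)] by (simp add: algebra_simps)
    then have "ip \<Omega> (B g) (B f) - \<mu> * ip \<Omega> g f = 0" by (rule quadratic_nonneg_imp_linear_zero)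
    then show ?thesis by (simp add: ip_commute[of \<Omega> g] ip_commute[of \<Omega> "B g"])
  qed
  have Bf: "B f \<in> H10 \<Omega> \<and> aeq \<Omega> (B (B f)) (\<lambda>x. \<mu> * f x)"
    by (rule B_adjointI[OF B_L2[OF f(1)] L2_scale[OF H10_L2[OF f(1)]] EL])
  then have dom: "f \<in> elliptic_dom \<Omega>" and "aeq \<Omega> (B (B f)) (elliptic_op \<Omega> M a0 f)"
    using sqrt_op f(1) by (auto simp: is_sqrt_operator_def)
  then have "aeq \<Omega> (elliptic_op \<Omega> M a0 f) (\<lambda>x. \<mu> * f x)" using Bf aeq_sym aeq_trans by blast
  moreover have "\<not> aeq \<Omega> f (\<lambda>x. 0)" using f nrm_eq_0_iff[OF H10_L2[OF f(1)]] by (simp add: nrm_def)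
  ultimately have "is_eigenvalue \<Omega> (elliptic_dom \<Omega>) (elliptic_op \<Omega> M a0) \<mu>"
    unfolding is_eigenvalue_def using dom by blast
  then have "lam \<le> \<mu>" using lam by (simp add: is_smallest_eigenvalue_def)
  then have "lam * ip \<Omega> v v \<le> \<mu> * ip \<Omega> v v" by (intro mult_right_mono) auto
  then show ?thesis using low[OF v] by simp
qed simp

section \<open>Time derivatives in the graph norm\<close>

lemma B_difference_quotient:
  assumes "f \<in> H10 \<Omega>" "g \<in> H10 \<Omega>" "h \<in> H10 \<Omega>"
  shows "(\<lambda>x. (f x - g x) / c - h x) \<in> H10 \<Omega>"
    and "aeq \<Omega> (B (\<lambda>x. (f x - g x) / c - h x)) (\<lambda>x. (B f x - B g x) / c - B h x)"
proof -
  let ?z = "\<lambda>x. (-1) * h x + 0" and ?k = "1 / c"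
  let ?y = "\<lambda>x. (- ?k) * g x + ?z x"
  have z0: "(\<lambda>x. 0) \<in> H10 \<Omega>" by (rule test_function_H10[OF test_function_zero])
  have B0: "aeq \<Omega> (B (\<lambda>x. 0)) (\<lambda>x. 0)"
    using B_lincomb[OF z0 z0, of 1] by (auto simp: aeq_def)
  have z: "?z \<in> H10 \<Omega>" by (rule H10_lincomb[OF assms(3) z0])
  have y: "?y \<in> H10 \<Omega>" by (rule H10_lincomb[OF assms(2) z])
  have q: "(\<lambda>x. ?k * f x + ?y x) = (\<lambda>x. (f x - g x) / c - h x)" by (auto simp: diff_divide_distrib)
  show "(\<lambda>x. (f x - g x) / c - h x) \<in> H10 \<Omega>"
    using H10_lincomb[OF assms(1) y, of ?k] unfolding q .
  show "aeq \<Omega> (B (\<lambda>x. (f x - g x) / c - h x)) (\<lambda>x. (B f x - B g x) / c - B h x)"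
    using B_lincomb[OF assms(1) y, of ?k] B_lincomb[OF assms(2) z, of "- ?k"]
      B_lincomb[OF assms(3) z0, of "-1"] B0
    unfolding q aeq_def by eventually_elim (simp add: diff_divide_distrib)
qed

text \<open>The graph norm dominates the norm of a function and that of its image under
  \<open>B\<close>. Differentiability in the form domain therefore splits into two statements in
  \<open>L2\<close>, to which the product rule applies.\<close>

lemma graph_norm_time_deriv:
  assumes w: "\<And>s. 0 \<le> s \<Longrightarrow> w s \<in> H10 \<Omega>" and w': "w' \<in> H10 \<Omega>" and t: "0 \<le> t"
    and d: "has_time_deriv (graph_norm \<Omega> B) w w' t"
  shows "has_time_deriv (nrm \<Omega>) w w' t" and "has_time_deriv (nrm \<Omega>) (\<lambda>s. B (w s)) (B w') t"
proof -
  let ?q = "\<lambda>s x. (w s x - w t x) / (s - t) - w' x"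
  let ?r = "\<lambda>s x. (B (w s) x - B (w t) x) / (s - t) - B w' x"
  note lim = d[unfolded has_time_deriv_def]
  have "nrm \<Omega> (?q s) \<le> graph_norm \<Omega> B (?q s)" for s
    unfolding graph_norm_def by (rule real_le_rsqrt) simp
  then show "has_time_deriv (nrm \<Omega>) w w' t"
    unfolding has_time_deriv_def by (intro Lim_null_comparison[OF always_eventually lim]) simp
  have "norm (nrm \<Omega> (?r s)) \<le> graph_norm \<Omega> B (?q s)" if s: "0 \<le> s \<and> s \<noteq> t" for s
  proof -
    have H: "w s \<in> H10 \<Omega>" "w t \<in> H10 \<Omega>" using w s t by auto
    note D = B_difference_quotient[OF H w', of "s - t"]
    have "nrm \<Omega> (B (?q s)) = nrm \<Omega> (?r s)"
      using H w' by (intro nrm_cong[OF D(2)] B_L2[OF D(1)] L2_diff L2_divide B_L2)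
    then have "nrm \<Omega> (?r s) \<le> graph_norm \<Omega> B (?q s)"
      unfolding graph_norm_def by (intro real_le_rsqrt) simp
    then show ?thesis by simp
  qed
  then show "has_time_deriv (nrm \<Omega>) (\<lambda>s. B (w s)) (B w') t"
    unfolding has_time_deriv_def
    by (intro Lim_null_comparison[OF eventually_mono[OF eventually_at_within_atLeast] lim])
qed

end

section \<open>Energy decay of the time derivatives\<close>

text \<open>For a test function fixed in time the left side of order \<open>k\<close> vanishes for
  all positive times, so its time derivative, the left side of order \<open>k + 1\<close>, vanishes
  too. \<open>W i\<close> stands for \<open>B\<close> applied to the derivative of order
  \<open>i\<close> and is available one order less far than \<open>V\<close>.\<close>

lemma weak_equation_derivatives:
  fixes V :: "nat \<Rightarrow> real \<Rightarrow> ('n::finite) fld"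
  assumes VL: "\<And>i t. i \<le> j \<Longrightarrow> 0 \<le> t \<Longrightarrow> V i t \<in> L2 \<Omega>"
    and dV: "\<And>i t. i < j \<Longrightarrow> 0 \<le> t \<Longrightarrow> has_time_deriv (nrm \<Omega>) (V i) (V (Suc i) t) t"
    and WL: "\<And>i t. i < j \<Longrightarrow> 0 \<le> t \<Longrightarrow> W i t \<in> L2 \<Omega>"
    and dW: "\<And>i t. Suc i < j \<Longrightarrow> 0 \<le> t \<Longrightarrow> has_time_deriv (nrm \<Omega>) (W i) (W (Suc i) t) t"
    and w: "w \<in> L2 \<Omega>" and b: "b \<in> L2 \<Omega>"
    and eq: "\<And>t. 0 < t \<Longrightarrow> ip \<Omega> (V 2 t) w + \<alpha> * ip \<Omega> (V 1 t) w + ip \<Omega> (W 0 t) b = 0"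
    and k: "k + 2 \<le> j" and t: "0 < t"
  shows "ip \<Omega> (V (k + 2) t) w + \<alpha> * ip \<Omega> (V (k + 1) t) w + ip \<Omega> (W k t) b = 0"
  using k t
proof (induction k arbitrary: t)
  case 0
  then show ?case using eq by (simp add: numeral_2_eq_2)
next
  case (Suc k)
  let ?\<phi> = "\<lambda>s. ip \<Omega> (V (k + 2) s) w + \<alpha> * ip \<Omega> (V (k + 1) s) w + ip \<Omega> (W k s) b"
  let ?D = "ip \<Omega> (V (Suc k + 2) t) w + \<alpha> * ip \<Omega> (V (Suc k + 1) t) w + ip \<Omega> (W (Suc k) t) b"
  have der: "((\<lambda>s. ip \<Omega> (U s) h) has_real_derivative ip \<Omega> U' h) (at t within {0..})"
    if "\<And>s. 0 \<le> s \<Longrightarrow> U s \<in> L2 \<Omega>" "U' \<in> L2 \<Omega>" "h \<in> L2 \<Omega>" "has_time_deriv (nrm \<Omega>) U U' t" for U U' h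
    using ip_has_real_derivative[OF that(1) _ that(2) L2_zero _ that(4) has_time_deriv_const[of \<Omega> h]]
      that(3) Suc.prems by simp
  have "(?\<phi> has_real_derivative ?D) (at t within {0..})"
    using Suc.prems VL dV[of "k + 2" t] dV[of "k + 1" t] WL dW[of k t] w b
    by (intro DERIV_add DERIV_cmult der) auto
  moreover have "at t within {0..} = at t" using Suc.prems by (intro at_within_interior) auto
  ultimately have "(?\<phi> has_real_derivative ?D) (at t)" by simp
  moreover have "(?\<phi> has_real_derivative 0) (at t)"
  proof (rule has_field_derivative_transform_within_open[of "\<lambda>_. 0" _ _ "{0<..}"])
    show "0 = ?\<phi> s" if "s \<in> {0<..}" for s using Suc.IH[of s] Suc.prems that by simp
  qed (use Suc.prems in auto)
  ultimately show ?case by (rule DERIV_unique)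
qed

theorem theorem2p3:
  fixes \<Omega> :: "(real^'n::finite) set"
    and M :: "real^'n \<Rightarrow> real^'n^'n"
    and a0 :: "real^'n \<Rightarrow> real"
    and A_half :: "(real^'n \<Rightarrow> real) \<Rightarrow> (real^'n \<Rightarrow> real)"
    and lam1 \<alpha> \<delta> :: real
    and j :: nat
    and u :: "real \<Rightarrow> real^'n \<Rightarrow> real"
    and u0 u1 :: "real^'n \<Rightarrow> real"
  assumes "convex_polytopal_domain \<Omega>"
    and "admissible_coefficients \<Omega> M a0"
    and "is_sqrt_operator \<Omega> (H10 \<Omega>) A_half (elliptic_dom \<Omega>) (elliptic_op \<Omega> M a0)"
    and "is_smallest_eigenvalue \<Omega> (elliptic_dom \<Omega>) (elliptic_op \<Omega> M a0) lam1"
    and "\<alpha> > 0"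
    and "j \<ge> 2"
    and "C_time (L2 \<Omega>) (nrm \<Omega>) j u"
    and "C_time (H10 \<Omega>) (graph_norm \<Omega> A_half) (j - 1) u"
    and "weak_damped_wave \<Omega> (H10 \<Omega>) A_half \<alpha> u"
    and "aeq \<Omega> (u 0) u0"
    and "aeq \<Omega> (time_deriv \<Omega> 1 u 0) u1"
    and "0 < \<delta>"
    and "\<delta> \<le> 1/3 * min \<alpha> (lam1 / (2 * \<alpha>))"
  shows "\<forall>t\<ge>0. energy \<Omega> A_half j u t \<le> 3 * exp (- 2 * \<delta> * t) * energy \<Omega> A_half j u 0"
proof -
  from assms(1) obtain P where "polytope P" "\<Omega> = interior P" by (auto simp: convex_polytopal_domain_def)
  then have "open \<Omega>" "bounded \<Omega>"
    by (auto intro: bounded_subset[OF polytope_imp_bounded interior_subset])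
  then interpret elliptic_sqrt \<Omega> M a0 A_half
    using assms(2,3) by (simp add: elliptic_sqrt_def)
  let ?B = A_half
  from C_time_chain[OF assms(7)] obtain V where V0: "V 0 = u"
    and "\<forall>i\<le>j. \<forall>t\<ge>0. V i t \<in> L2 \<Omega>"
    and "\<forall>i<j. \<forall>t\<ge>0. has_time_deriv (nrm \<Omega>) (V i) (V (Suc i) t) t"
    and "\<forall>t\<ge>0. ((\<lambda>s. nrm \<Omega> (\<lambda>x. V j s x - V j t x)) \<longlongrightarrow> 0) (at t within {0..})"
    by (elim exE conjE) (rule that)
  then have VL: "\<And>i t. i \<le> j \<Longrightarrow> 0 \<le> t \<Longrightarrow> V i t \<in> L2 \<Omega>"
    and dV: "\<And>i t. i < j \<Longrightarrow> 0 \<le> t \<Longrightarrow> has_time_deriv (nrm \<Omega>) (V i) (V (Suc i) t) t"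
    and cV: "\<And>t. 0 \<le> t \<Longrightarrow> ((\<lambda>s. nrm \<Omega> (\<lambda>x. V j s x - V j t x)) \<longlongrightarrow> 0) (at t within {0..})"
    by simp_all
  from C_time_chain[OF assms(8)] obtain W where W0: "W 0 = u"
    and "\<forall>i\<le>j - 1. \<forall>t\<ge>0. W i t \<in> H10 \<Omega>"
    and "\<forall>i<j - 1. \<forall>t\<ge>0. has_time_deriv (graph_norm \<Omega> ?B) (W i) (W (Suc i) t) t"
    by (elim exE conjE) (rule that)
  then have WH: "\<And>i t. i \<le> j - 1 \<Longrightarrow> 0 \<le> t \<Longrightarrow> W i t \<in> H10 \<Omega>"
    and dW: "\<And>i t. i < j - 1 \<Longrightarrow> 0 \<le> t \<Longrightarrow> has_time_deriv (graph_norm \<Omega> ?B) (W i) (W (Suc i) t) t"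
    by simp_all
  have WL: "W i t \<in> L2 \<Omega>" "?B (W i t) \<in> L2 \<Omega>" if "i \<le> j - 1" "0 \<le> t" for i t
    using WH[OF that] by (auto intro: H10_L2 B_L2)
  have dW0: "has_time_deriv (nrm \<Omega>) (W i) (W (Suc i) t) t"
    and dW1: "has_time_deriv (nrm \<Omega>) (\<lambda>s. ?B (W i s)) (?B (W (Suc i) t)) t" if i: "i < j - 1" "0 \<le> t" for i t
    using graph_norm_time_deriv[OF _ _ i(2) dW[OF i]] WH i by auto
  \<comment> \<open>The derivatives in \<open>L2\<close> and those in the form domain come from
    separate existence statements. Both chains start at \<open>u\<close>, and uniqueness in the
    weaker norm identifies them.\<close>
  have VW: "aeq \<Omega> (V i t) (W i t)" if "i \<le> j - 1" "0 \<le> t" for i t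
    using that
  proof (induction i arbitrary: t)
    case 0
    then show ?case by (simp add: V0 W0)
  next
    case (Suc i)
    have "has_time_deriv (nrm \<Omega>) (W i) (V (Suc i) t) t"
      by (rule has_time_deriv_cong[of \<Omega> "V i" _ "V (Suc i) t"]) (use Suc VL WL dV in auto)
    then show ?case
      by (intro has_time_deriv_unique[of "W i"]) (use Suc.prems VL WL dW0 in auto)
  qed
  have td: "time_deriv \<Omega> i u t \<in> L2 \<Omega> \<and> aeq \<Omega> (V i t) (time_deriv \<Omega> i u t)" if "i \<le> j" "0 \<le> t" for i t
    using time_deriv_aeq_chain[of j V \<Omega>, OF VL dV that] V0 by simp
  \<comment> \<open>The derivative of order \<open>m\<close> is the solution to which the decay
    result applies; writing \<open>j\<close> this way also avoids truncated subtraction.\<close>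
  obtain m where j: "j = m + 2" using assms(6) by (metis add.commute le_Suc_ex)
  have weak: "ip \<Omega> (V (m + 2) t) w + \<alpha> * ip \<Omega> (V (m + 1) t) w + ip \<Omega> (?B (W m t)) (?B w) = 0"
    if w: "w \<in> H10 \<Omega>" and t: "0 < t" for t w
  proof (rule weak_equation_derivatives[of j V, OF VL dV _ _ H10_L2[OF w] B_L2[OF w]])
    fix s :: real assume s: "0 < s"
    have "ip \<Omega> (V i s) w = ip \<Omega> (time_deriv \<Omega> i u s) w" if "i \<le> j" for i
      using td[OF that, of s] VL[OF that, of s] s w by (intro ip_cong) (auto intro: H10_L2)
    then show "ip \<Omega> (V 2 s) w + \<alpha> * ip \<Omega> (V 1 s) w + ip \<Omega> (?B (W 0 s)) (?B w) = 0"
      using assms(9) s w j by (simp add: weak_damped_wave_def energy_form_def W0)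
  qed (use t j WL dW1 in auto)
  \<comment> \<open>Extension to time 0, where forward difference quotients start. The derivative of
    order \<open>j\<close> is merely continuous, by \<open>cV\<close>; the other two terms are
    continuous because they are differentiable.\<close>
  have weak0: "ip \<Omega> (V (m + 2) t) w + \<alpha> * ip \<Omega> (W (m + 1) t) w + ip \<Omega> (?B (W m t)) (?B w) = 0"
    if t: "0 \<le> t" and w: "w \<in> H10 \<Omega>" for t w
  proof -
    have eqW: "ip \<Omega> (W (m + 1) s) w = ip \<Omega> (V (m + 1) s) w" if "0 \<le> s" for s
      using VW[of "m + 1" s] VL[of "m + 1" s] WL[of "m + 1" s] that w j
      by (intro ip_cong) (auto intro: H10_L2 aeq_sym)
    let ?\<phi> = "\<lambda>s. ip \<Omega> (V (m + 2) s) w + \<alpha> * ip \<Omega> (V (m + 1) s) w + ip \<Omega> (?B (W m s)) (?B w)"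
    have L: "w \<in> L2 \<Omega>" "?B w \<in> L2 \<Omega>" using w by (auto intro: H10_L2 B_L2)
    have lim: "((\<lambda>s. ip \<Omega> (U s) h) \<longlongrightarrow> ip \<Omega> (U t) h) (at t within {0..})"
      if "\<And>s. 0 \<le> s \<Longrightarrow> U s \<in> L2 \<Omega>" "h \<in> L2 \<Omega>"
        "((\<lambda>s. nrm \<Omega> (\<lambda>x. U s x - U t x)) \<longlongrightarrow> 0) (at t within {0..})" for U h
      using that t
      by (intro ip_tendsto) (auto simp: nrm_def intro!: eventually_mono[OF eventually_at_within_atLeast])
    have "(?\<phi> \<longlongrightarrow> ?\<phi> t) (at t within {0..})"
    proof (intro tendsto_add tendsto_mult_left lim)
      show "((\<lambda>s. nrm \<Omega> (\<lambda>x. V (m + 2) s x - V (m + 2) t x)) \<longlongrightarrow> 0) (at t within {0..})"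
        using cV[OF t] j by simp
      show "((\<lambda>s. nrm \<Omega> (\<lambda>x. V (m + 1) s x - V (m + 1) t x)) \<longlongrightarrow> 0) (at t within {0..})"
        by (rule has_time_deriv_imp_continuous[OF _ _ t dV]) (use VL t j in auto)
      show "((\<lambda>s. nrm \<Omega> (\<lambda>x. ?B (W m s) x - ?B (W m t) x)) \<longlongrightarrow> 0) (at t within {0..})"
        by (rule has_time_deriv_imp_continuous[OF _ _ t dW1]) (use WL t j in auto)
    qed (use VL WL L j in auto)
    moreover have "\<forall>\<^sub>F s in at t within {0..}. ?\<phi> s = 0" if "t = 0"
      using weak[OF w] that by (auto simp: eventually_at_filter)
    ultimately have "?\<phi> t = 0"
      using weak[OF w, of t] t at_within_atLeast_neq_bot[OF t]
      by (cases "t = 0") (auto dest!: tendsto_eventually intro: tendsto_unique)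
    then show ?thesis using eqW[OF t] by simp
  qed
  \<comment> \<open>The triple \<open>z\<close>, \<open>p\<close>, \<open>q\<close> is
    \<open>W m\<close>, \<open>W (m + 1)\<close>, \<open>V (m + 2)\<close>: the last one need only
    lie in \<open>L2\<close>, which is the regularity assumed for the derivative of order
    \<open>j\<close>.\<close>
  have decay: "ip \<Omega> (V (m + 2) t) (V (m + 2) t) + ip \<Omega> (?B (W (m + 1) t)) (?B (W (m + 1) t))
    \<le> 3 * exp (- 2 * \<delta> * t) * (ip \<Omega> (V (m + 2) 0) (V (m + 2) 0) + ip \<Omega> (?B (W (m + 1) 0)) (?B (W (m + 1) 0)))"
    if t: "0 \<le> t" for t
  proof (rule derivative_damped_wave_decay[OF linear_B _ assms(5,12,13), where z = "W m"])
    show "has_time_deriv (nrm \<Omega>) (W (m + 1)) (V (m + 2) s) s" if s: "0 \<le> s" for s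
      by (rule has_time_deriv_cong[of \<Omega> "V (m + 1)" _ "V (m + 2) s"])
         (use VL WL VW dV[of "m + 1" s] s j in auto)
    show "lam1 * ip \<Omega> f f \<le> ip \<Omega> (?B f) (?B f)" if "f \<in> H10 \<Omega>" for f
      by (rule smallest_eigenvalue_Rayleigh[OF assms(4) that])
  qed (use WH VL dW0[of m] dW1[of m] weak0 t j in auto)
  have energy: "energy \<Omega> ?B j u t
      = 1/2 * (ip \<Omega> (V (m + 2) t) (V (m + 2) t) + ip \<Omega> (?B (W (m + 1) t)) (?B (W (m + 1) t)))" if t: "0 \<le> t" for t
  proof -
    have "nrm \<Omega> (time_deriv \<Omega> j u t) = nrm \<Omega> (V (m + 2) t)"
      using td[of j t] VL[of j t] t j by (intro nrm_cong[OF aeq_sym]) auto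
    moreover have "nrm \<Omega> (?B (time_deriv \<Omega> (j - 1) u t)) = nrm \<Omega> (?B (W (m + 1) t))"
    proof -
      \<comment> \<open>The derivative chosen by \<open>time_deriv\<close> is a priori only in
        \<open>L2\<close>, where values of \<open>B\<close> mean nothing. As it equals
        \<open>W (m + 1) t\<close> almost everywhere, the adjoint criterion puts it into
        \<open>H10\<close> with the same image.\<close>
      let ?v = "time_deriv \<Omega> (j - 1) u t"
      have w: "W (m + 1) t \<in> H10 \<Omega>" using WH t j by simp
      have v: "?v \<in> L2 \<Omega>" using td[of "j - 1" t] t by simp
      have "aeq \<Omega> (W (m + 1) t) ?v"
        using aeq_trans[OF aeq_sym[OF VW[of "m + 1" t]] conjunct2[OF td[of "m + 1" t]]] t j by simp
      then have "ip \<Omega> ?v (?B g) = ip \<Omega> (?B (W (m + 1) t)) g" if "g \<in> H10 \<Omega>" for g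
        using B_symmetric[OF w that] ip_cong[of \<Omega> "W (m + 1) t" ?v "?B g" "?B g"] w v that
        by (simp add: H10_L2 B_L2)
      then have "?v \<in> H10 \<Omega> \<and> aeq \<Omega> (?B ?v) (?B (W (m + 1) t))"
        by (rule B_adjointI[OF v B_L2[OF w]])
      then show ?thesis using w by (intro nrm_cong) (auto intro: B_L2)
    qed
    ultimately show ?thesis by (simp add: energy_def nrm_square)
  qed
  show ?thesis
  proof (intro allI impI)
    fix t :: real assume t: "0 \<le> t"
    show "energy \<Omega> ?B j u t \<le> 3 * exp (- 2 * \<delta> * t) * energy \<Omega> ?B j u 0"
      unfolding energy[OF t] energy[OF order_refl] using decay[OF t] by simp
  qed
qed

end
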